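(* Let $\Delta t>0$ be a time step, $T>0$ a final time, $N_T:=\lfloor T/\Delta t\rfloor$, $t^n:=n\Delta t$, and $\gamma_*:=1-1/\sqrt2$ (the smallest root of $X^2-2X+\frac12$). For $\varepsilon\in(0,1]$ and initial data $(\mathbf Z^0(\varepsilon),\mathbf u_\perp^0(\varepsilon))$, let $(\mathbf Z^n(\varepsilon),\mathbf u_\perp^n(\varepsilon))_{0\le n\le N_T}$ be the sequence obtained from the following two-stage scheme (the objects $\mathbf J_0,\mathbf F,\mathbf U_\perp,\overline{\mathbf U}_\perp,b$ and the standing assumptions are given in the context). First stage: $$\frac{\mathbf Z^{(1)}-\mathbf Z^n}{\Delta t}=\gamma_*\mathbf F(t^n,\mathbf Z^n,\mathbf u_\perp^{(1)}),\qquad \mathbf J_0\frac{\mathbf u_\perp^{(1)}-\mathbf u_\perp^n}{\Delta t}=\gamma_*\Big[\mathbf U_\perp(t^n,\mathbf Z^n,\mathbf u_\perp^n)-\frac{b(\mathbf Z^n)\mathbf u_\perp^{(1)}}{\varepsilon}\Big].$$ Then set $\hat t^{(1)}=t^n+\frac{\Delta t}{2\gamma_*}$, $\hat{\mathbf Z}^{(1)}=\big(1-\frac1{2\gamma_*^2}\big)\mathbf Z^n+\frac1{2\gamma_*^2}\mathbf Z^{(1)}$, $\hat{\mathbf u}_\perp^{(1)}=\big(1-\frac1{2\gamma_*^2}\big)\mathbf u_\perp^n+\frac1{2\gamma_*^2}\mathbf u_\perp^{(1)}$. Second stage: $$\frac{\mathbf Z^{n+1}-\mathbf Z^n}{\Delta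 t}=(1-\gamma_* )\mathbf F(t^n,\mathbf Z^n,\mathbf u_\perp^{(1)})+\gamma_*\mathbf F(\hat t^{(1)},\hat{\mathbf Z}^{(1)},\mathbf u_\perp^{n+1}),$$ $$\mathbf J_0\frac{\mathbf u_\perp^{n+1}-\mathbf u_\perp^n}{\Delta t}=(1-\gamma_* )\Big[\mathbf U_\perp(t^n,\mathbf Z^n,\mathbf u_\perp^n)-\frac{b(\mathbf Z^n)\mathbf u_\perp^{(1)}}{\varepsilon}\Big]+\gamma_*\Big[\mathbf U_\perp(\hat t^{(1)},\hat{\mathbf Z}^{(1)},\hat{\mathbf u}_\perp^{(1)})-\frac{b(\hat{\mathbf Z}^{(1)})\mathbf u_\perp^{n+1}}{\varepsilon}\Big].$$ (i) Assume that $(\mathbf Z^0(\varepsilon),\sqrt\varepsilon\,\mathbf u_\perp^0(\varepsilon))_{\varepsilon>0}$ converges, as $\varepsilon\to0$, to $(\mathbf Z^0,0)$ for some $\mathbf Z^0$. Then, for any $1\le n\le N_T$, $(\mathbf Z^n(\varepsilon),\mathbf u_\perp^n(\varepsilon))_{\varepsilon>0}$ converges to $(\mathbf Z^n,0)$ as $\varepsilon\to0$, where $(\mathbf Z^n)_{0\le n\le N_T}$ starts from $\mathbf Z^0$ and satisfies $$\frac{\hat{\mathbf Z}^{(1)}-\mathbf Z^n}{\Delta t}=\frac1{2\gamma_*}\mathbf F(t^n,\mathbf Z^n,0),\qquad \frac{\mathbf Z^{n+1}-\mathbf Z^n}{\Delta t}=(1-\gamma_* )\mathbf F(t^n,\mathbf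 Z^n,0)+\gamma_*\mathbf F(\hat t^{(1)},\hat{\mathbf Z}^{(1)},0),\tag{A}$$ which provides a consistent second-order approximation with respect to $\Delta t$ of the gyro-kinetic system $\frac{d\mathbf Z}{dt}=\mathbf F(t,\mathbf Z,0)$. (ii) Alternatively, make the stronger assumption that for some $M>0$ and some $\mathbf Z^0$, the family $\big((\mathbf Z^0(\varepsilon)-\mathbf Z^0)/\varepsilon,\ \mathbf u_\perp^0(\varepsilon)\big)_{\varepsilon>0}$ is bounded by $M$, uniformly with respect to $\varepsilon$. Then, for some $C_M$ depending only on $M$, $\Delta t$ and $T$, for any $1\le n\le N_T$, $$\|\mathbf Z^n(\varepsilon)-\mathbf Z^n\|+\|\mathbf u_\perp^n(\varepsilon)\|\le C_M\,\varepsilon,$$ where $(\mathbf Z^n)_{0\le n\le N_T}$ is obtained from (A), and, for any $2\le n\le N_T$, $$\|\mathbf Z^n(\varepsilon)-\mathbf Y^n(\varepsilon)\|+\left\|\mathbf u_\perp^n(\varepsilon)-\varepsilon\,\frac{\overline{\mathbf U}_\perp(t^{n-1},\mathbf Y^{n-1}(\varepsilon))}{b(\mathbf Y^{n-1}(\varepsilon))}\right\|\le C_M\,\varepsilon^2,$$ where $(\mathbf Y^n(\varepsilon))_{1\le n\le N_T}$ is obtained from $\mathbf Y^1(\varepsilon)=\mathbf Z^1(\varepsilon)$ and, for $1\le n\le N_T-1$ (omitting the dependence on $\varepsilon$, and with $\hat t^{(1)}=t^n+\frac{\Delta t}{2\gamma_*}$), $$\frac{\hat{\mathbf Y}^{(1)}-\mathbf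 Y^n}{\Delta t}=\frac1{2\gamma_*}\mathbf F\Big(t^n,\mathbf Y^n,\varepsilon\tfrac{\overline{\mathbf U}_\perp(t^n,\mathbf Y^n)}{b(\mathbf Y^n)}\Big),$$ $$\frac{\mathbf Y^{n+1}-\mathbf Y^n}{\Delta t}=(1-\gamma_* )\mathbf F\Big(t^n,\mathbf Y^n,\varepsilon\tfrac{\overline{\mathbf U}_\perp(t^n,\mathbf Y^n)}{b(\mathbf Y^n)}\Big)+\gamma_*\mathbf F\Big(\hat t^{(1)},\hat{\mathbf Y}^{(1)},\varepsilon\tfrac{\overline{\mathbf U}_\perp(\hat t^{(1)},\hat{\mathbf Y}^{(1)})}{b(\hat{\mathbf Y}^{(1)})}\Big),$$ which provides a consistent second-order approximation with respect to $\Delta t$ of the system $\frac{d\mathbf Z}{dt}=\mathbf F\big(t,\mathbf Z,\tfrac{\varepsilon}{b(\mathbf Z)}\overline{\mathbf U}_\perp(t,\mathbf Z)\big)$.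
   Context: Variables: $\mathbf Z=(r,\varphi,\theta,v_\parallel,b\mu)$, where $b\mu$ is a single independent real variable, and $\mathbf u_\perp=(u_r,u_\perp)\in\mathbb R^2$. Here $(r,\theta,\varphi)$ are toroidal coordinates: $R_0>0$ is fixed, $r\in(0,R_0)$, $\theta,\varphi$ are angles (all fields are $2\pi$-periodic in them; in the schemes the angles are handled as real variables), and $R=R(r,\theta)=R_0+r\cos\theta$. Fixed data: real functions $b=b(r,\theta)>0$ (magnetic field intensity) and $\omega=\omega(r,\theta)$ (magnetic field direction angle), and functions $E_r,E_\theta,E_\varphi$ of $(t,r,\theta,\varphi)$ (components of the electric field in the toroidal orthonormal frame). Set $E_\parallel=\cos\omega\,E_\varphi+\sin\omega\,E_\theta$, $E_\perp=\sin\omega\,E_\varphi-\cos\omega\,E_\theta$, $\mathbf E_\perp=(E_r,E_\perp)$. Write $b(\mathbf Z)=b(r,\theta)$ and $\mu:=(b\mu)/b(r,\theta)$. Standing assumptions: the fields are boundedly smooth, $b$ does not vanish, and $\varepsilon$ is bounded above, say by $1$. Coefficients, functions of $(r,\theta)$ (the function $\gamma$ is unrelated to the number $\gamma_*$): $\alpha=-\frac{\partial_\theta\omega}{r}\sin\omega-\frac{\sin\theta}{R}\cos\omega$, $\ \beta=\frac{\partial_\theta\omega}{r}\cos\omega-\frac{\sin\theta}{R}\sin\omega$, $\ \gamma=-\frac{\sin^2\omega}{r}-\frac{\cos\theta}{R}\cos^2\omega$, $\ \delta=-\big(\frac{\cos\theta}{R}-\frac1r\big)\sin\omega\cos\omega$,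 $\ \zeta=\frac{\cos^2\omega}{r}+\frac{\cos\theta}{R}\sin^2\omega$, $\ \eta=-\frac{\sin\omega}{r}\frac{\partial_\theta b}{b}$, $\ \kappa=\frac{\cos\omega}{r}\frac{\partial_\theta b}{b}$, $\ \lambda=-\frac{\partial_r b}{b}$. $\mathbf J_0=\begin{pmatrix}0&1\\-1&0\end{pmatrix}$. $$\mathbf F(t,\mathbf Z,\mathbf u_\perp)=\Big(b\,u_r,\ \tfrac{\cos\omega\,v_\parallel+b\sin\omega\,u_\perp}{R},\ \tfrac{\sin\omega\,v_\parallel-b\cos\omega\,u_\perp}{r},\ E_\parallel+F_\parallel,\ -v_\parallel F_\parallel+b\langle\mathbf E_\perp,\mathbf u_\perp\rangle\Big),$$ $$F_\parallel=b\Big[(\gamma u_r+\alpha u_\perp)v_\parallel+b(\delta-\partial_r\omega)u_\perp u_r+\beta\Big(\mu+b\,\tfrac{u_\perp^2-u_r^2}{2}\Big)\Big].$$ $\mathbf U_\perp(t,\mathbf Z,\mathbf u_\perp)=(U_r,U_\perp)$ with $$U_r=\tfrac{E_\perp}{b}-\tfrac{\alpha}{b}v_\parallel^2+(\partial_r\omega+\delta)v_\parallel u_r+(\eta-\beta)v_\parallel u_\perp+b(\lambda-\zeta)u_ru_\perp+\kappa\Big(\mu+b\,\tfrac{u_\perp^2-u_r^2}{2}\Big),$$ $$U_\perp=-\tfrac{E_r}{b}+2\delta v_\parallel u_\perp-\zeta b u_\perp^2+\tfrac{\gamma}{b}v_\parallel^2-\eta u_rv_\parallel-\kappa b\,u_ru_\perp-\lambda\Big(\mu-b\,\tfrac{u_\perp^2-u_r^2}{2}\Big).$$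 $\overline{\mathbf U}_\perp(t,\mathbf Z):=\mathbf U_\perp(t,\mathbf Z,0)$, i.e. $\overline U_r=\frac1b(E_\perp-\alpha v_\parallel^2+\kappa\,b\mu)$, $\overline U_\perp=\frac1b(-E_r+\gamma v_\parallel^2-\lambda\,b\mu)$. The system $\frac{d\mathbf Z}{dt}=\mathbf F(t,\mathbf Z,0)$ reads explicitly $\dot r=0$, $\dot\varphi=\frac{\cos\omega\,v_\parallel}{R}$, $\dot\theta=\frac{\sin\omega\,v_\parallel}{r}$, $\dot v_\parallel=E_\parallel+\beta\,b\mu$, $\frac{d(b\mu)}{dt}=-v_\parallel\beta\,b\mu$.
   Formalization: In (ii) the drift term is evaluated at the internal stage of the step from n-1 to n, not at (t^{n-1},Y^{n-1}); the bounds hold for ε≤ε_0 or for runs at distance ≥ρ from r=0 and r=R_0; C_M also depends on the fields, ρ and a compact set containing Z^0. *)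

theory Defs
  imports "HOL-Analysis.Analysis"
begin

text \<open>
  Iterated directional derivatives, the innermost direction being the last one in the list.
  With directions in \<^const>\<open>Basis\<close> these are the partial derivatives of every order.
\<close>

fun iterated_deriv :: "'a::euclidean_space list \<Rightarrow> ('a \<Rightarrow> real) \<Rightarrow> 'a \<Rightarrow> real" where
  "iterated_deriv [] f = f"
| "iterated_deriv (v # vs) f = (\<lambda>x. frechet_derivative (iterated_deriv vs f) (at x) v)"

definition boundedly_smooth_on :: "'a::euclidean_space set \<Rightarrow> ('a \<Rightarrow> real) \<Rightarrow> bool" where
  "boundedly_smooth_on S f \<longleftrightarrow>
     (\<forall>vs. set vs \<subseteq> Basis \<longrightarrow>
        (\<forall>x\<in>S. iterated_deriv vs f differentiable (at x)) \<and> bounded (iterated_deriv vs f ` S))"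

text \<open>
  Argument order: \<open>bmag\<close> and \<open>angle\<close> take \<open>r \<theta>\<close>, the electric field components take
  \<open>t r \<theta> \<phi>\<close>.  Only the values for \<open>0 < r < R0\<close> are meaningful.
\<close>

record torus_data =
  R0 :: real
  bmag :: "real \<Rightarrow> real \<Rightarrow> real"
  angle :: "real \<Rightarrow> real \<Rightarrow> real"
  E_r :: "real \<Rightarrow> real \<Rightarrow> real \<Rightarrow> real \<Rightarrow> real"
  E_th :: "real \<Rightarrow> real \<Rightarrow> real \<Rightarrow> real \<Rightarrow> real"
  E_ph :: "real \<Rightarrow> real \<Rightarrow> real \<Rightarrow> real \<Rightarrow> real"

text \<open>
  A state is \<open>Z = (r, \<phi>, \<theta>, v, m)\<close> with \<open>v\<close> the parallel velocity and \<open>m\<close> the variable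
  \<open>b\<mu>\<close>; a perpendicular velocity is \<open>u = (u\<^sub>r, u\<^sub>p)\<close>.  Angles are real numbers.
\<close>

type_synonym state = "real \<times> real \<times> real \<times> real \<times> real"
type_synonym perp = "real \<times> real"

definition state_space :: "torus_data \<Rightarrow> state set" where
  "state_space D = {Z. 0 < fst Z \<and> fst Z < R0 D}"

definition periodic_field :: "torus_data \<Rightarrow> (real \<Rightarrow> real \<Rightarrow> real \<Rightarrow> real \<Rightarrow> real) \<Rightarrow> bool" where
  "periodic_field D E \<longleftrightarrow>
     (\<forall>t \<theta> \<phi>. \<forall>r\<in>{0<..<R0 D}.
        E t r (\<theta> + 2 * pi) \<phi> = E t r \<theta> \<phi> \<and> E t r \<theta> (\<phi> + 2 * pi) = E t r \<theta> \<phi>)"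

definition standing_assumptions :: "torus_data \<Rightarrow> bool" where
  "standing_assumptions D \<longleftrightarrow>
     0 < R0 D \<and>
     boundedly_smooth_on ({0<..<R0 D} \<times> UNIV) (\<lambda>(r, \<theta>). bmag D r \<theta>) \<and>
     boundedly_smooth_on ({0<..<R0 D} \<times> UNIV) (\<lambda>(r, \<theta>). angle D r \<theta>) \<and>
     (\<forall>E\<in>{E_r D, E_th D, E_ph D}.
        boundedly_smooth_on (UNIV \<times> {0<..<R0 D} \<times> UNIV \<times> UNIV) (\<lambda>(t, r, \<theta>, \<phi>). E t r \<theta> \<phi>) \<and>
        periodic_field D E) \<and>
     (\<forall>\<theta>. \<forall>r\<in>{0<..<R0 D}.
        0 < bmag D r \<theta> \<and>
        bmag D r (\<theta> + 2 * pi) = bmag D r \<theta> \<and>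
        angle D r (\<theta> + 2 * pi) = angle D r \<theta>)"

definition big_R :: "torus_data \<Rightarrow> real \<Rightarrow> real \<Rightarrow> real" where
  "big_R D r \<theta> = R0 D + r * cos \<theta>"

definition d_r :: "(real \<Rightarrow> real \<Rightarrow> real) \<Rightarrow> real \<Rightarrow> real \<Rightarrow> real" where
  "d_r f r \<theta> = deriv (\<lambda>x. f x \<theta>) r"

definition d_th :: "(real \<Rightarrow> real \<Rightarrow> real) \<Rightarrow> real \<Rightarrow> real \<Rightarrow> real" where
  "d_th f r \<theta> = deriv (\<lambda>x. f r x) \<theta>"

definition alpha :: "torus_data \<Rightarrow> real \<Rightarrow> real \<Rightarrow> real" where
  "alpha D r \<theta> = - (d_th (angle D) r \<theta> / r) * sin (angle D r \<theta>)
     - sin \<theta> / big_R D r \<theta> * cos (angle D r \<theta>)"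

definition beta :: "torus_data \<Rightarrow> real \<Rightarrow> real \<Rightarrow> real" where
  "beta D r \<theta> = d_th (angle D) r \<theta> / r * cos (angle D r \<theta>)
     - sin \<theta> / big_R D r \<theta> * sin (angle D r \<theta>)"

definition gamma :: "torus_data \<Rightarrow> real \<Rightarrow> real \<Rightarrow> real" where
  "gamma D r \<theta> = - ((sin (angle D r \<theta>))\<^sup>2 / r)
     - cos \<theta> / big_R D r \<theta> * (cos (angle D r \<theta>))\<^sup>2"

definition delta :: "torus_data \<Rightarrow> real \<Rightarrow> real \<Rightarrow> real" where
  "delta D r \<theta> = - (cos \<theta> / big_R D r \<theta> - 1 / r) * sin (angle D r \<theta>) * cos (angle D r \<theta>)"

definition zeta :: "torus_data \<Rightarrow> real \<Rightarrow> real \<Rightarrow> real" where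
  "zeta D r \<theta> = (cos (angle D r \<theta>))\<^sup>2 / r
     + cos \<theta> / big_R D r \<theta> * (sin (angle D r \<theta>))\<^sup>2"

definition eta :: "torus_data \<Rightarrow> real \<Rightarrow> real \<Rightarrow> real" where
  "eta D r \<theta> = - (sin (angle D r \<theta>) / r) * (d_th (bmag D) r \<theta> / bmag D r \<theta>)"

definition kappa :: "torus_data \<Rightarrow> real \<Rightarrow> real \<Rightarrow> real" where
  "kappa D r \<theta> = cos (angle D r \<theta>) / r * (d_th (bmag D) r \<theta> / bmag D r \<theta>)"

definition lambda :: "torus_data \<Rightarrow> real \<Rightarrow> real \<Rightarrow> real" where
  "lambda D r \<theta> = - (d_r (bmag D) r \<theta> / bmag D r \<theta>)"

definition E_par :: "torus_data \<Rightarrow> real \<Rightarrow> real \<Rightarrow> real \<Rightarrow> real \<Rightarrow> real" where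
  "E_par D t r \<theta> \<phi> = cos (angle D r \<theta>) * E_ph D t r \<theta> \<phi> + sin (angle D r \<theta>) * E_th D t r \<theta> \<phi>"

definition E_perp :: "torus_data \<Rightarrow> real \<Rightarrow> real \<Rightarrow> real \<Rightarrow> real \<Rightarrow> real" where
  "E_perp D t r \<theta> \<phi> = sin (angle D r \<theta>) * E_ph D t r \<theta> \<phi> - cos (angle D r \<theta>) * E_th D t r \<theta> \<phi>"

fun b_at :: "torus_data \<Rightarrow> state \<Rightarrow> real" where
  "b_at D (r, \<phi>, \<theta>, v, m) = bmag D r \<theta>"

fun J0 :: "perp \<Rightarrow> perp" where
  "J0 (x, y) = (y, - x)"

fun F_par :: "torus_data \<Rightarrow> state \<Rightarrow> perp \<Rightarrow> real" where
  "F_par D (r, \<phi>, \<theta>, v, m) (ur, up) =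
     (let b = bmag D r \<theta>; \<mu> = m / b in
      b * ((gamma D r \<theta> * ur + alpha D r \<theta> * up) * v
         + b * (delta D r \<theta> - d_r (angle D) r \<theta>) * up * ur
         + beta D r \<theta> * (\<mu> + b * ((up\<^sup>2 - ur\<^sup>2) / 2))))"

fun F :: "torus_data \<Rightarrow> real \<Rightarrow> state \<Rightarrow> perp \<Rightarrow> state" where
  "F D t (r, \<phi>, \<theta>, v, m) (ur, up) =
     (let b = bmag D r \<theta>; \<omega> = angle D r \<theta>; Fp = F_par D (r, \<phi>, \<theta>, v, m) (ur, up) in
      (b * ur,
       (cos \<omega> * v + b * sin \<omega> * up) / big_R D r \<theta>,
       (sin \<omega> * v - b * cos \<omega> * up) / r,
       E_par D t r \<theta> \<phi> + Fp,
       - v * Fp + b * (E_r D t r \<theta> \<phi> * ur + E_perp D t r \<theta> \<phi> * up)))"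

fun U_perp :: "torus_data \<Rightarrow> real \<Rightarrow> state \<Rightarrow> perp \<Rightarrow> perp" where
  "U_perp D t (r, \<phi>, \<theta>, v, m) (ur, up) =
     (let b = bmag D r \<theta>; \<mu> = m / b in
      (E_perp D t r \<theta> \<phi> / b
         - alpha D r \<theta> / b * v\<^sup>2
         + (d_r (angle D) r \<theta> + delta D r \<theta>) * v * ur
         + (eta D r \<theta> - beta D r \<theta>) * v * up
         + b * (lambda D r \<theta> - zeta D r \<theta>) * ur * up
         + kappa D r \<theta> * (\<mu> + b * ((up\<^sup>2 - ur\<^sup>2) / 2)),
       - (E_r D t r \<theta> \<phi> / b)
         + 2 * delta D r \<theta> * v * up
         - zeta D r \<theta> * b * up\<^sup>2
         + gamma D r \<theta> / b * v\<^sup>2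
         - eta D r \<theta> * ur * v
         - kappa D r \<theta> * b * ur * up
         - lambda D r \<theta> * (\<mu> - b * ((up\<^sup>2 - ur\<^sup>2) / 2))))"

definition U_bar :: "torus_data \<Rightarrow> real \<Rightarrow> state \<Rightarrow> perp" where
  "U_bar D t Z = U_perp D t Z 0"

text \<open>
  The perpendicular velocity to which the relaxation of \<open>u\<close> drives the system at \<open>(t, Z)\<close>.
  After a step of \<open>imex_step\<close> below, \<open>u\<close> is slaved up to \<open>O(\<epsilon>\<^sup>2)\<close> at the internal stage
  \<open>(th, Zh)\<close> of that step, where the last implicit stage evaluates \<open>U_perp\<close> and \<open>b\<close>, and not at
  the starting point \<open>(t, Z)\<close> of the step: the two values differ by a term of order \<open>\<epsilon>\<close>.
\<close>

definition slaved :: "torus_data \<Rightarrow> real \<Rightarrow> real \<Rightarrow> state \<Rightarrow> perp" where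
  "slaved D \<epsilon> t Z = (\<epsilon> / b_at D Z) *\<^sub>R U_bar D t Z"

definition gyro_field :: "torus_data \<Rightarrow> real \<Rightarrow> state \<Rightarrow> state" where
  "gyro_field D t Z = F D t Z 0"

definition corrected_field :: "torus_data \<Rightarrow> real \<Rightarrow> real \<Rightarrow> state \<Rightarrow> state" where
  "corrected_field D \<epsilon> t Z = F D t Z (slaved D \<epsilon> t Z)"

definition gam :: real where
  "gam = 1 - 1 / sqrt 2"

definition num_steps :: "real \<Rightarrow> real \<Rightarrow> nat" where
  "num_steps T h = nat \<lfloor>T / h\<rfloor>"

definition stage_time :: "real \<Rightarrow> real \<Rightarrow> real" where
  "stage_time h t = t + h / (2 * gam)"

definition extrapolate :: "'a::real_vector \<Rightarrow> 'a \<Rightarrow> 'a" where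
  "extrapolate x x1 = (1 - 1 / (2 * gam\<^sup>2)) *\<^sub>R x + (1 / (2 * gam\<^sup>2)) *\<^sub>R x1"

text \<open>
  One step of size \<open>h\<close> at time \<open>t\<close>, from \<open>(Z, u)\<close> to \<open>(Z', u')\<close> with first stage \<open>(Z1, u1)\<close>.
\<close>

definition imex_step ::
  "torus_data \<Rightarrow> real \<Rightarrow> real \<Rightarrow> real \<Rightarrow> state \<Rightarrow> perp \<Rightarrow> state \<Rightarrow> perp \<Rightarrow> state \<Rightarrow> perp \<Rightarrow> bool"
where
  "imex_step D \<epsilon> h t Z u Z1 u1 Z' u' \<longleftrightarrow>
     (let th = stage_time h t; Zh = extrapolate Z Z1; uh = extrapolate u u1 in
      (1 / h) *\<^sub>R (Z1 - Z) = gam *\<^sub>R F D t Z u1 \<and>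
      J0 ((1 / h) *\<^sub>R (u1 - u)) = gam *\<^sub>R (U_perp D t Z u - (b_at D Z / \<epsilon>) *\<^sub>R u1) \<and>
      (1 / h) *\<^sub>R (Z' - Z) = (1 - gam) *\<^sub>R F D t Z u1 + gam *\<^sub>R F D th Zh u' \<and>
      J0 ((1 / h) *\<^sub>R (u' - u)) =
        (1 - gam) *\<^sub>R (U_perp D t Z u - (b_at D Z / \<epsilon>) *\<^sub>R u1)
        + gam *\<^sub>R (U_perp D th Zh uh - (b_at D Zh / \<epsilon>) *\<^sub>R u'))"

definition imex_run ::
  "torus_data \<Rightarrow> real \<Rightarrow> real \<Rightarrow> nat \<Rightarrow>
   (nat \<Rightarrow> state) \<Rightarrow> (nat \<Rightarrow> perp) \<Rightarrow> (nat \<Rightarrow> state) \<Rightarrow> (nat \<Rightarrow> perp) \<Rightarrow> bool"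
where
  "imex_run D \<epsilon> h N Z u Z1 u1 \<longleftrightarrow>
     (\<forall>n<N. imex_step D \<epsilon> h (real n * h) (Z n) (u n) (Z1 n) (u1 n) (Z (Suc n)) (u (Suc n)))"

text \<open>
  The explicit two-stage scheme for \<open>z' = G t z\<close>; the first function returns its internal stage
  at time \<open>stage_time h t\<close>.
\<close>

definition rk_stage :: "(real \<Rightarrow> 'a::real_vector \<Rightarrow> 'a) \<Rightarrow> real \<Rightarrow> real \<Rightarrow> 'a \<Rightarrow> 'a" where
  "rk_stage G h t z = z + (h * (1 / (2 * gam))) *\<^sub>R G t z"

definition rk_step :: "(real \<Rightarrow> 'a::real_vector \<Rightarrow> 'a) \<Rightarrow> real \<Rightarrow> real \<Rightarrow> 'a \<Rightarrow> 'a" where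
  "rk_step G h t z =
     z + h *\<^sub>R ((1 - gam) *\<^sub>R G t z + gam *\<^sub>R G (stage_time h t) (rk_stage G h t z))"

definition rk_run ::
  "(real \<Rightarrow> 'a::real_vector \<Rightarrow> 'a) \<Rightarrow> real \<Rightarrow> nat \<Rightarrow> nat \<Rightarrow> (nat \<Rightarrow> 'a) \<Rightarrow> bool"
where
  "rk_run G h n0 N z \<longleftrightarrow> (\<forall>n\<in>{n0..<N}. z (Suc n) = rk_step G h (real n * h) (z n))"

text \<open>
  Consistency of order two of a one-step map with \<open>z' = G t z\<close> on the domain \<open>S\<close>: along every
  exact solution the error committed in one step of size \<open>h\<close> is \<open>O(h\<^sup>3)\<close>, uniformly in the
  starting time.
\<close>

definition consistent_second_order ::
  "(real \<Rightarrow> real \<Rightarrow> 'a::real_normed_vector \<Rightarrow> 'a) \<Rightarrow> (real \<Rightarrow> 'a \<Rightarrow> 'a) \<Rightarrow> 'a set \<Rightarrow> bool"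
where
  "consistent_second_order \<Phi> G S \<longleftrightarrow>
     (\<forall>z a c. a < c \<and>
        (\<forall>t\<in>{a..c}. z t \<in> S \<and> (z has_vector_derivative G t (z t)) (at t within {a..c})) \<longrightarrow>
        (\<exists>C h0. 0 < h0 \<and>
           (\<forall>h t. 0 < h \<and> h \<le> h0 \<and> a \<le> t \<and> t + h \<le> c \<longrightarrow>
              norm (z (t + h) - \<Phi> h t (z t)) \<le> C * h ^ 3)))"

text \<open>
  Some coefficients are unbounded near \<open>r = 0\<close> (factor \<open>1 / r\<close>) and near \<open>r = R0\<close>
  (factor \<open>1 / R\<close>, and \<open>1 / b\<close>, as \<open>b\<close> may vanish in that limit).  Bounds that are uniform over
  large values of \<open>\<epsilon>\<close> only make sense for runs whose evaluation points keep a distance \<open>\<rho>\<close> from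
  both, as expressed by the following predicates; for small \<open>\<epsilon>\<close> this is automatic.
\<close>

definition confined :: "torus_data \<Rightarrow> real \<Rightarrow> state \<Rightarrow> bool" where
  "confined D \<rho> Z \<longleftrightarrow> \<rho> \<le> fst Z \<and> fst Z \<le> R0 D - \<rho>"

definition imex_confined ::
  "torus_data \<Rightarrow> real \<Rightarrow> nat \<Rightarrow> (nat \<Rightarrow> state) \<Rightarrow> (nat \<Rightarrow> state) \<Rightarrow> bool"
where
  "imex_confined D \<rho> N Z Z1 \<longleftrightarrow>
     (\<forall>n<N. confined D \<rho> (Z n) \<and> confined D \<rho> (extrapolate (Z n) (Z1 n)))"

definition rk_confined ::
  "torus_data \<Rightarrow> real \<Rightarrow> (real \<Rightarrow> state \<Rightarrow> state) \<Rightarrow> real \<Rightarrow> nat \<Rightarrow> nat \<Rightarrow> (nat \<Rightarrow> state) \<Rightarrow> bool"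
where
  "rk_confined D \<rho> G h n0 N Y \<longleftrightarrow>
     (\<forall>n\<in>{n0..<N}. confined D \<rho> (Y n) \<and> confined D \<rho> (rk_stage G h (real n * h) (Y n)))"

end

theory Submission
  imports Defs
begin

text \<open>
  All coefficients are smooth in the open region \<open>0 < r < R0\<close>, hence bounded and Lipschitz on
  compact subsets of it.  Writing \<open>c = \<epsilon> / (h \<gamma>)\<close>, each implicit stage for the perpendicular
  velocity has the form \<open>b w + c J0 w = y\<close>.  As \<open>J0 w\<close> is orthogonal to \<open>w\<close>, this gives
  \<open>\<bar>w\<bar> \<le> \<bar>y\<bar> / b\<close> whatever the size of \<open>c\<close>, where \<open>y\<close> consists of \<open>\<epsilon> U\<close>, of \<open>c J0 u\<close>
  and of a multiple of the residual \<open>\<epsilon> U - b w\<close> of the preceding stage.  Thus one step sends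
  \<open>u = o(\<epsilon> powr (-1/2))\<close> to \<open>o(1)\<close> and \<open>u = O(1)\<close> to \<open>O(\<epsilon>)\<close>; and if already \<open>u = O(\<epsilon>)\<close>, then all
  terms other than \<open>\<epsilon> U_bar\<close> are \<open>O(\<epsilon>\<^sup>2)\<close>, so that the new velocity is slaved up to \<open>O(\<epsilon>\<^sup>2)\<close>.
  The equation for \<open>Z\<close> is then a perturbation of the explicit two-stage scheme, and the error
  estimates follow by a finite induction over the steps.
\<close>

section \<open>Smooth functions\<close>

text \<open>The coefficients have no uniform bounds near r = 0 and r = R0, so every estimate first
  needs a compact set containing the points at which the fields are evaluated. The limit scheme
  supplies it: at zero perpendicular velocity the first component of \<open>F\<close> vanishes, so r
  is constant along a limit run. Runs with small \<epsilon> inherit its margin by closeness; for the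
  other ones the margin is a hypothesis. Confinement and estimates therefore have to be proved
  together, stage by stage. The scaling by sqrt \<epsilon> comes from \<open>U_perp\<close> being
  quadratic in the velocity: \<epsilon> times \<open>U_perp\<close> at u is controlled by sqrt
  \<epsilon> u. The constants must be shared by all runs, so orders are computed along a filter on
  the set of runs instead of along \<epsilon> tending to 0 in one family. Second-order consistency
  is independent of all this. It is a Taylor comparison for an arbitrary smooth field, where the
  weight \<open>gam\<close> times the stage offset h / (2 gam) produces the required h / 2.\<close>

primrec Ck_on ::
  "nat \<Rightarrow> 'a::real_normed_vector set \<Rightarrow> ('a \<Rightarrow> 'b::real_normed_vector) \<Rightarrow> bool" where
  "Ck_on 0 S f \<longleftrightarrow> continuous_on S f"
| "Ck_on (Suc n) S f \<longleftrightarrow>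
     (\<exists>D. (\<forall>x\<in>S. (f has_derivative (\<lambda>v. D v x)) (at x)) \<and> (\<forall>v. Ck_on n S (D v)))"

text \<open>\<open>Ck_on\<close> keeps derivatives as functions \<open>D v\<close> with the
  direction v fixed, so all orders share one domain and codomain and inductions on n only generalise
  over the function. The witness \<open>D\<close> may differ from one n to the next;
  \<open>smooth_on_imp_derivative\<close> removes that dependence.\<close>

definition smooth_on ::
  "'a::real_normed_vector set \<Rightarrow> ('a \<Rightarrow> 'b::real_normed_vector) \<Rightarrow> bool" where
  "smooth_on S f \<longleftrightarrow> (\<forall>n. Ck_on n S f)"

lemma Ck_on_SucI:
  assumes "\<And>x. x \<in> S \<Longrightarrow> (f has_derivative (\<lambda>v. D v x)) (at x)" and "\<And>v. Ck_on n S (D v)"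
  shows "Ck_on (Suc n) S f"
  using assms by auto

text \<open>Product and chain rule also contain the undifferentiated factors, whose order has to be
  lowered by one before the induction hypothesis applies.\<close>

lemma Ck_on_Suc_imp: "Ck_on (Suc n) S f \<Longrightarrow> Ck_on n S f"
proof (induction n arbitrary: f)
  case 0
  then show ?case
    unfolding Ck_on.simps by (meson continuous_at_imp_continuous_on has_derivative_continuous)
next
  case (Suc n)
  from Suc.prems obtain D where "\<forall>x\<in>S. (f has_derivative (\<lambda>v. D v x)) (at x)"
    "\<forall>v. Ck_on (Suc n) S (D v)"
    unfolding Ck_on.simps by blast
  note D = this[rule_format]
  show ?case
    using D Suc.IH by (intro Ck_on_SucI[of S f D]) auto
qed

lemma Ck_on_cong:
  assumes "open S" "Ck_on n S f" "\<And>x. x \<in> S \<Longrightarrow> f x = g x"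
  shows "Ck_on n S g"
proof (cases n)
  case 0 then show ?thesis using assms by (simp cong: continuous_on_cong_simp)
next
  case (Suc m)
  from assms(2) obtain D where "\<forall>x\<in>S. (f has_derivative (\<lambda>v. D v x)) (at x)"
    "\<forall>v. Ck_on m S (D v)"
    unfolding Suc Ck_on.simps by blast
  note D = this[rule_format]
  show ?thesis unfolding Suc
  proof (rule Ck_on_SucI)
    show "(g has_derivative (\<lambda>v. D v x)) (at x)" if "x \<in> S" for x
      using has_derivative_transform_within_open[OF D(1)[OF that] assms(1) that assms(3)] .
  qed (rule D)
qed

lemma Ck_on_const: "Ck_on n S (\<lambda>x. c)"
proof (induction n arbitrary: c)
  case (Suc n) then show ?case by (intro Ck_on_SucI[where D = "\<lambda>v x. 0"]) auto
qed auto

lemma Ck_on_bounded_linear: "bounded_linear f \<Longrightarrow> Ck_on n S f"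
proof (cases n)
  case (Suc m)
  assume "bounded_linear f"
  then show ?thesis unfolding Suc
    by (intro Ck_on_SucI[where D = "\<lambda>v x. f v"]) (auto simp: Ck_on_const bounded_linear_imp_has_derivative)
qed (auto intro: linear_continuous_on)

lemma Ck_on_add:
  "Ck_on n S f \<Longrightarrow> Ck_on n S g \<Longrightarrow> Ck_on n S (\<lambda>x. f x + g x)"
proof (induction n arbitrary: f g)
  case 0 then show ?case by (auto intro: continuous_intros)
next
  case (Suc n)
  from Suc.prems(1) obtain D where "\<forall>x\<in>S. (f has_derivative (\<lambda>v. D v x)) (at x)" "\<forall>v. Ck_on n S (D v)"
    unfolding Ck_on.simps by blast
  note D = this[rule_format]
  from Suc.prems(2) obtain E where "\<forall>x\<in>S. (g has_derivative (\<lambda>v. E v x)) (at x)" "\<forall>v. Ck_on n S (E v)"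
    unfolding Ck_on.simps by blast
  note E = this[rule_format]
  show ?case
    by (rule Ck_on_SucI[where D = "\<lambda>v x. D v x + E v x"])
       (auto intro!: has_derivative_add D E Suc.IH)
qed

lemma Ck_on_sum:
  "(\<And>i. i \<in> I \<Longrightarrow> Ck_on n S (f i)) \<Longrightarrow> Ck_on n S (\<lambda>x. \<Sum>i\<in>I. f i x)"
  by (induction I rule: infinite_finite_induct) (auto intro: Ck_on_const Ck_on_add)

lemma Ck_on_bilinear:
  assumes "bounded_bilinear B"
  shows "Ck_on n S f \<Longrightarrow> Ck_on n S g \<Longrightarrow> Ck_on n S (\<lambda>x. B (f x) (g x))"
proof (induction n arbitrary: f g)
  case 0 then show ?case by (auto intro: bounded_bilinear.continuous_on[OF assms])
next
  case (Suc n)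
  from Suc.prems(1) obtain D where "\<forall>x\<in>S. (f has_derivative (\<lambda>v. D v x)) (at x)" "\<forall>v. Ck_on n S (D v)"
    unfolding Ck_on.simps by blast
  note D = this[rule_format]
  from Suc.prems(2) obtain E where "\<forall>x\<in>S. (g has_derivative (\<lambda>v. E v x)) (at x)" "\<forall>v. Ck_on n S (E v)"
    unfolding Ck_on.simps by blast
  note E = this[rule_format]
  show ?case
    by (rule Ck_on_SucI[where D = "\<lambda>v x. B (f x) (E v x) + B (D v x) (g x)"])
       (auto intro!: bounded_bilinear.FDERIV[OF assms] Ck_on_add D E Suc.IH
         Ck_on_Suc_imp[OF Suc.prems(1)] Ck_on_Suc_imp[OF Suc.prems(2)])
qed

lemma linear_expand_Basis:
  fixes f :: "'a::euclidean_space \<Rightarrow> 'b::real_normed_vector"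
  assumes "linear f"
  shows "f v = (\<Sum>b\<in>Basis. (v \<bullet> b) *\<^sub>R f b)"
proof -
  have "f v = f (\<Sum>b\<in>Basis. (v \<bullet> b) *\<^sub>R b)" by (simp add: euclidean_representation)
  then show ?thesis by (simp add: linear_sum[OF assms] linear_scale[OF assms])
qed

text \<open>In the chain rule the direction \<open>E v x\<close> of the outer derivative varies with
  x, whereas the induction hypothesis speaks of a fixed direction. Expanding it in the basis
  separates the two dependences.\<close>

lemma Ck_on_compose:
  fixes f :: "'b::euclidean_space \<Rightarrow> 'c::real_normed_vector"
  assumes "g ` S \<subseteq> T"
  shows "Ck_on n T f \<Longrightarrow> Ck_on n S g \<Longrightarrow> Ck_on n S (\<lambda>x. f (g x))"
proof (induction n arbitrary: f)
  case 0 then show ?case using assms by (auto intro: continuous_on_compose2)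
next
  case (Suc n)
  from Suc.prems(1) obtain D where "\<forall>x\<in>T. (f has_derivative (\<lambda>v. D v x)) (at x)" "\<forall>v. Ck_on n T (D v)"
    unfolding Ck_on.simps by blast
  note D = this[rule_format]
  from Suc.prems(2) obtain E where "\<forall>x\<in>S. (g has_derivative (\<lambda>v. E v x)) (at x)" "\<forall>v. Ck_on n S (E v)"
    unfolding Ck_on.simps by blast
  note E = this[rule_format]
  show ?case
  proof (rule Ck_on_SucI[where D = "\<lambda>v x. \<Sum>b\<in>Basis. (E v x \<bullet> b) *\<^sub>R D b (g x)"])
    fix x assume x: "x \<in> S"
    with assms have gx: "g x \<in> T" by auto
    have "((\<lambda>x. f (g x)) has_derivative (\<lambda>v. D (E v x) (g x))) (at x)"
      using has_derivative_compose[OF E(1)[OF x] D(1)[OF gx]] .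
    moreover have "D (E v x) (g x) = (\<Sum>b\<in>Basis. (E v x \<bullet> b) *\<^sub>R D b (g x))" for v
      using linear_expand_Basis[OF has_derivative_linear[OF D(1)[OF gx]]] .
    ultimately show "((\<lambda>x. f (g x)) has_derivative
        (\<lambda>v. \<Sum>b\<in>Basis. (E v x \<bullet> b) *\<^sub>R D b (g x))) (at x)" by simp
  next
    fix v
    show "Ck_on n S (\<lambda>x. \<Sum>b\<in>Basis. (E v x \<bullet> b) *\<^sub>R D b (g x))"
      by (intro Ck_on_sum Ck_on_bilinear[OF bounded_bilinear_scaleR]
          Ck_on_bilinear[OF bounded_bilinear_inner] Ck_on_const E D Suc.IH
          Ck_on_Suc_imp[OF Suc.prems(2)])
  qed
qed

text \<open>The derivative is a product of constants and the inverse itself, which closes the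
  induction.\<close>

lemma Ck_on_inverse: "Ck_on n (- {0}) (inverse :: real \<Rightarrow> real)"
proof (induction n)
  case 0 then show ?case by (auto intro!: continuous_intros)
next
  case (Suc n)
  show ?case
  proof (rule Ck_on_SucI[where D = "\<lambda>v x. (inverse x * (- v)) * inverse x"])
    show "Ck_on n (- {0}) (\<lambda>x. inverse x * (- v) * inverse x)" for v :: real
      by (intro Ck_on_bilinear[OF bounded_bilinear_mult] Suc Ck_on_const)
  qed (auto intro!: derivative_eq_intros)
qed

text \<open>Each derivative is the other function up to sign, so both go through one
  induction.\<close>

lemma Ck_on_sin_cos: "Ck_on n UNIV (sin :: real \<Rightarrow> real) \<and> Ck_on n UNIV (cos :: real \<Rightarrow> real)"
proof (induction n)
  case 0 then show ?case by (auto intro!: continuous_intros)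
next
  case (Suc n)
  then have sc: "Ck_on n UNIV (sin :: real \<Rightarrow> real)" "Ck_on n UNIV (cos :: real \<Rightarrow> real)" by auto
  have "Ck_on (Suc n) UNIV (sin :: real \<Rightarrow> real)"
  proof (rule Ck_on_SucI[where D = "\<lambda>v x. v * cos x"])
    show "Ck_on n UNIV (\<lambda>x. v * cos x)" for v :: real
      by (intro Ck_on_bilinear[OF bounded_bilinear_mult] sc Ck_on_const)
  qed (auto intro!: derivative_eq_intros)
  moreover have "Ck_on (Suc n) UNIV (cos :: real \<Rightarrow> real)"
  proof (rule Ck_on_SucI[where D = "\<lambda>v x. (- v) * sin x"])
    show "Ck_on n UNIV (\<lambda>x. (- v) * sin x)" for v :: real
      by (intro Ck_on_bilinear[OF bounded_bilinear_mult] sc Ck_on_const)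
  qed (auto intro!: derivative_eq_intros)
  ultimately show ?case by blast
qed

lemma smooth_on_cong:
  assumes "open S" "smooth_on S f" "\<And>x. x \<in> S \<Longrightarrow> f x = g x"
  shows "smooth_on S g"
  using assms Ck_on_cong unfolding smooth_on_def by blast

text \<open>Derivatives are unique, so the witnesses for the different orders all agree on S with
  \<open>frechet_derivative\<close>; openness of S lets regularity be transferred along this
  agreement.\<close>

lemma smooth_on_imp_derivative:
  assumes "smooth_on S f" "open S"
  shows "\<exists>D. (\<forall>x\<in>S. (f has_derivative (\<lambda>v. D v x)) (at x)) \<and> (\<forall>v. smooth_on S (D v))"
proof (intro exI conjI ballI allI)
  let ?D = "\<lambda>v x. frechet_derivative f (at x) v"
  show *: "(f has_derivative (\<lambda>v. ?D v x)) (at x)" if "x \<in> S" for x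
  proof -
    from assms have "Ck_on (Suc 0) S f" by (auto simp: smooth_on_def)
    then have "f differentiable (at x)"
      unfolding Ck_on.simps differentiable_def using \<open>x \<in> S\<close> by blast
    then show ?thesis using frechet_derivative_works by blast
  qed
  show "smooth_on S (?D v)" for v
    unfolding smooth_on_def
  proof
    fix n
    from assms have "Ck_on (Suc n) S f" unfolding smooth_on_def by blast
    then obtain D where "\<forall>x\<in>S. (f has_derivative (\<lambda>v. D v x)) (at x)"
      "\<forall>v. Ck_on n S (D v)"
      unfolding Ck_on.simps by blast
    note D = this[rule_format]
    show "Ck_on n S (?D v)"
      by (rule Ck_on_cong[OF assms(2) D(2)[of v]])
         (use D(1) * has_derivative_unique in metis)
  qed
qed

lemma smooth_on_imp_continuous_on: "smooth_on S f \<Longrightarrow> continuous_on S f"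
  unfolding smooth_on_def using Ck_on.simps(1) by blast

lemma smooth_on_const: "smooth_on S (\<lambda>x. c)"
  by (simp add: smooth_on_def Ck_on_const)

lemma smooth_on_bounded_linear: "bounded_linear f \<Longrightarrow> smooth_on S f"
  by (simp add: smooth_on_def Ck_on_bounded_linear)

lemma smooth_on_add: "smooth_on S f \<Longrightarrow> smooth_on S g \<Longrightarrow> smooth_on S (\<lambda>x. f x + g x)"
  by (simp add: smooth_on_def Ck_on_add)

lemma smooth_on_sum:
  "(\<And>i. i \<in> I \<Longrightarrow> smooth_on S (f i)) \<Longrightarrow> smooth_on S (\<lambda>x. \<Sum>i\<in>I. f i x)"
  by (simp add: smooth_on_def Ck_on_sum)

lemma smooth_on_bilinear:
  "bounded_bilinear B \<Longrightarrow> smooth_on S f \<Longrightarrow> smooth_on S g \<Longrightarrow> smooth_on S (\<lambda>x. B (f x) (g x))"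
  by (simp add: smooth_on_def Ck_on_bilinear)

lemmas smooth_on_mult = smooth_on_bilinear[OF bounded_bilinear_mult]
lemmas smooth_on_scaleR = smooth_on_bilinear[OF bounded_bilinear_scaleR]
lemmas smooth_on_inner = smooth_on_bilinear[OF bounded_bilinear_inner]

lemma smooth_on_compose:
  fixes f :: "'b::euclidean_space \<Rightarrow> 'c::real_normed_vector"
  shows "smooth_on T f \<Longrightarrow> smooth_on S g \<Longrightarrow> g ` S \<subseteq> T \<Longrightarrow> smooth_on S (\<lambda>x. f (g x))"
  by (simp add: smooth_on_def Ck_on_compose)

lemma smooth_on_linear_compose:
  fixes f :: "'b::euclidean_space \<Rightarrow> 'c::real_normed_vector"
  assumes "bounded_linear f" "smooth_on S g"
  shows "smooth_on S (\<lambda>x. f (g x))"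
  by (rule smooth_on_compose[OF smooth_on_bounded_linear[OF assms(1), of UNIV] assms(2)]) auto

lemma smooth_on_id: "smooth_on S (\<lambda>x. x)"
  by (rule smooth_on_bounded_linear) (rule bounded_linear_ident)

lemmas smooth_on_fst = smooth_on_linear_compose[OF bounded_linear_fst]
lemmas smooth_on_snd = smooth_on_linear_compose[OF bounded_linear_snd]
lemmas smooth_on_minus =
  smooth_on_linear_compose[OF bounded_linear_minus[OF bounded_linear_ident]]

lemma smooth_on_diff:
  fixes f g :: "'a::real_normed_vector \<Rightarrow> 'b::euclidean_space"
  shows "smooth_on S f \<Longrightarrow> smooth_on S g \<Longrightarrow> smooth_on S (\<lambda>x. f x - g x)"
  using smooth_on_add[of S f "\<lambda>x. - g x"] smooth_on_minus[of S g] by simp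

lemma smooth_on_Pair:
  fixes f :: "'a::real_normed_vector \<Rightarrow> 'b::euclidean_space" and g :: "'a \<Rightarrow> 'c::euclidean_space"
  assumes "smooth_on S f" "smooth_on S g"
  shows "smooth_on S (\<lambda>x. (f x, g x))"
proof -
  have "bounded_linear (\<lambda>y::'b. (y, 0::'c))" "bounded_linear (\<lambda>y::'c. (0::'b, y))"
    by (intro bounded_linear_Pair bounded_linear_ident bounded_linear_zero)+
  from smooth_on_add[OF smooth_on_linear_compose[OF this(1) assms(1)]
      smooth_on_linear_compose[OF this(2) assms(2)]]
  show ?thesis by simp
qed

lemma smooth_on_sin: "smooth_on S f \<Longrightarrow> smooth_on S (\<lambda>x. sin (f x) :: real)"
  and smooth_on_cos: "smooth_on S f \<Longrightarrow> smooth_on S (\<lambda>x. cos (f x) :: real)"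
  using Ck_on_sin_cos smooth_on_compose[of UNIV sin S f] smooth_on_compose[of UNIV cos S f]
  by (simp_all add: smooth_on_def)

lemma smooth_on_divide:
  fixes f g :: "'a::real_normed_vector \<Rightarrow> real"
  assumes "smooth_on S f" "smooth_on S g" "\<And>x. x \<in> S \<Longrightarrow> g x \<noteq> 0"
  shows "smooth_on S (\<lambda>x. f x / g x)"
proof -
  have "smooth_on S (\<lambda>x. inverse (g x))"
    by (rule smooth_on_compose[of "- {0}" inverse, OF _ assms(2)])
       (use assms(3) in \<open>auto simp: smooth_on_def Ck_on_inverse\<close>)
  then show ?thesis unfolding divide_inverse by (rule smooth_on_mult[OF assms(1)])
qed

lemma smooth_on_power:
  fixes f :: "'a::real_normed_vector \<Rightarrow> real"
  shows "smooth_on S f \<Longrightarrow> smooth_on S (\<lambda>x. f x ^ k)"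
  by (induction k) (auto intro: smooth_on_const smooth_on_mult)

lemmas smooth_intros = smooth_on_const smooth_on_add smooth_on_mult smooth_on_scaleR smooth_on_fst
  smooth_on_snd smooth_on_minus smooth_on_diff smooth_on_Pair smooth_on_sin smooth_on_cos
  smooth_on_divide smooth_on_power smooth_on_id

text \<open>\<open>boundedly_smooth_on\<close> speaks of derivatives along basis vectors only. By
  linearity a derivative in any direction v is a combination of these with constant coefficients,
  and the induction is run with the list \<open>vs\<close> arbitrary.\<close>

lemma boundedly_smooth_on_imp_smooth_on:
  assumes "boundedly_smooth_on S f"
  shows "smooth_on S f"
proof -
  have "Ck_on n S (iterated_deriv vs f)" if "set vs \<subseteq> Basis" for n vs
    using that
  proof (induction n arbitrary: vs)
    case 0
    then have "\<forall>x\<in>S. iterated_deriv vs f differentiable (at x)"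
      using assms by (auto simp: boundedly_smooth_on_def)
    then show ?case
      by (auto intro!: continuous_at_imp_continuous_on differentiable_imp_continuous_within)
  next
    case (Suc n)
    let ?f = "iterated_deriv vs f"
    show ?case
    proof (rule Ck_on_SucI[where D = "\<lambda>v x. \<Sum>b\<in>Basis. (v \<bullet> b) *\<^sub>R iterated_deriv (b # vs) f x"])
      fix x assume "x \<in> S"
      then have "?f differentiable (at x)" using assms Suc.prems by (auto simp: boundedly_smooth_on_def)
      then have d: "(?f has_derivative frechet_derivative ?f (at x)) (at x)"
        using frechet_derivative_works by blast
      have "frechet_derivative ?f (at x) v = (\<Sum>b\<in>Basis. (v \<bullet> b) *\<^sub>R iterated_deriv (b # vs) f x)" for v
        unfolding iterated_deriv.simps by (rule linear_expand_Basis[OF has_derivative_linear[OF d]])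
      then show "(?f has_derivative (\<lambda>v. \<Sum>b\<in>Basis. (v \<bullet> b) *\<^sub>R iterated_deriv (b # vs) f x)) (at x)"
        by (intro has_derivative_eq_rhs[OF d] ext)
    next
      show "Ck_on n S (\<lambda>x. \<Sum>b\<in>Basis. (v \<bullet> b) *\<^sub>R iterated_deriv (b # vs) f x)" for v
        by (intro Ck_on_sum Ck_on_bilinear[OF bounded_bilinear_scaleR] Ck_on_const Suc.IH)
           (use Suc.prems in auto)
    qed
  qed
  from this[of "[]"] show ?thesis by (simp add: smooth_on_def)
qed

lemma norm_linear_le_sum_Basis:
  fixes f :: "'a::euclidean_space \<Rightarrow> 'b::real_normed_vector"
  assumes "linear f"
  shows "norm (f v) \<le> (\<Sum>b\<in>Basis. norm (f b)) * norm v"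
proof -
  have "norm (f v) \<le> (\<Sum>b\<in>Basis. norm ((v \<bullet> b) *\<^sub>R f b))"
    unfolding linear_expand_Basis[OF assms, of v] by (rule norm_sum)
  also have "\<dots> \<le> (\<Sum>b\<in>Basis. norm (f b) * norm v)"
    by (intro sum_mono) (simp add: mult.commute[of _ "norm (f _)"] mult_left_mono Basis_le_norm)
  finally show ?thesis by (simp add: sum_distrib_right)
qed

text \<open>K need not be convex, so the mean value inequality is applied on small balls inside S;
  compactness of K then merges the local constants into one. The singleton \<open>{0}\<close> fills
  the time slot of \<open>local_lipschitz\<close>.\<close>

lemma smooth_on_lipschitz_compact:
  fixes f :: "'a::euclidean_space \<Rightarrow> 'b::real_normed_vector"
  assumes "smooth_on S f" "open S" "compact K" "K \<subseteq> S"
  obtains L where "L \<ge> 0" "\<And>x y. x \<in> K \<Longrightarrow> y \<in> K \<Longrightarrow> norm (f x - f y) \<le> L * norm (x - y)"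
proof -
  obtain D where "\<forall>x\<in>S. (f has_derivative (\<lambda>v. D v x)) (at x)" "\<forall>v. smooth_on S (D v)"
    using smooth_on_imp_derivative[OF assms(1,2)] by blast
  note D = this[rule_format]
  have "local_lipschitz {0::real} K (\<lambda>_. f)"
  proof (rule local_lipschitzI)
    fix t x assume "x \<in> K"
    with assms obtain u where u: "u > 0" "cball x u \<subseteq> S"
      by (meson open_contains_cball subsetD)
    have "continuous_on (cball x u) (\<lambda>y. \<Sum>b\<in>Basis. norm (D b y))"
      by (intro continuous_intros continuous_on_subset[OF smooth_on_imp_continuous_on u(2)] D)
    then have "bounded ((\<lambda>y. \<Sum>b\<in>Basis. norm (D b y)) ` cball x u)"
      by (intro compact_imp_bounded compact_continuous_image) auto
    then obtain B where B: "\<And>y. y \<in> cball x u \<Longrightarrow> norm (\<Sum>b\<in>Basis. norm (D b y)) \<le> B"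
      unfolding bounded_iff by blast
    have "B-lipschitz_on (cball x u) f"
    proof (rule lipschitz_onI)
      show "0 \<le> B" using B[of x] u(1) norm_ge_zero order_trans by fastforce
      fix y z assume yz: "y \<in> cball x u" "z \<in> cball x u"
      have "norm (f y - f z) \<le> B * norm (y - z)"
      proof (rule differentiable_bound[OF convex_cball _ _ yz])
        fix w assume w: "w \<in> cball x u"
        then have d: "(f has_derivative (\<lambda>v. D v w)) (at w)" using u D by auto
        then show "(f has_derivative (\<lambda>v. D v w)) (at w within cball x u)"
          by (rule has_derivative_at_withinI)
        show "onorm (\<lambda>v. D v w) \<le> B"
        proof (rule onorm_le)
          fix v
          have "norm (D v w) \<le> (\<Sum>b\<in>Basis. norm (D b w)) * norm v"
            by (rule norm_linear_le_sum_Basis[OF has_derivative_linear[OF d]])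
          also have "\<dots> \<le> B * norm v"
            using B[OF w] by (intro mult_right_mono) (auto simp: sum_nonneg)
          finally show "norm (D v w) \<le> B * norm v" .
        qed
      qed
      then show "dist (f y) (f z) \<le> B * dist y z" by (simp add: dist_norm)
    qed
    then have "B-lipschitz_on (cball x u \<inter> K) f" by (rule lipschitz_on_subset) auto
    then show "\<exists>u>0. \<exists>L. \<forall>t\<in>cball t u \<inter> {0}. L-lipschitz_on (cball x u \<inter> K) f"
      using u(1) by blast
  qed
  then obtain L where "L-lipschitz_on K f"
    by (rule local_lipschitz_compact_implies_lipschitz[OF _ assms(3), of "{0}"]) auto
  then show thesis
    using that[of L] by (auto simp: lipschitz_on_def dist_norm)
qed

lemma smooth_on_bounded_compact:
  fixes f :: "'a::real_normed_vector \<Rightarrow> 'b::real_normed_vector"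
  assumes "smooth_on S f" "compact K" "K \<subseteq> S"
  obtains B where "B \<ge> 0" "\<And>x. x \<in> K \<Longrightarrow> norm (f x) \<le> B"
proof -
  have "bounded (f ` K)"
    by (intro compact_imp_bounded compact_continuous_image assms(2)
        continuous_on_subset[OF smooth_on_imp_continuous_on[OF assms(1)] assms(3)])
  then obtain B where "B > 0" "\<And>x. x \<in> K \<Longrightarrow> norm (f x) \<le> B"
    unfolding bounded_pos by blast
  then show thesis using that[of B] by auto
qed

lemma smooth_on_compose2:
  fixes c :: "real \<Rightarrow> real \<Rightarrow> real" and f g :: "'a::real_normed_vector \<Rightarrow> real"
  assumes "smooth_on T (\<lambda>x. c (fst x) (snd x))" "smooth_on S f" "smooth_on S g"
    and "\<And>x. x \<in> S \<Longrightarrow> (f x, g x) \<in> T"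
  shows "smooth_on S (\<lambda>x. c (f x) (g x))"
  using smooth_on_compose[OF assms(1) smooth_on_Pair[OF assms(2,3)]] assms(4) by auto

text \<open>On S, \<open>deriv\<close> of a partial map is the directional derivative of the joint
  map along (1, 0) or (0, 1), and these are smooth; \<open>smooth_on_cong\<close> carries this
  over.\<close>

lemma
  fixes f :: "real \<Rightarrow> real \<Rightarrow> real"
  assumes "smooth_on S (\<lambda>x. f (fst x) (snd x))" "open S"
  shows smooth_on_d_r: "smooth_on S (\<lambda>x. d_r f (fst x) (snd x))"
    and smooth_on_d_th: "smooth_on S (\<lambda>x. d_th f (fst x) (snd x))"
proof -
  obtain D where "\<forall>x\<in>S. ((\<lambda>x. f (fst x) (snd x)) has_derivative (\<lambda>v. D v x)) (at x)"
    "\<forall>v. smooth_on S (D v)"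
    using smooth_on_imp_derivative[OF assms] by blast
  note D = this[rule_format]
  have "d_r f (fst x) (snd x) = D (1, 0) x" "d_th f (fst x) (snd x) = D (0, 1) x" if "x \<in> S" for x
  proof -
    obtain r s where x: "x = (r, s)" by (cases x)
    note d = D(1)[OF that, unfolded x]
    have 1: "((\<lambda>a. (a, s)) has_derivative (\<lambda>a. (a, 0))) (at r)"
      and 2: "((\<lambda>a. (r, a)) has_derivative (\<lambda>a. (0, a))) (at s)"
      by (auto intro!: derivative_eq_intros)
    have l: "D (a, 0) (r, s) = D (1, 0) (r, s) * a" "D (0, a) (r, s) = D (0, 1) (r, s) * a" for a :: real
      using linear_scale[OF has_derivative_linear[OF d], of a "(1, 0)"]
        linear_scale[OF has_derivative_linear[OF d], of a "(0, 1)"] by (auto simp: mult.commute)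
    have "((\<lambda>a. f a s) has_field_derivative D (1, 0) (r, s)) (at r)"
      unfolding has_field_derivative_def fst_conv snd_conv
      using has_derivative_eq_rhs[OF has_derivative_compose[OF 1 d] ext[OF l(1)]] by simp
    moreover have "((\<lambda>a. f r a) has_field_derivative D (0, 1) (r, s)) (at s)"
      unfolding has_field_derivative_def fst_conv snd_conv
      using has_derivative_eq_rhs[OF has_derivative_compose[OF 2 d] ext[OF l(2)]] by simp
    ultimately show "d_r f (fst x) (snd x) = D (1, 0) x" "d_th f (fst x) (snd x) = D (0, 1) x"
      by (auto simp: d_r_def d_th_def x DERIV_imp_deriv)
  qed
  note eq = this[symmetric]
  show "smooth_on S (\<lambda>x. d_r f (fst x) (snd x))"
    by (rule smooth_on_cong[OF assms(2) D(2) eq(1)])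
  show "smooth_on S (\<lambda>x. d_th f (fst x) (snd x))"
    by (rule smooth_on_cong[OF assms(2) D(2) eq(2)])
qed

section \<open>Smoothness of the guiding-centre fields\<close>

definition fields_domain :: "torus_data \<Rightarrow> (real \<times> state \<times> perp) set" where
  "fields_domain D = UNIV \<times> state_space D \<times> UNIV"

lemma open_state_space: "open (state_space D)"
proof -
  have "state_space D = fst -` {0<..<R0 D}" by (auto simp: state_space_def)
  then show ?thesis by (metis open_greaterThanLessThan open_vimage_fst vimage_fst)
qed

lemma open_fields_domain: "open (fields_domain D)"
  unfolding fields_domain_def by (intro open_Times open_UNIV open_state_space)

lemma big_R_pos:
  assumes "0 < r" "r < R0 D" shows "0 < big_R D r \<theta>"
proof -
  have "- (r * cos \<theta>) \<le> r" using assms mult_left_mono[of "- cos \<theta>" 1 r] by simp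
  then show ?thesis using assms by (auto simp: big_R_def)
qed

text \<open>Projections in place of tuple patterns give a form on which the closure rules
  \<open>smooth_intros\<close> can act.\<close>

lemma F_unfold:
  "F D t Z u = (let r = fst Z; ph = fst (snd Z); th = fst (snd (snd Z)); v = fst (snd (snd (snd Z)));
      m = snd (snd (snd (snd Z))); ur = fst u; up = snd u; b = bmag D r th; \<omega> = angle D r th;
      Fp = b * ((gamma D r th * ur + alpha D r th * up) * v
         + b * (delta D r th - d_r (angle D) r th) * up * ur
         + beta D r th * (m / b + b * ((up\<^sup>2 - ur\<^sup>2) / 2))) in
      (b * ur,
       (cos \<omega> * v + b * sin \<omega> * up) / big_R D r th,
       (sin \<omega> * v - b * cos \<omega> * up) / r,
       E_par D t r th ph + Fp,
       - v * Fp + b * (E_r D t r th ph * ur + E_perp D t r th ph * up)))"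
  by (cases Z; cases u) (simp add: Let_def)

lemma U_perp_unfold:
  "U_perp D t Z u = (let r = fst Z; ph = fst (snd Z); th = fst (snd (snd Z)); v = fst (snd (snd (snd Z)));
      m = snd (snd (snd (snd Z))); ur = fst u; up = snd u; b = bmag D r th; \<mu> = m / b in
      (E_perp D t r th ph / b
         - alpha D r th / b * v\<^sup>2
         + (d_r (angle D) r th + delta D r th) * v * ur
         + (eta D r th - beta D r th) * v * up
         + b * (lambda D r th - zeta D r th) * ur * up
         + kappa D r th * (\<mu> + b * ((up\<^sup>2 - ur\<^sup>2) / 2)),
       - (E_r D t r th ph / b)
         + 2 * delta D r th * v * up
         - zeta D r th * b * up\<^sup>2
         + gamma D r th / b * v\<^sup>2
         - eta D r th * ur * v
         - kappa D r th * b * ur * up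
         - lambda D r th * (\<mu> - b * ((up\<^sup>2 - ur\<^sup>2) / 2))))"
  by (cases Z; cases u) (simp add: Let_def)

lemma b_at_unfold: "b_at D Z = bmag D (fst Z) (fst (snd (snd Z)))"
  by (cases Z) simp

context
  fixes D :: torus_data
  assumes sa: "standing_assumptions D"
begin

lemma bmag_pos: "0 < r \<Longrightarrow> r < R0 D \<Longrightarrow> 0 < bmag D r \<theta>"
  using sa unfolding standing_assumptions_def by (meson greaterThanLessThan_iff)

lemma b_at_pos: "Z \<in> state_space D \<Longrightarrow> 0 < b_at D Z"
  by (simp add: bmag_pos b_at_unfold state_space_def)

lemma smooth_on_coefficients:
  defines "A \<equiv> {0<..<R0 D} \<times> (UNIV :: real set)"
  shows "smooth_on A (\<lambda>x. bmag D (fst x) (snd x))"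
    "smooth_on A (\<lambda>x. angle D (fst x) (snd x))"
    "smooth_on A (\<lambda>x. d_r (angle D) (fst x) (snd x))"
    "smooth_on A (\<lambda>x. big_R D (fst x) (snd x))"
    "smooth_on A (\<lambda>x. alpha D (fst x) (snd x))"
    "smooth_on A (\<lambda>x. beta D (fst x) (snd x))"
    "smooth_on A (\<lambda>x. gamma D (fst x) (snd x))"
    "smooth_on A (\<lambda>x. delta D (fst x) (snd x))"
    "smooth_on A (\<lambda>x. zeta D (fst x) (snd x))"
    "smooth_on A (\<lambda>x. eta D (fst x) (snd x))"
    "smooth_on A (\<lambda>x. kappa D (fst x) (snd x))"
    "smooth_on A (\<lambda>x. lambda D (fst x) (snd x))"
proof -
  have "open A" unfolding A_def by (intro open_Times) auto
  show b: "smooth_on A (\<lambda>x. bmag D (fst x) (snd x))"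
    and w: "smooth_on A (\<lambda>x. angle D (fst x) (snd x))"
    using sa boundedly_smooth_on_imp_smooth_on
    unfolding standing_assumptions_def A_def case_prod_beta' by blast+
  note d = smooth_on_d_r[OF b \<open>open A\<close>] smooth_on_d_th[OF b \<open>open A\<close>]
    smooth_on_d_r[OF w \<open>open A\<close>] smooth_on_d_th[OF w \<open>open A\<close>]
  show "smooth_on A (\<lambda>x. d_r (angle D) (fst x) (snd x))" by (rule d)
  show R: "smooth_on A (\<lambda>x. big_R D (fst x) (snd x))"
    unfolding big_R_def by (intro smooth_intros)
  have nz: "fst x \<noteq> 0" "big_R D (fst x) (snd x) \<noteq> 0" "bmag D (fst x) (snd x) \<noteq> 0" if "x \<in> A" for x
    using that big_R_pos[of "fst x" D "snd x"] bmag_pos[of "fst x" "snd x"]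
    by (auto simp: A_def mem_Times_iff)
  note * = smooth_intros d b w R nz
  show "smooth_on A (\<lambda>x. alpha D (fst x) (snd x))" unfolding alpha_def by (intro *)
  show "smooth_on A (\<lambda>x. beta D (fst x) (snd x))" unfolding beta_def by (intro *)
  show "smooth_on A (\<lambda>x. gamma D (fst x) (snd x))" unfolding gamma_def by (intro *)
  show "smooth_on A (\<lambda>x. delta D (fst x) (snd x))" unfolding delta_def by (intro *)
  show "smooth_on A (\<lambda>x. zeta D (fst x) (snd x))" unfolding zeta_def by (intro *)
  show "smooth_on A (\<lambda>x. eta D (fst x) (snd x))" unfolding eta_def by (intro *)
  show "smooth_on A (\<lambda>x. kappa D (fst x) (snd x))" unfolding kappa_def by (intro *)
  show "smooth_on A (\<lambda>x. lambda D (fst x) (snd x))" unfolding lambda_def by (intro *)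
qed

lemma smooth_on_electric:
  fixes f g h k :: "'a::real_normed_vector \<Rightarrow> real"
  assumes "E \<in> {E_r D, E_th D, E_ph D}" "smooth_on S f" "smooth_on S g" "smooth_on S h" "smooth_on S k"
    and "\<And>x. x \<in> S \<Longrightarrow> g x \<in> {0<..<R0 D}"
  shows "smooth_on S (\<lambda>x. E (f x) (g x) (h x) (k x))"
proof -
  have E: "smooth_on (UNIV \<times> {0<..<R0 D} \<times> UNIV \<times> UNIV) (\<lambda>(t, r, \<theta>, \<phi>). E t r \<theta> \<phi>)"
    using sa assms(1) boundedly_smooth_on_imp_smooth_on unfolding standing_assumptions_def by blast
  have "smooth_on S (\<lambda>x. case (f x, g x, h x, k x) of (t, r, \<theta>, \<phi>) \<Rightarrow> E t r \<theta> \<phi>)"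
    by (rule smooth_on_compose[OF E]) (use assms in \<open>auto intro!: smooth_on_Pair\<close>)
  then show ?thesis by simp
qed

lemma
  shows smooth_on_F: "smooth_on (fields_domain D) (\<lambda>p. F D (fst p) (fst (snd p)) (snd (snd p)))"
    and smooth_on_U_perp:
      "smooth_on (fields_domain D) (\<lambda>p. U_perp D (fst p) (fst (snd p)) (snd (snd p)))"
    and smooth_on_b_at: "smooth_on (state_space D) (b_at D)"
proof -
  let ?A = "{0<..<R0 D} \<times> (UNIV :: real set)"
  have r: "fst (fst (snd x)) \<in> {0<..<R0 D}" 
    if "x \<in> fields_domain D" for x
    using that by (auto simp: fields_domain_def state_space_def)
  then have A: "(fst (fst (snd x)), s) \<in> ?A" 
    if "x \<in> fields_domain D" for x s
    using that by auto
  have nz: "fst (fst (snd x)) \<noteq> 0" "big_R D (fst (fst (snd x))) s \<noteq> 0"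
    "bmag D (fst (fst (snd x))) s \<noteq> 0" if "x \<in> fields_domain D" for x s
    using r[OF that] big_R_pos[of "fst (fst (snd x))" D s] bmag_pos[of "fst (fst (snd x))" s]
    by auto
  note E = smooth_on_electric[of "E_r D"] smooth_on_electric[of "E_th D"] smooth_on_electric[of "E_ph D"]
  note * = smooth_intros smooth_on_coefficients[THEN smooth_on_compose2] E r A nz insertI1 insertI2
  show "smooth_on (fields_domain D) (\<lambda>p. F D (fst p) (fst (snd p)) (snd (snd p)))"
    unfolding F_unfold Let_def E_par_def E_perp_def
    by (intro *) simp_all
  show "smooth_on (fields_domain D) (\<lambda>p. U_perp D (fst p) (fst (snd p)) (snd (snd p)))"
    unfolding U_perp_unfold Let_def E_perp_def by (intro *) simp_all
  show "smooth_on (state_space D) (b_at D)"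
    unfolding b_at_unfold[abs_def]
    by (intro smooth_intros smooth_on_coefficients(1)[THEN smooth_on_compose2])
       (auto simp: state_space_def)
qed

end

section \<open>Second-order consistency of the explicit scheme\<close>

lemma gam_pos: "0 < gam"
  by (simp add: gam_def)

lemma has_vector_derivative_bound:
  fixes f :: "real \<Rightarrow> 'a::real_normed_vector"
  assumes "\<And>s. s \<in> {a..b} \<Longrightarrow> (f has_vector_derivative f' s) (at s within {a..b})"
    and "\<And>s. s \<in> {a..b} \<Longrightarrow> norm (f' s) \<le> M" and "a \<le> b"
  shows "norm (f b - f a) \<le> M * (b - a)"
proof -
  have "norm (f b - f a) \<le> M * norm (b - a)"
  proof (rule differentiable_bound[of "{a..b}" f "\<lambda>s x. x *\<^sub>R f' s"])
    show "(f has_derivative (\<lambda>x. x *\<^sub>R f' s)) (at s within {a..b})" if "s \<in> {a..b}" for s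
      using assms(1)[OF that] by (simp add: has_vector_derivative_def)
    show "onorm (\<lambda>x. x *\<^sub>R f' s) \<le> M" if "s \<in> {a..b}" for s
      using assms(2)[OF that] by (intro onorm_le) (simp add: mult.commute[of M] mult_left_mono)
  qed (use assms(3) in auto)
  then show ?thesis using assms(3) by simp
qed

text \<open>Along a solution the direction (1, \<open>G t (z t)\<close>) varies together with the
  point, so a Lipschitz constant in both variables jointly is required. Linearity in the direction
  reduces this to finitely many basis directions.\<close>

lemma smooth_on_directional_derivative:
  fixes f :: "'a::euclidean_space \<Rightarrow> 'b::real_normed_vector"
  assumes "\<And>x. x \<in> S \<Longrightarrow> (f has_derivative (\<lambda>v. D v x)) (at x)" "\<And>v. smooth_on S (D v)" "open S"
  shows "smooth_on (S \<times> UNIV) (\<lambda>q. D (snd q) (fst q))"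
proof (rule smooth_on_cong)
  show "open (S \<times> (UNIV :: 'a set))" by (intro open_Times assms open_UNIV)
  show "smooth_on (S \<times> UNIV) (\<lambda>q. \<Sum>b\<in>Basis. (snd q \<bullet> b) *\<^sub>R D b (fst q))"
    by (intro smooth_on_sum smooth_on_scaleR smooth_on_inner smooth_intros
        smooth_on_compose[OF assms(2)]) auto
  show "(\<Sum>b\<in>Basis. (snd q \<bullet> b) *\<^sub>R D b (fst q)) = D (snd q) (fst q)" if "q \<in> S \<times> UNIV" for q
  proof -
    have "fst q \<in> S" using that by auto
    from linear_expand_Basis[OF has_derivative_linear[OF assms(1)[OF this]], of "snd q"]
    show ?thesis by simp
  qed
qed

text \<open>
  With \<open>g t = G t (z t)\<close>, the curves \<open>s \<mapsto> g (t + s)\<close> and \<open>s \<mapsto> G (t + s) (z t + s *\<^sub>R g t)\<close>, the second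
  of which gives the internal stage at \<open>s = h / (2 * gam)\<close>, agree to first order at \<open>s = 0\<close>.
\<close>

lemma consistent_second_order_rk_step:
  fixes G :: "real \<Rightarrow> 'a::euclidean_space \<Rightarrow> 'a"
  assumes sm: "smooth_on (UNIV \<times> S) (\<lambda>p. G (fst p) (snd p))" and "open S"
  shows "consistent_second_order (rk_step G) G S"
  unfolding consistent_second_order_def
proof (intro allI impI, elim conjE)
  fix z :: "real \<Rightarrow> 'a" and a c :: real
  assume "a < c" and z: "\<forall>t\<in>{a..c}. z t \<in> S \<and> (z has_vector_derivative G t (z t)) (at t within {a..c})"
  let ?\<Omega> = "UNIV \<times> S :: (real \<times> 'a) set"
  have open\<Omega>: "open ?\<Omega>" using \<open>open S\<close> by (intro open_Times) auto
  from smooth_on_imp_derivative[OF sm this] obtain D where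
    "\<forall>p\<in>?\<Omega>. ((\<lambda>p. G (fst p) (snd p)) has_derivative (\<lambda>v. D v p)) (at p)"
    "\<forall>v. smooth_on ?\<Omega> (D v)" by blast
  note D = this[rule_format]
  have smD: "smooth_on (?\<Omega> \<times> UNIV) (\<lambda>q. D (snd q) (fst q))"
    using smooth_on_directional_derivative[OF D open\<Omega>] by simp
  define g where "g t = G t (z t)" for t
  have zS: "z t \<in> S" and dz: "(z has_vector_derivative g t) (at t within {a..c})" if "t \<in> {a..c}" for t
    using z that by (auto simp: g_def)
  have cz: "continuous_on {a..c} z"
    by (rule continuous_on_vector_derivative[OF dz])
  have graph: "continuous_on {a..c} (\<lambda>t. (t, z t))" "(\<lambda>t. (t, z t)) ` {a..c} \<subseteq> ?\<Omega>"
    using zS by (auto intro!: continuous_intros cz)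
  then have cg: "continuous_on {a..c} g"
    using continuous_on_compose2[OF smooth_on_imp_continuous_on[OF sm] graph]
    by (simp add: g_def[abs_def])
  obtain B where B: "B > 0" "\<And>t. t \<in> {a..c} \<Longrightarrow> norm (g t) \<le> B"
    using compact_imp_bounded[OF compact_continuous_image[OF cg compact_Icc]]
    unfolding bounded_pos by auto
  obtain e where e: "e > 0" "(\<Union>x\<in>z ` {a..c}. ball x e) \<subseteq> S"
    using compact_subset_open_imp_ball_epsilon_subset[OF compact_continuous_image[OF cz compact_Icc] \<open>open S\<close>]
      zS by blast
  \<comment> \<open>The stage displacement then has norm at most \<open>\<delta> * B\<close>, that
    is e / 2, and stays in the e-neighbourhood of the solution curve.\<close>
  define \<delta> where "\<delta> = e / (2 * B)"
  have \<delta>: "\<delta> > 0" using e B by (simp add: \<delta>_def)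
  have inS: "z t + s *\<^sub>R g t \<in> S" if "t \<in> {a..c}" "s \<in> {0..\<delta>}" for t s
  proof -
    have "norm (s *\<^sub>R g t) \<le> \<delta> * B" using that B by (auto intro!: mult_mono)
    also have "\<dots> < e" using e B by (simp add: \<delta>_def)
    finally have "z t + s *\<^sub>R g t \<in> ball (z t) e" by (simp add: dist_norm)
    then show ?thesis using e(2) that by blast
  qed
  \<comment> \<open>\<open>\<psi> (t, s)\<close> pairs a point on the straight stage line from
    \<open>z t\<close> with the direction of that line. As s = 0 gives the exact curve, one
    Lipschitz constant on the compact image serves the exact solution and the internal stage
    alike.\<close>
  define \<psi> where "\<psi> x = ((fst x + snd x, z (fst x) + snd x *\<^sub>R g (fst x)), (1::real, g (fst x)))"
    for x :: "real \<times> real"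
  define K where "K = \<psi> ` ({a..c} \<times> {0..\<delta>})"
  have "continuous_on ({a..c} \<times> {0..\<delta>}) \<psi>"
    unfolding \<psi>_def
    by (intro continuous_intros continuous_on_compose2[OF cz] continuous_on_compose2[OF cg]) auto
  then have "compact K"
    unfolding K_def by (intro compact_continuous_image compact_Times) auto
  moreover have "K \<subseteq> ?\<Omega> \<times> UNIV" using inS by (auto simp: K_def \<psi>_def)
  moreover have "open (?\<Omega> \<times> (UNIV :: (real \<times> 'a) set))" by (intro open_Times open\<Omega> open_UNIV)
  ultimately obtain L where L: "L \<ge> 0"
    "\<And>x y. x \<in> K \<Longrightarrow> y \<in> K \<Longrightarrow> norm (D (snd x) (fst x) - D (snd y) (fst y)) \<le> L * norm (x - y)"
    using smooth_on_lipschitz_compact[OF smD] by metis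
  have \<psi>K: "\<psi> (t, s) \<in> K" if "t \<in> {a..c}" "s \<in> {0..\<delta>}" for t s
    using that by (auto simp: K_def)
  have "compact ((\<lambda>t. (t, z t)) ` {a..c})"
    by (intro compact_continuous_image graph) auto
  then obtain L2 where L2_raw: "L2 \<ge> 0" "\<And>x y. x \<in> (\<lambda>t. (t, z t)) ` {a..c} \<Longrightarrow> y \<in> (\<lambda>t. (t, z t)) ` {a..c} \<Longrightarrow>
      norm (G (fst x) (snd x) - G (fst y) (snd y)) \<le> L2 * norm (x - y)"
    by (rule smooth_on_lipschitz_compact[OF sm open\<Omega> _ graph(2)]) (rule that)
  have L2: "norm (g s - g t) \<le> L2 * norm ((s, z s) - (t, z t))" if "s \<in> {a..c}" "t \<in> {a..c}" for s t
    using L2_raw(2)[OF imageI[OF that(1)] imageI[OF that(2)]] by (simp add: g_def)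
  have lipz: "norm (z s - z t) \<le> B * \<bar>s - t\<bar>" if "s \<in> {a..c}" "t \<in> {a..c}" for s t
  proof -
    have *: "norm (z y - z x) \<le> B * (y - x)" if "x \<le> y" "x \<in> {a..c}" "y \<in> {a..c}" for x y
    proof (rule has_vector_derivative_bound)
      fix r assume r: "r \<in> {x..y}"
      with that have "r \<in> {a..c}" by auto
      then show "norm (g r) \<le> B" by (rule B)
      show "(z has_vector_derivative g r) (at r within {x..y})"
        using that by (intro has_vector_derivative_within_subset[OF dz[OF \<open>r \<in> {a..c}\<close>]]) auto
    qed (fact that)
    show ?thesis using *[of s t] *[of t s] that by (cases "s \<le> t") (auto simp: norm_minus_commute)
  qed
  have lipzp: "norm ((s, z s) - (t, z t)) \<le> (1 + B) * \<bar>s - t\<bar>" if "s \<in> {a..c}" "t \<in> {a..c}" for s t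
    using lipz[OF that] norm_Pair_le[of "s - t" "z s - z t"] by (simp add: distrib_right)
  \<comment> \<open>By the chain rule this is the second derivative of the solution z.\<close>
  define q where "q t = D (1, g t) (t, z t)" for t
  have q_eq: "q t = D (snd (\<psi> (t, 0))) (fst (\<psi> (t, 0)))" for t by (simp add: q_def \<psi>_def)
  have dg: "(g has_vector_derivative q t) (at t within {a..c})" if "t \<in> {a..c}" for t
  proof -
    have "((\<lambda>t. (t, z t)) has_vector_derivative (1, g t)) (at t within {a..c})"
      by (intro has_vector_derivative_Pair dz that has_vector_derivative_id)
    moreover have "((\<lambda>p. G (fst p) (snd p)) has_derivative (\<lambda>v. D v (t, z t)))
        (at (t, z t) within (\<lambda>t. (t, z t)) ` {a..c})"
      by (rule has_derivative_at_withinI[OF D(1)]) (use zS[OF that] in auto)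
    ultimately have "((\<lambda>p. G (fst p) (snd p)) \<circ> (\<lambda>t. (t, z t)) has_vector_derivative D (1, g t) (t, z t))
        (at t within {a..c})"
      by (rule vector_derivative_diff_chain_within)
    then show ?thesis by (simp add: o_def g_def[abs_def] q_def)
  qed
  define L' where "L' = L * (1 + B + L2 * (1 + B))"
  have L': "L' \<ge> 0" using L L2_raw(1) B by (simp add: L'_def)
  have lipq: "norm (q s - q t) \<le> L' * \<bar>s - t\<bar>" if "s \<in> {a..c}" "t \<in> {a..c}" for s t
  proof -
    have eq: "\<psi> (s, 0) - \<psi> (t, 0) = ((s, z s) - (t, z t), (0, g s - g t))" by (simp add: \<psi>_def)
    have "norm (q s - q t) \<le> L * norm (\<psi> (s, 0) - \<psi> (t, 0))"
      unfolding q_eq using that \<delta> by (intro L \<psi>K) auto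
    also have "norm (\<psi> (s, 0) - \<psi> (t, 0)) \<le> norm ((s, z s) - (t, z t)) + norm (0::real, g s - g t)"
      unfolding eq by (rule norm_Pair_le)
    also have "norm (0::real, g s - g t) = norm (g s - g t)" by (simp add: norm_Pair)
    also have "norm ((s, z s) - (t, z t)) + norm (g s - g t) \<le> (1 + B + L2 * (1 + B)) * \<bar>s - t\<bar>"
      using lipzp[OF that] L2[OF that] mult_left_mono[OF lipzp[OF that] L2_raw(1)]
      by (simp add: algebra_simps)
    finally show ?thesis using L(1) by (simp add: L'_def mult_left_mono mult.assoc)
  qed
  \<comment> \<open>The first term is the Taylor remainder of the exact solution; the second is
    \<open>gam\<close> times the remainder of the internal stage, which is quadratic in its offset h
    / (2 gam).\<close>
  define C where "C = L' + gam * (L * (1 + B) * (1 / (2 * gam))\<^sup>2)"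
  show "\<exists>C h0. 0 < h0 \<and> (\<forall>h t. 0 < h \<and> h \<le> h0 \<and> a \<le> t \<and> t + h \<le> c \<longrightarrow>
      norm (z (t + h) - rk_step G h t (z t)) \<le> C * h ^ 3)"
  \<comment> \<open>This step bound keeps the stage offset h / (2 gam) below \<delta>.\<close>
  proof (rule exI[of _ C], rule exI[of _ "\<delta> * (2 * gam)"], intro conjI allI impI; (elim conjE)?)
    show "0 < \<delta> * (2 * gam)" using \<delta> gam_pos by simp
    fix h t assume h: "0 < h" "h \<le> \<delta> * (2 * gam)" and t: "a \<le> t" "t + h \<le> c"
    have tac: "t \<in> {a..c}" using h t by auto
    \<comment> \<open>Taylor's formula is obtained by using the mean value inequality twice, here
      for g minus its linear part and then for z minus its quadratic part, starting from the
      Lipschitz bound on q.\<close>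
    have exact_g: "norm (g s - g t - (s - t) *\<^sub>R q t) \<le> L' * h * h" if s: "s \<in> {t..t + h}" for s
    proof -
      have "norm ((g s - (s - t) *\<^sub>R q t) - (g t - (t - t) *\<^sub>R q t)) \<le> L' * h * (s - t)"
      proof (rule has_vector_derivative_bound)
        fix r assume r: "r \<in> {t..s}"
        then have rac: "r \<in> {a..c}" and "r - t \<le> h" using s t by auto
        show "((\<lambda>s. g s - (s - t) *\<^sub>R q t) has_vector_derivative q r - q t) (at r within {t..s})"
          using has_vector_derivative_within_subset[OF dg[OF rac], of "{t..s}"] s t
          by (auto intro!: derivative_eq_intros)
        have "norm (q r - q t) \<le> L' * \<bar>r - t\<bar>" by (rule lipq[OF rac tac])
        also have "\<dots> \<le> L' * h" using r \<open>r - t \<le> h\<close> L' by (intro mult_left_mono) auto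
        finally show "norm (q r - q t) \<le> L' * h" .
      qed (use s in auto)
      also have "\<dots> \<le> L' * h * h" using s h L' by (intro mult_left_mono) auto
      finally show ?thesis by (simp add: algebra_simps)
    qed
    have "norm ((z (t + h) - (t + h - t) *\<^sub>R g t - ((t + h - t)\<^sup>2 / 2) *\<^sub>R q t)
        - (z t - (t - t) *\<^sub>R g t - ((t - t)\<^sup>2 / 2) *\<^sub>R q t)) \<le> L' * h * h * (t + h - t)"
    proof (rule has_vector_derivative_bound)
      fix r assume r: "r \<in> {t..t + h}"
      then have rac: "r \<in> {a..c}" using t by auto
      show "((\<lambda>s. z s - (s - t) *\<^sub>R g t - ((s - t)\<^sup>2 / 2) *\<^sub>R q t) has_vector_derivative
          g r - g t - (r - t) *\<^sub>R q t) (at r within {t..t + h})"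
        using has_vector_derivative_within_subset[OF dz[OF rac], of "{t..t + h}"] t
        by (auto intro!: derivative_eq_intros)
      show "norm (g r - g t - (r - t) *\<^sub>R q t) \<le> L' * h * h" by (rule exact_g[OF r])
    qed (use h in auto)
    then have exact: "norm (z (t + h) - (z t + h *\<^sub>R g t + (h\<^sup>2 / 2) *\<^sub>R q t)) \<le> L' * h ^ 3"
      by (simp add: algebra_simps power3_eq_cube)
    define \<tau> where "\<tau> = h * (1 / (2 * gam))"
    \<comment> \<open>The identity \<open>gam * \<tau> = h / 2\<close> is the second-order
      condition: it makes the coefficient of \<open>q t\<close> in the scheme equal to the Taylor
      coefficient \<open>h\<^sup>2 / 2\<close>.\<close>
    have \<tau>: "0 < \<tau>" "\<tau> \<le> \<delta>" "gam * \<tau> = h / 2" using h gam_pos by (auto simp: \<tau>_def field_simps)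
    define \<phi> where "\<phi> s = G (t + s) (z t + s *\<^sub>R g t)" for s
    have "norm ((\<phi> \<tau> - \<tau> *\<^sub>R q t) - (\<phi> 0 - 0 *\<^sub>R q t)) \<le> L * (1 + B) * \<tau> * (\<tau> - 0)"
    proof (rule has_vector_derivative_bound)
      fix s assume s: "s \<in> {0..\<tau>}"
      then have s\<delta>: "s \<in> {0..\<delta>}" using \<tau> by auto
      let ?d = "D (snd (\<psi> (t, s))) (fst (\<psi> (t, s)))"
      have "((\<lambda>s. (t + s, z t + s *\<^sub>R g t)) has_vector_derivative (1, g t)) (at s within {0..\<tau>})"
        by (auto intro!: derivative_eq_intros has_vector_derivative_Pair)
      moreover have "((\<lambda>p. G (fst p) (snd p)) has_derivative (\<lambda>v. D v (t + s, z t + s *\<^sub>R g t)))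
          (at (t + s, z t + s *\<^sub>R g t) within (\<lambda>s. (t + s, z t + s *\<^sub>R g t)) ` {0..\<tau>})"
        by (rule has_derivative_at_withinI[OF D(1)]) (use inS[OF tac s\<delta>] in auto)
      ultimately have "((\<lambda>p. G (fst p) (snd p)) \<circ> (\<lambda>s. (t + s, z t + s *\<^sub>R g t)) has_vector_derivative
          D (1, g t) (t + s, z t + s *\<^sub>R g t)) (at s within {0..\<tau>})"
        by (rule vector_derivative_diff_chain_within)
      then have "(\<phi> has_vector_derivative ?d) (at s within {0..\<tau>})"
        by (simp add: o_def \<phi>_def[abs_def] \<psi>_def)
      then show "((\<lambda>s. \<phi> s - s *\<^sub>R q t) has_vector_derivative ?d - q t) (at s within {0..\<tau>})"
        by (auto intro!: derivative_eq_intros)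
      have eq: "\<psi> (t, s) - \<psi> (t, 0) = ((s, s *\<^sub>R g t), 0)" by (simp add: \<psi>_def zero_prod_def)
      have "norm (?d - q t) \<le> L * norm (\<psi> (t, s) - \<psi> (t, 0))"
        unfolding q_eq using \<delta> by (intro L \<psi>K tac s\<delta>) auto
      also have "norm (\<psi> (t, s) - \<psi> (t, 0)) = norm (s, s *\<^sub>R g t)"
        unfolding eq by (simp add: norm_Pair)
      also have "\<dots> \<le> norm s + norm (s *\<^sub>R g t)" by (rule norm_Pair_le)
      also have "\<dots> \<le> (1 + B) * \<tau>"
      proof -
        have "s * norm (g t) \<le> \<tau> * B" using s B(2)[OF tac] by (intro mult_mono) auto
        then show ?thesis using s by (simp add: algebra_simps)
      qed
      finally show "norm (?d - q t) \<le> L * (1 + B) * \<tau>" using L(1) by (simp add: mult_left_mono mult.assoc)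
    qed (use \<tau> in auto)
    moreover have "(\<phi> \<tau> - \<tau> *\<^sub>R q t) - (\<phi> 0 - 0 *\<^sub>R q t) = \<phi> \<tau> - g t - \<tau> *\<^sub>R q t"
      by (simp add: \<phi>_def g_def)
    moreover have "L * (1 + B) * \<tau> * (\<tau> - 0) = L * (1 + B) * (1 / (2 * gam))\<^sup>2 * h\<^sup>2"
      by (simp add: \<tau>_def power2_eq_square)
    ultimately have num: "norm (\<phi> \<tau> - g t - \<tau> *\<^sub>R q t) \<le> L * (1 + B) * (1 / (2 * gam))\<^sup>2 * h\<^sup>2"
      by (simp only:)
    have "rk_step G h t (z t) = z t + h *\<^sub>R ((1 - gam) *\<^sub>R g t + gam *\<^sub>R \<phi> \<tau>)"
      by (simp add: rk_step_def rk_stage_def stage_time_def \<phi>_def g_def \<tau>_def)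
    also have "\<dots> = (z t + h *\<^sub>R g t + (h * (gam * \<tau>)) *\<^sub>R q t) + (h * gam) *\<^sub>R (\<phi> \<tau> - g t - \<tau> *\<^sub>R q t)"
      by (simp add: algebra_simps)
    also have "h * (gam * \<tau>) = h\<^sup>2 / 2" by (simp add: \<tau>(3) power2_eq_square)
    finally have "z (t + h) - rk_step G h t (z t) =
        (z (t + h) - (z t + h *\<^sub>R g t + (h\<^sup>2 / 2) *\<^sub>R q t)) - (h * gam) *\<^sub>R (\<phi> \<tau> - g t - \<tau> *\<^sub>R q t)"
      by simp
    then have "norm (z (t + h) - rk_step G h t (z t)) \<le> L' * h ^ 3
        + norm ((h * gam) *\<^sub>R (\<phi> \<tau> - g t - \<tau> *\<^sub>R q t))"
      using exact norm_triangle_ineq4 by (smt (verit))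
    also have "norm ((h * gam) *\<^sub>R (\<phi> \<tau> - g t - \<tau> *\<^sub>R q t)) \<le>
        (h * gam) * (L * (1 + B) * (1 / (2 * gam))\<^sup>2 * h\<^sup>2)"
      using num h gam_pos by (simp add: mult_left_mono)
    finally show "norm (z (t + h) - rk_step G h t (z t)) \<le> C * h ^ 3"
      by (simp add: C_def power2_eq_square power3_eq_cube algebra_simps)
  qed
qed

section \<open>The implicit stages and the limit of vanishing Larmor radius\<close>

lemma bounded_linear_J0: "bounded_linear J0"
proof -
  have "J0 = (\<lambda>p. (snd p, - fst p))" by auto
  moreover have "bounded_linear (\<lambda>p::perp. (snd p, - fst p))"
    by (intro bounded_linear_Pair bounded_linear_snd bounded_linear_minus bounded_linear_fst)
  ultimately show ?thesis by (simp only:)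
qed

lemma linear_J0: "linear J0"
  by (rule bounded_linear.linear[OF bounded_linear_J0])

lemma norm_J0 [simp]: "norm (J0 u) = norm u"
  by (cases u) (simp add: norm_Pair add.commute)

lemma norm_le_of_rotation_eq:
  assumes "a *\<^sub>R w + c *\<^sub>R J0 w = y" "0 < a"
  shows "norm w \<le> norm y / a"
proof -
  have "w \<bullet> J0 w = 0" by (cases w) (simp add: inner_prod_def)
  then have "a * (norm w)\<^sup>2 = w \<bullet> y"
    by (simp add: assms(1)[symmetric] inner_add_right power2_norm_eq_inner)
  also have "\<dots> \<le> norm w * norm y" by (rule norm_cauchy_schwarz)
  finally have "norm w * (a * norm w) \<le> norm w * norm y"
    by (simp add: power2_eq_square algebra_simps)
  then have "w = 0 \<or> a * norm w \<le> norm y"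
    by (auto simp: mult_le_cancel_left)
  then show ?thesis using assms(2) by (auto simp: field_simps)
qed

text \<open>
  Since \<open>U_perp\<close> is quadratic in \<open>u\<close>, its even and odd parts separate the degrees; with \<open>s = sqrt \<epsilon>\<close>
  only \<open>sqrt \<epsilon> u\<close>, and not the possibly unbounded \<open>u\<close>, remains on the right.
\<close>

lemma U_perp_rescale:
  "s\<^sup>2 *\<^sub>R U_perp D t Z u = s\<^sup>2 *\<^sub>R U_perp D t Z 0
     + (s / 2) *\<^sub>R (U_perp D t Z (s *\<^sub>R u) - U_perp D t Z (- (s *\<^sub>R u)))
     + ((1 / 2) *\<^sub>R (U_perp D t Z (s *\<^sub>R u) + U_perp D t Z (- (s *\<^sub>R u))) - U_perp D t Z 0)"
  unfolding U_perp_unfold Let_def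
  by (rule prod_eqI) (simp_all add: algebra_simps power2_eq_square add_divide_distrib diff_divide_distrib)

lemma slaved_eq: "slaved D \<epsilon> t Z = \<epsilon> *\<^sub>R ((1 / b_at D Z) *\<^sub>R U_bar D t Z)"
  by (simp add: slaved_def)

text \<open>Makes the consistency of the gyro-kinetic scheme the case \<epsilon> = 0 of the
  corrected one.\<close>

lemma corrected_field_0: "corrected_field D 0 = gyro_field D"
  by (rule ext)+ (simp add: corrected_field_def gyro_field_def slaved_def zero_prod_def)

lemma fst_F_0: "fst (F D t Z 0) = 0"
  by (simp add: F_unfold Let_def)

text \<open>The radius is an invariant of the limit scheme and of its internal stage. Hence a limit
  run started in \<open>state_space D\<close> stays there and keeps its distance from r = 0 and r =
  R0.\<close>

lemma fst_rk_gyro: "fst (rk_stage (gyro_field D) h t Z) = fst Z" "fst (rk_step (gyro_field D) h t Z) = fst Z"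
  by (simp_all add: rk_stage_def rk_step_def gyro_field_def fst_F_0)

section \<open>Algebraic form of one step\<close>

context
  fixes D :: torus_data and \<epsilon> h t :: real and Z Z1 Z' :: state and u u1 u' :: perp
  assumes step: "imex_step D \<epsilon> h t Z u Z1 u1 Z' u'" and h: "0 < h" and \<epsilon>: "0 < \<epsilon>"
begin

text \<open>Extrapolation stretches the first-stage displacement, of length \<open>h * gam\<close>,
  by \<open>1 / (2 * gam\<^sup>2)\<close>. The result h / (2 gam) is the offset of
  \<open>rk_stage\<close> and of \<open>stage_time\<close>.\<close>

lemma imex_step_extrapolate: "extrapolate Z Z1 = Z + (h * (1 / (2 * gam))) *\<^sub>R F D t Z u1"
proof -
  have "Z1 - Z = h *\<^sub>R ((1 / h) *\<^sub>R (Z1 - Z))" using h by simp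
  also have "\<dots> = (h * gam) *\<^sub>R F D t Z u1"
    using step by (simp add: imex_step_def Let_def)
  finally have 1: "Z1 = Z + (h * gam) *\<^sub>R F D t Z u1" by (simp add: algebra_simps)
  show ?thesis unfolding extrapolate_def 1
    using gam_pos by (simp add: algebra_simps power2_eq_square)
qed

lemma imex_step_result: "Z' = Z + h *\<^sub>R ((1 - gam) *\<^sub>R F D t Z u1
    + gam *\<^sub>R F D (stage_time h t) (extrapolate Z Z1) u')"
proof -
  have "Z' - Z = h *\<^sub>R ((1 / h) *\<^sub>R (Z' - Z))" using h by simp
  also have "(1 / h) *\<^sub>R (Z' - Z) = (1 - gam) *\<^sub>R F D t Z u1
      + gam *\<^sub>R F D (stage_time h t) (extrapolate Z Z1) u'"
    using step by (simp only: imex_step_def Let_def)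
  finally show ?thesis by (simp only: diff_eq_eq add.commute)
qed

text \<open>Scaling the velocity equation by \<open>\<epsilon> / gam\<close> leaves the stiff term
  with the coefficient b, which does not degenerate as \<epsilon> tends to 0.\<close>

lemma imex_step_relax1:
  "b_at D Z *\<^sub>R u1 + (\<epsilon> / (h * gam)) *\<^sub>R J0 u1 = \<epsilon> *\<^sub>R U_perp D t Z u + (\<epsilon> / (h * gam)) *\<^sub>R J0 u"
proof -
  have "(\<epsilon> / (h * gam)) *\<^sub>R J0 (u1 - u) = (\<epsilon> / gam) *\<^sub>R J0 ((1 / h) *\<^sub>R (u1 - u))"
    by (simp add: linear_scale[OF linear_J0])
  also have "\<dots> = \<epsilon> *\<^sub>R U_perp D t Z u - b_at D Z *\<^sub>R u1"
    using step \<epsilon> gam_pos by (simp add: imex_step_def Let_def scaleR_diff_right)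
  finally show ?thesis by (simp add: linear_diff[OF linear_J0] algebra_simps)
qed

text \<open>The first-stage residual is kept as one term: by \<open>imex_step_relax1\<close> it
  equals \<open>\<epsilon> / (h * gam)\<close> times \<open>J0 u1 - J0 u\<close>, which is one order
  smaller than its two parts once u is O(\<epsilon>).\<close>

lemma imex_step_relax2:
  "b_at D (extrapolate Z Z1) *\<^sub>R u' + (\<epsilon> / (h * gam)) *\<^sub>R J0 u' =
     \<epsilon> *\<^sub>R U_perp D (stage_time h t) (extrapolate Z Z1) (extrapolate u u1) + (\<epsilon> / (h * gam)) *\<^sub>R J0 u
     + ((1 - gam) / gam) *\<^sub>R (\<epsilon> *\<^sub>R U_perp D t Z u - b_at D Z *\<^sub>R u1)"
proof -
  have "(\<epsilon> / (h * gam)) *\<^sub>R J0 (u' - u) = (\<epsilon> / gam) *\<^sub>R J0 ((1 / h) *\<^sub>R (u' - u))"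
    by (simp add: linear_scale[OF linear_J0])
  also have "\<dots> = ((1 - gam) / gam) *\<^sub>R (\<epsilon> *\<^sub>R (U_perp D t Z u - (b_at D Z / \<epsilon>) *\<^sub>R u1))
      + \<epsilon> *\<^sub>R (U_perp D (stage_time h t) (extrapolate Z Z1) (extrapolate u u1)
        - (b_at D (extrapolate Z Z1) / \<epsilon>) *\<^sub>R u')"
  proof -
    have "J0 ((1 / h) *\<^sub>R (u' - u)) = (1 - gam) *\<^sub>R (U_perp D t Z u - (b_at D Z / \<epsilon>) *\<^sub>R u1)
        + gam *\<^sub>R (U_perp D (stage_time h t) (extrapolate Z Z1) (extrapolate u u1)
          - (b_at D (extrapolate Z Z1) / \<epsilon>) *\<^sub>R u')"
      using step by (simp only: imex_step_def Let_def)
    then show ?thesis using gam_pos by (simp only:) (simp add: scaleR_add_right)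
  qed
  finally show ?thesis
    using \<epsilon> by (simp add: linear_diff[OF linear_J0] scaleR_diff_right algebra_simps)
qed

end

section \<open>Consistency of the explicit schemes and the limit of vanishing \<epsilon>\<close>

context
  fixes D :: torus_data
  assumes sa: "standing_assumptions D"
begin

lemma smooth_on_drift:
  "smooth_on (UNIV \<times> state_space D) (\<lambda>p. (1 / b_at D (snd p)) *\<^sub>R U_bar D (fst p) (snd p))"
proof -
  have "smooth_on (UNIV \<times> state_space D) (\<lambda>p. U_perp D (fst p) (snd p) 0)"
  proof -
    have "smooth_on (UNIV \<times> state_space D) (\<lambda>p::real \<times> state. (fst p, snd p, 0 :: perp))"
      by (intro smooth_intros)
    moreover have "(\<lambda>p. (fst p, snd p, 0 :: perp)) ` (UNIV \<times> state_space D) \<subseteq> fields_domain D"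
      by (auto simp: fields_domain_def)
    ultimately show ?thesis using smooth_on_compose[OF smooth_on_U_perp[OF sa]] by fastforce
  qed
  moreover have "smooth_on ((UNIV :: real set) \<times> state_space D) (\<lambda>p. b_at D (snd p))"
    by (rule smooth_on_compose[OF smooth_on_b_at[OF sa] smooth_on_snd[OF smooth_on_id]]) auto
  ultimately show ?thesis
    unfolding U_bar_def using b_at_pos[OF sa]
    by (intro smooth_on_scaleR smooth_on_divide smooth_on_const) force+
qed

lemma smooth_on_corrected_field:
  "smooth_on (UNIV \<times> state_space D) (\<lambda>p. corrected_field D \<epsilon> (fst p) (snd p))"
proof -
  have "smooth_on (UNIV \<times> state_space D) (\<lambda>p. (fst p, snd p, slaved D \<epsilon> (fst p) (snd p)))"
    unfolding slaved_eq by (intro smooth_intros smooth_on_drift)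
  moreover have "(\<lambda>p. (fst p, snd p, slaved D \<epsilon> (fst p) (snd p))) ` (UNIV \<times> state_space D)
      \<subseteq> fields_domain D"
    by (auto simp: fields_domain_def)
  ultimately show ?thesis
    unfolding corrected_field_def using smooth_on_compose[OF smooth_on_F[OF sa]] by fastforce
qed

lemma consistent_corrected:
  "consistent_second_order (rk_step (corrected_field D \<epsilon>)) (corrected_field D \<epsilon>) (state_space D)"
  by (rule consistent_second_order_rk_step[OF smooth_on_corrected_field open_state_space])

lemma consistent_gyro:
  "consistent_second_order (rk_step (gyro_field D)) (gyro_field D) (state_space D)"
  using consistent_corrected[of 0] by (simp add: corrected_field_0)

lemma tendsto_smooth_field:
  assumes "smooth_on (fields_domain D) (\<lambda>p. f (fst p) (fst (snd p)) (snd (snd p)))"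
    and "(Z \<longlongrightarrow> z) Fl" "(u \<longlongrightarrow> w) Fl" "z \<in> state_space D"
  shows "((\<lambda>x. f t (Z x) (u x)) \<longlongrightarrow> f t z w) Fl"
proof -
  have "(t, z, w) \<in> fields_domain D" using assms(4) by (simp add: fields_domain_def)
  with smooth_on_imp_continuous_on[OF assms(1)]
  have "isCont (\<lambda>p. f (fst p) (fst (snd p)) (snd (snd p))) (t, z, w)"
    by (simp add: continuous_on_eq_continuous_at open_fields_domain)
  moreover have "((\<lambda>x. (t, Z x, u x)) \<longlongrightarrow> (t, z, w)) Fl"
    by (intro tendsto_intros assms)
  ultimately show ?thesis using isCont_tendsto_compose by fastforce
qed

lemmas tendsto_F = tendsto_smooth_field[OF smooth_on_F[OF sa]]
lemmas tendsto_U_perp = tendsto_smooth_field[OF smooth_on_U_perp[OF sa]]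

lemma tendsto_b_at:
  assumes "(Z \<longlongrightarrow> z) Fl" "z \<in> state_space D"
  shows "((\<lambda>x. b_at D (Z x)) \<longlongrightarrow> b_at D z) Fl"
proof -
  have "isCont (b_at D) z"
    using smooth_on_imp_continuous_on[OF smooth_on_b_at[OF sa]] open_state_space assms(2)
    by (simp add: continuous_on_eq_continuous_at)
  then show ?thesis using assms(1) by (rule isCont_tendsto_compose)
qed

lemma tendsto_scaled_U_perp:
  assumes "((\<lambda>\<epsilon>. sqrt \<epsilon> *\<^sub>R u \<epsilon>) \<longlongrightarrow> 0) (at_right 0)" "(Z \<longlongrightarrow> z) (at_right 0)" "z \<in> state_space D"
  shows "((\<lambda>\<epsilon>. \<epsilon> *\<^sub>R U_perp D t (Z \<epsilon>) (u \<epsilon>)) \<longlongrightarrow> 0) (at_right 0)"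
proof -
  let ?w = "\<lambda>\<epsilon>. sqrt \<epsilon> *\<^sub>R u \<epsilon>"
  let ?U = "\<lambda>\<epsilon>. U_perp D t (Z \<epsilon>)"
  have s: "((\<lambda>\<epsilon>. sqrt \<epsilon>) \<longlongrightarrow> 0) (at_right (0::real))"
    using tendsto_real_sqrt[OF tendsto_ident_at, of 0 "{0<..}"] by simp
  have w: "((\<lambda>\<epsilon>. - ?w \<epsilon>) \<longlongrightarrow> 0) (at_right 0)" using tendsto_minus[OF assms(1)] by simp
  note U = tendsto_U_perp[OF assms(2) assms(1) assms(3), of t] tendsto_U_perp[OF assms(2) w assms(3), of t]
    tendsto_U_perp[OF assms(2) tendsto_const assms(3), of t 0]
  \<comment> \<open>Every velocity argument tends to 0. The first two summands vanish through their
    prefactors, the last one because the even part converges to the value at zero velocity.\<close>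
  have "((\<lambda>\<epsilon>. (sqrt \<epsilon>)\<^sup>2 *\<^sub>R ?U \<epsilon> 0 + (sqrt \<epsilon> / 2) *\<^sub>R (?U \<epsilon> (?w \<epsilon>) - ?U \<epsilon> (- ?w \<epsilon>))
      + ((1 / 2) *\<^sub>R (?U \<epsilon> (?w \<epsilon>) + ?U \<epsilon> (- ?w \<epsilon>)) - ?U \<epsilon> 0)) \<longlongrightarrow>
      0\<^sup>2 *\<^sub>R U_perp D t z 0 + (0 / 2) *\<^sub>R (U_perp D t z 0 - U_perp D t z 0)
      + ((1 / 2) *\<^sub>R (U_perp D t z 0 + U_perp D t z 0) - U_perp D t z 0)) (at_right 0)"
    by (intro tendsto_add tendsto_diff tendsto_scaleR tendsto_power tendsto_divide U s tendsto_const) auto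
  then have "((\<lambda>\<epsilon>. (sqrt \<epsilon>)\<^sup>2 *\<^sub>R ?U \<epsilon> (u \<epsilon>)) \<longlongrightarrow> 0) (at_right 0)"
    unfolding U_perp_rescale[symmetric] by (simp flip: scaleR_add_left add: scaleR_2[symmetric])
  \<comment> \<open>\<open>(sqrt \<epsilon>)\<^sup>2\<close> equals \<epsilon> for \<epsilon> > 0,
    hence eventually along \<open>at_right 0\<close>.\<close>
  then show ?thesis
    by (rule Lim_transform_eventually) (auto simp: eventually_at_filter)
qed

lemma tendsto_0_of_rotation_eq:
  fixes w y :: "'i \<Rightarrow> perp"
  assumes "(y \<longlongrightarrow> 0) Fl" "(a \<longlongrightarrow> a0) Fl" "0 < a0"
    and "\<forall>\<^sub>F x in Fl. a x *\<^sub>R w x + c x *\<^sub>R J0 (w x) = y x"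
  shows "(w \<longlongrightarrow> 0) Fl"
proof (rule tendsto_norm_zero_cancel, rule Lim_null_comparison)
  have "\<forall>\<^sub>F x in Fl. 0 < a x" using order_tendstoD(1)[OF assms(2,3)] .
  with assms(4) show "\<forall>\<^sub>F x in Fl. norm (norm (w x)) \<le> norm (y x) / a x"
    by eventually_elim (simp add: norm_le_of_rotation_eq)
  show "((\<lambda>x. norm (y x) / a x) \<longlongrightarrow> 0) Fl"
    using tendsto_divide[OF tendsto_norm[OF assms(1)] assms(2)] assms(3) by simp
qed

lemma imex_step_tendsto:
  assumes "0 < h" "z \<in> state_space D"
    and step: "\<forall>\<^sub>F \<epsilon> in at_right 0. imex_step D \<epsilon> h t (Z \<epsilon>) (u \<epsilon>) (Z1 \<epsilon>) (u1 \<epsilon>) (Z' \<epsilon>) (u' \<epsilon>)"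
    and Z: "(Z \<longlongrightarrow> z) (at_right 0)" and u: "((\<lambda>\<epsilon>. sqrt \<epsilon> *\<^sub>R u \<epsilon>) \<longlongrightarrow> 0) (at_right 0)"
  shows "(Z' \<longlongrightarrow> rk_step (gyro_field D) h t z) (at_right 0)" "(u' \<longlongrightarrow> 0) (at_right 0)"
proof -
  let ?F = "at_right (0::real)"
  have pos: "\<forall>\<^sub>F \<epsilon> in ?F. 0 < (\<epsilon>::real)" by (auto simp: eventually_at_filter)
  have s: "((\<lambda>\<epsilon>. sqrt \<epsilon>) \<longlongrightarrow> 0) ?F"
    using tendsto_real_sqrt[OF tendsto_ident_at, of 0 "{0<..}"] by simp
  \<comment> \<open>Only \<open>sqrt \<epsilon> *\<^sub>R u \<epsilon>\<close> is known to converge,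
    so the factor \<epsilon> is split evenly between coefficient and velocity.\<close>
  have "((\<lambda>\<epsilon>. (sqrt \<epsilon> / (h * gam)) *\<^sub>R J0 (sqrt \<epsilon> *\<^sub>R u \<epsilon>)) \<longlongrightarrow> (0 / (h * gam)) *\<^sub>R J0 0) ?F"
    using \<open>0 < h\<close> gam_pos
    by (intro tendsto_scaleR tendsto_divide s tendsto_const bounded_linear.tendsto[OF bounded_linear_J0] u) auto
  then have "((\<lambda>\<epsilon>. (sqrt \<epsilon> / (h * gam)) *\<^sub>R J0 (sqrt \<epsilon> *\<^sub>R u \<epsilon>)) \<longlongrightarrow> 0) ?F" by simp
  moreover have "\<forall>\<^sub>F \<epsilon> in ?F. (sqrt \<epsilon> / (h * gam)) *\<^sub>R J0 (sqrt \<epsilon> *\<^sub>R u \<epsilon>) = (\<epsilon> / (h * gam)) *\<^sub>R J0 (u \<epsilon>)"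
    using pos by eventually_elim (simp add: linear_scale[OF linear_J0])
  ultimately have cu: "((\<lambda>\<epsilon>. (\<epsilon> / (h * gam)) *\<^sub>R J0 (u \<epsilon>)) \<longlongrightarrow> 0) ?F"
    by (rule Lim_transform_eventually)
  note U0 = tendsto_scaled_U_perp[OF u Z \<open>z \<in> state_space D\<close>, of t]
  note b0 = tendsto_b_at[OF Z \<open>z \<in> state_space D\<close>]
  have u1: "(u1 \<longlongrightarrow> 0) ?F"
  proof (rule tendsto_0_of_rotation_eq[OF _ b0 b_at_pos[OF sa \<open>z \<in> state_space D\<close>]])
    show "((\<lambda>\<epsilon>. \<epsilon> *\<^sub>R U_perp D t (Z \<epsilon>) (u \<epsilon>) + (\<epsilon> / (h * gam)) *\<^sub>R J0 (u \<epsilon>)) \<longlongrightarrow> 0) ?F"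
      using tendsto_add[OF U0 cu] by simp
    show "\<forall>\<^sub>F \<epsilon> in ?F. b_at D (Z \<epsilon>) *\<^sub>R u1 \<epsilon> + (\<epsilon> / (h * gam)) *\<^sub>R J0 (u1 \<epsilon>) =
        \<epsilon> *\<^sub>R U_perp D t (Z \<epsilon>) (u \<epsilon>) + (\<epsilon> / (h * gam)) *\<^sub>R J0 (u \<epsilon>)"
      using step pos by eventually_elim (rule imex_step_relax1[OF _ \<open>0 < h\<close>])
  qed
  let ?Zh = "\<lambda>\<epsilon>. extrapolate (Z \<epsilon>) (Z1 \<epsilon>)" and ?uh = "\<lambda>\<epsilon>. extrapolate (u \<epsilon>) (u1 \<epsilon>)"
  let ?zh = "rk_stage (gyro_field D) h t z" and ?th = "stage_time h t"
  have zh: "?zh \<in> state_space D" using \<open>z \<in> state_space D\<close> by (simp add: state_space_def fst_rk_gyro)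
  have "((\<lambda>\<epsilon>. Z \<epsilon> + (h * (1 / (2 * gam))) *\<^sub>R F D t (Z \<epsilon>) (u1 \<epsilon>)) \<longlongrightarrow> ?zh) ?F"
    unfolding rk_stage_def gyro_field_def
    by (intro tendsto_intros Z tendsto_F u1 \<open>z \<in> state_space D\<close>)
  moreover have "\<forall>\<^sub>F \<epsilon> in ?F. Z \<epsilon> + (h * (1 / (2 * gam))) *\<^sub>R F D t (Z \<epsilon>) (u1 \<epsilon>) = ?Zh \<epsilon>"
    using step pos by eventually_elim (rule imex_step_extrapolate[OF _ \<open>0 < h\<close>, symmetric])
  ultimately have Zh: "(?Zh \<longlongrightarrow> ?zh) ?F"
    by (rule Lim_transform_eventually)
  \<comment> \<open>The extrapolated velocity contains u, which may blow up; it too is followed in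
    the scaling by sqrt \<epsilon>, as \<open>tendsto_scaled_U_perp\<close> asks for.\<close>
  have "((\<lambda>\<epsilon>. (1 - 1 / (2 * gam\<^sup>2)) *\<^sub>R (sqrt \<epsilon> *\<^sub>R u \<epsilon>) + (1 / (2 * gam\<^sup>2)) *\<^sub>R (sqrt \<epsilon> *\<^sub>R u1 \<epsilon>)) \<longlongrightarrow>
      (1 - 1 / (2 * gam\<^sup>2)) *\<^sub>R 0 + (1 / (2 * gam\<^sup>2)) *\<^sub>R (0 *\<^sub>R 0)) ?F"
    by (intro tendsto_add tendsto_scaleR tendsto_const u u1 s)
  then have uh: "((\<lambda>\<epsilon>. sqrt \<epsilon> *\<^sub>R ?uh \<epsilon>) \<longlongrightarrow> 0) ?F"
    by (simp add: extrapolate_def algebra_simps)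
  have r: "((\<lambda>\<epsilon>. \<epsilon> *\<^sub>R U_perp D t (Z \<epsilon>) (u \<epsilon>) - b_at D (Z \<epsilon>) *\<^sub>R u1 \<epsilon>) \<longlongrightarrow> 0) ?F"
    using tendsto_diff[OF U0 tendsto_scaleR[OF b0 u1]] by simp
  show u': "(u' \<longlongrightarrow> 0) ?F"
  proof (rule tendsto_0_of_rotation_eq[OF _ tendsto_b_at[OF Zh zh] b_at_pos[OF sa zh]])
    show "((\<lambda>\<epsilon>. \<epsilon> *\<^sub>R U_perp D ?th (?Zh \<epsilon>) (?uh \<epsilon>) + (\<epsilon> / (h * gam)) *\<^sub>R J0 (u \<epsilon>)
        + ((1 - gam) / gam) *\<^sub>R (\<epsilon> *\<^sub>R U_perp D t (Z \<epsilon>) (u \<epsilon>) - b_at D (Z \<epsilon>) *\<^sub>R u1 \<epsilon>)) \<longlongrightarrow> 0) ?F"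
      using tendsto_add[OF tendsto_add[OF tendsto_scaled_U_perp[OF uh Zh zh] cu]
          tendsto_scaleR[OF tendsto_const r]] by simp
    show "\<forall>\<^sub>F \<epsilon> in ?F. b_at D (?Zh \<epsilon>) *\<^sub>R u' \<epsilon> + (\<epsilon> / (h * gam)) *\<^sub>R J0 (u' \<epsilon>) =
        \<epsilon> *\<^sub>R U_perp D ?th (?Zh \<epsilon>) (?uh \<epsilon>) + (\<epsilon> / (h * gam)) *\<^sub>R J0 (u \<epsilon>)
        + ((1 - gam) / gam) *\<^sub>R (\<epsilon> *\<^sub>R U_perp D t (Z \<epsilon>) (u \<epsilon>) - b_at D (Z \<epsilon>) *\<^sub>R u1 \<epsilon>)"
      using step pos by eventually_elim (rule imex_step_relax2[OF _ \<open>0 < h\<close>])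
  qed
  have "((\<lambda>\<epsilon>. Z \<epsilon> + h *\<^sub>R ((1 - gam) *\<^sub>R F D t (Z \<epsilon>) (u1 \<epsilon>) + gam *\<^sub>R F D ?th (?Zh \<epsilon>) (u' \<epsilon>))) \<longlongrightarrow>
      rk_step (gyro_field D) h t z) ?F"
    unfolding rk_step_def gyro_field_def
    by (intro tendsto_intros Z tendsto_F u1 u' zh[unfolded gyro_field_def]
        Zh[unfolded gyro_field_def] \<open>z \<in> state_space D\<close>)
  moreover have "\<forall>\<^sub>F \<epsilon> in ?F. Z \<epsilon> + h *\<^sub>R ((1 - gam) *\<^sub>R F D t (Z \<epsilon>) (u1 \<epsilon>)
      + gam *\<^sub>R F D ?th (?Zh \<epsilon>) (u' \<epsilon>)) = Z' \<epsilon>"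
    using step pos by eventually_elim (rule imex_step_result[OF _ \<open>0 < h\<close>, symmetric])
  ultimately show "(Z' \<longlongrightarrow> rk_step (gyro_field D) h t z) ?F"
    by (rule Lim_transform_eventually)
qed

lemma imex_run_tendsto:
  assumes "0 < h" "Z0 \<in> state_space D"
    and run: "\<forall>\<epsilon>\<in>{0<..1}. imex_run D \<epsilon> h N (Z \<epsilon>) (u \<epsilon>) (Z1 \<epsilon>) (u1 \<epsilon>)"
    and Z: "((\<lambda>\<epsilon>. Z \<epsilon> 0) \<longlongrightarrow> Z0) (at_right 0)" and u: "((\<lambda>\<epsilon>. sqrt \<epsilon> *\<^sub>R u \<epsilon> 0) \<longlongrightarrow> 0) (at_right 0)"
    and lim: "Zlim 0 = Z0" "rk_run (gyro_field D) h 0 N Zlim"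
    and n: "n \<in> {1..N}"
  shows "((\<lambda>\<epsilon>. Z \<epsilon> n) \<longlongrightarrow> Zlim n) (at_right 0) \<and> ((\<lambda>\<epsilon>. u \<epsilon> n) \<longlongrightarrow> 0) (at_right 0)"
proof -
  \<comment> \<open>At n = 0 only the scaled velocity converges, from n = 1 on the velocity itself.
    A step consumes the scaled statement, which is therefore carried for all n.\<close>
  have *: "((\<lambda>\<epsilon>. Z \<epsilon> n) \<longlongrightarrow> Zlim n) (at_right 0) \<and> ((\<lambda>\<epsilon>. sqrt \<epsilon> *\<^sub>R u \<epsilon> n) \<longlongrightarrow> 0) (at_right 0)
      \<and> Zlim n \<in> state_space D \<and> (1 \<le> n \<longrightarrow> ((\<lambda>\<epsilon>. u \<epsilon> n) \<longlongrightarrow> 0) (at_right 0))" if "n \<le> N" for n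
    using that
  proof (induction n)
    case 0 then show ?case using assms by simp
  next
    case (Suc n)
    then have IH: "((\<lambda>\<epsilon>. Z \<epsilon> n) \<longlongrightarrow> Zlim n) (at_right 0)"
      "((\<lambda>\<epsilon>. sqrt \<epsilon> *\<^sub>R u \<epsilon> n) \<longlongrightarrow> 0) (at_right 0)" "Zlim n \<in> state_space D" by auto
    have "\<forall>\<^sub>F \<epsilon> in at_right (0::real). \<epsilon> \<in> {0<..1}"
      using eventually_at_right_field[of _ "0::real"] zero_less_one by (auto intro!: exI[of _ 1])
    then have "\<forall>\<^sub>F \<epsilon> in at_right 0. imex_step D \<epsilon> h (real n * h) (Z \<epsilon> n) (u \<epsilon> n) (Z1 \<epsilon> n) (u1 \<epsilon> n)
        (Z \<epsilon> (Suc n)) (u \<epsilon> (Suc n))"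
      by eventually_elim (use run Suc.prems in \<open>auto simp: imex_run_def\<close>)
    note s = imex_step_tendsto[OF \<open>0 < h\<close> IH(3) this IH(1,2)]
    have "Zlim (Suc n) = rk_step (gyro_field D) h (real n * h) (Zlim n)"
      using lim(2) Suc.prems by (simp add: rk_run_def)
    moreover from this have "Zlim (Suc n) \<in> state_space D"
      using IH(3) by (simp add: state_space_def fst_rk_gyro)
    moreover have "((\<lambda>\<epsilon>. sqrt \<epsilon> *\<^sub>R u \<epsilon> (Suc n)) \<longlongrightarrow> 0) (at_right 0)"
    proof -
      have "((\<lambda>\<epsilon>. sqrt \<epsilon>) \<longlongrightarrow> 0) (at_right (0::real))"
        using tendsto_real_sqrt[OF tendsto_ident_at, of 0 "{0<..}"] by simp
      from tendsto_scaleR[OF this s(2)] show ?thesis by simp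
    qed
    ultimately show ?case using s by simp
  qed
  then show ?thesis using n by auto
qed

end

section \<open>Error estimates\<close>

text \<open>Landau's O for vector-valued families. The index type is arbitrary because an index will
  eventually be a whole run of the scheme, which makes C independent of the run.\<close>

definition dominated ::
  "'i filter \<Rightarrow> ('i \<Rightarrow> 'a::real_normed_vector) \<Rightarrow> ('i \<Rightarrow> real) \<Rightarrow> bool" where
  "dominated Fl f g \<longleftrightarrow> (\<exists>C. \<forall>\<^sub>F i in Fl. norm (f i) \<le> C * \<bar>g i\<bar>)"

lemma dominatedI: "\<forall>\<^sub>F i in Fl. norm (f i) \<le> C * \<bar>g i\<bar> \<Longrightarrow> dominated Fl f g"
  by (auto simp: dominated_def)

lemma dominatedE:
  assumes "dominated Fl f g"
  obtains C where "C \<ge> 0" "\<forall>\<^sub>F i in Fl. norm (f i) \<le> C * \<bar>g i\<bar>"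
proof -
  obtain C where C: "\<forall>\<^sub>F i in Fl. norm (f i) \<le> C * \<bar>g i\<bar>" using assms by (auto simp: dominated_def)
  have "\<forall>\<^sub>F i in Fl. norm (f i) \<le> \<bar>C\<bar> * \<bar>g i\<bar>"
    using C by eventually_elim (smt (verit) abs_ge_zero mult_right_mono)
  then show thesis using that[of "\<bar>C\<bar>"] by auto
qed

lemma dominated_lipschitz:
  assumes "\<forall>\<^sub>F i in Fl. norm (f i) \<le> L * (norm (x i) + norm (y i))" "0 \<le> L"
    and "dominated Fl x g" "dominated Fl y g"
  shows "dominated Fl f g"
proof -
  obtain A B where "\<forall>\<^sub>F i in Fl. norm (x i) \<le> A * \<bar>g i\<bar>" "\<forall>\<^sub>F i in Fl. norm (y i) \<le> B * \<bar>g i\<bar>"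
    using assms(3,4) by (auto simp: dominated_def)
  with assms(1) have "\<forall>\<^sub>F i in Fl. norm (f i) \<le> (L * (A + B)) * \<bar>g i\<bar>"
  proof eventually_elim
    case (elim i)
    have "L * (norm (x i) + norm (y i)) \<le> L * (A * \<bar>g i\<bar> + B * \<bar>g i\<bar>)"
      using elim assms(2) by (intro mult_left_mono) auto
    then show ?case using elim by (simp add: algebra_simps)
  qed
  then show ?thesis by (rule dominatedI)
qed

lemma dominated_add: "dominated Fl f g \<Longrightarrow> dominated Fl k g \<Longrightarrow> dominated Fl (\<lambda>i. f i + k i) g"
  by (rule dominated_lipschitz[where L = 1 and x = f and y = k])
     (auto intro!: always_eventually norm_triangle_ineq)

lemma dominated_diff: "dominated Fl f g \<Longrightarrow> dominated Fl k g \<Longrightarrow> dominated Fl (\<lambda>i. f i - k i) g"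
  by (rule dominated_lipschitz[where L = 1 and x = f and y = k])
     (auto intro!: always_eventually norm_triangle_ineq4)

lemma dominated_scaleR:
  assumes "dominated Fl a g" "dominated Fl f k"
  shows "dominated Fl (\<lambda>i. a i *\<^sub>R f i) (\<lambda>i. g i * k i)"
proof -
  obtain A where A: "\<forall>\<^sub>F i in Fl. norm (a i) \<le> A * \<bar>g i\<bar>" using assms(1) by (auto simp: dominated_def)
  obtain B where "\<forall>\<^sub>F i in Fl. norm (f i) \<le> B * \<bar>k i\<bar>" using assms(2) by (auto simp: dominated_def)
  with A have "\<forall>\<^sub>F i in Fl. norm (a i *\<^sub>R f i) \<le> (A * B) * \<bar>g i * k i\<bar>"
  proof eventually_elim
    case (elim i)
    then have "norm (a i) * norm (f i) \<le> (A * \<bar>g i\<bar>) * (B * \<bar>k i\<bar>)"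
      by (intro mult_mono order_trans[OF norm_ge_zero elim(1)]) auto
    then show ?case by (simp add: abs_mult algebra_simps)
  qed
  then show ?thesis by (rule dominatedI)
qed

lemma dominated_const: "dominated Fl (\<lambda>i. c) (\<lambda>i. 1)"
  by (rule dominatedI[where C = "norm c"]) simp

lemma dominated_diff_self: "dominated Fl (\<lambda>i. f i - f i) g"
  by (rule dominatedI[where C = 0]) simp

lemma dominated_refl: "dominated Fl g g"
  by (rule dominatedI[where C = 1]) simp

lemma dominated_cmult: "dominated Fl f g \<Longrightarrow> dominated Fl (\<lambda>i. c *\<^sub>R f i) g"
  using dominated_scaleR[OF dominated_const[where c = c]] by fastforce

lemma dominated_bscale: "dominated Fl a (\<lambda>i. 1) \<Longrightarrow> dominated Fl f g \<Longrightarrow> dominated Fl (\<lambda>i. a i *\<^sub>R f i) g"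
  using dominated_scaleR[of Fl a "\<lambda>i. 1" f g] by simp

lemma dominated_trans:
  assumes "dominated Fl f g" "dominated Fl g k"
  shows "dominated Fl f k"
proof -
  obtain A where A: "A \<ge> 0" "\<forall>\<^sub>F i in Fl. norm (f i) \<le> A * \<bar>g i\<bar>" using dominatedE[OF assms(1)] .
  show ?thesis
    by (rule dominated_lipschitz[where L = A and x = g and y = g])
       (use A assms in \<open>auto elim!: eventually_mono intro: order_trans mult_left_mono\<close>)
qed

lemma dominated_cong:
  "dominated Fl f g \<Longrightarrow> \<forall>\<^sub>F i in Fl. f i = k i \<Longrightarrow> dominated Fl k g"
  unfolding dominated_def by (elim exE, rule exI) (auto elim: eventually_elim2)

lemma dominated_norm_cong:
  "dominated Fl f g \<Longrightarrow> (\<And>i. norm (k i) = norm (f i)) \<Longrightarrow> dominated Fl k g"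
  by (simp add: dominated_def)

lemma dominated_minus_commute:
  "dominated Fl (\<lambda>i. f i - k i) g \<Longrightarrow> dominated Fl (\<lambda>i. k i - f i) g"
  by (erule dominated_norm_cong) (rule norm_minus_commute)

lemma dominated_extrapolate:
  "dominated Fl u g \<Longrightarrow> dominated Fl w g \<Longrightarrow> dominated Fl (\<lambda>i. extrapolate (u i) (w i)) g"
  unfolding extrapolate_def by (intro dominated_add dominated_cmult)

lemma dominated_norm: "dominated Fl f g \<Longrightarrow> dominated Fl (\<lambda>i. norm (f i)) g"
  by (rule dominated_norm_cong) auto

text \<open>Every step number has its own constant; a run has finitely many steps, so a maximum
  exists.\<close>

lemma dominated_uniform:
  assumes "finite I" "\<And>n. n \<in> I \<Longrightarrow> dominated Fl (\<lambda>i. f i n) g"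
  shows "\<exists>C. \<forall>\<^sub>F i in Fl. \<forall>n\<in>I. norm (f i n) \<le> C * \<bar>g i\<bar>"
  using assms
proof (induction I rule: finite_induct)
  case (insert m I)
  then obtain C where "\<forall>\<^sub>F i in Fl. \<forall>n\<in>I. norm (f i n) \<le> C * \<bar>g i\<bar>" by auto
  moreover obtain C' where "\<forall>\<^sub>F i in Fl. norm (f i m) \<le> C' * \<bar>g i\<bar>"
    using insert.prems[of m] by (auto simp: dominated_def)
  ultimately have "\<forall>\<^sub>F i in Fl. \<forall>n\<in>insert m I. norm (f i n) \<le> max C C' * \<bar>g i\<bar>"
  proof eventually_elim
    case (elim i)
    have "C * \<bar>g i\<bar> \<le> max C C' * \<bar>g i\<bar>" "C' * \<bar>g i\<bar> \<le> max C C' * \<bar>g i\<bar>"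
      by (intro mult_right_mono; simp)+
    then show ?case using elim by force
  qed
  then show ?case by blast
qed simp

lemma dominated_J0: "dominated Fl u g \<Longrightarrow> dominated Fl (\<lambda>i. J0 (u i)) g"
  by (rule dominated_norm_cong[OF _ norm_J0])

text \<open>
  Eventually with values in a fixed compact subset of \<open>state_space D\<close>.
\<close>

definition tame :: "torus_data \<Rightarrow> 'i filter \<Rightarrow> ('i \<Rightarrow> state) \<Rightarrow> bool" where
  "tame D Fl X \<longleftrightarrow> (\<exists>\<rho>>0. \<forall>\<^sub>F i in Fl. confined D \<rho> (X i)) \<and> dominated Fl X (\<lambda>i. 1)"

definition confined_ball :: "torus_data \<Rightarrow> real \<Rightarrow> real \<Rightarrow> state set" where
  "confined_ball D \<rho> B = {Z. confined D \<rho> Z} \<inter> cball 0 B"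

lemma compact_confined_ball: "compact (confined_ball D \<rho> B)"
proof -
  have "closed {Z :: state. \<rho> \<le> fst Z \<and> fst Z \<le> R0 D - \<rho>}"
    by (intro closed_Collect_conj closed_Collect_le continuous_intros)
  then show ?thesis
    unfolding confined_ball_def confined_def by (rule closed_Int_compact) (rule compact_cball)
qed

lemma confined_mono: "confined D \<rho> Z \<Longrightarrow> \<rho>' \<le> \<rho> \<Longrightarrow> confined D \<rho>' Z"
  by (simp add: confined_def)

lemma confined_imp_state_space: "confined D \<rho> Z \<Longrightarrow> 0 < \<rho> \<Longrightarrow> Z \<in> state_space D"
  by (simp add: confined_def state_space_def)

text \<open>Both families end up in the same compact set, where one Lipschitz constant controls
  differences of field values.\<close>

lemma tame_pairE:
  assumes "tame D Fl X" "tame D Fl Y"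
  obtains \<rho> B where "\<rho> > 0" "\<forall>\<^sub>F i in Fl. X i \<in> confined_ball D \<rho> B \<and> Y i \<in> confined_ball D \<rho> B"
proof -
  obtain \<rho> where \<rho>: "\<rho> > 0" "\<forall>\<^sub>F i in Fl. confined D \<rho> (X i)" using assms(1) by (auto simp: tame_def)
  obtain \<rho>' where \<rho>': "\<rho>' > 0" "\<forall>\<^sub>F i in Fl. confined D \<rho>' (Y i)" using assms(2) by (auto simp: tame_def)
  obtain B where B: "\<forall>\<^sub>F i in Fl. norm (X i) \<le> B * \<bar>1\<bar>" using assms(1) by (auto simp: tame_def dominated_def)
  obtain B' where B': "\<forall>\<^sub>F i in Fl. norm (Y i) \<le> B' * \<bar>1\<bar>" using assms(2) by (auto simp: tame_def dominated_def)
  have "\<forall>\<^sub>F i in Fl. X i \<in> confined_ball D (min \<rho> \<rho>') (max B B') \<and> Y i \<in> confined_ball D (min \<rho> \<rho>') (max B B')"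
    using \<rho>(2) \<rho>'(2) B B' by eventually_elim (auto simp: confined_ball_def elim: confined_mono)
  then show thesis using that[of "min \<rho> \<rho>'"] \<rho>(1) \<rho>'(1) by auto
qed

lemma tame_eventually_state_space: "tame D Fl X \<Longrightarrow> \<forall>\<^sub>F i in Fl. X i \<in> state_space D"
  unfolding tame_def by (auto elim: eventually_mono intro: confined_imp_state_space)

lemma tame_cong:
  assumes "tame D Fl X" and eq: "\<forall>\<^sub>F i in Fl. X i = Y i"
  shows "tame D Fl Y"
proof -
  obtain \<rho> where \<rho>: "\<rho> > 0" "\<forall>\<^sub>F i in Fl. confined D \<rho> (X i)"
    using assms(1) by (auto simp: tame_def)
  have "\<forall>\<^sub>F i in Fl. confined D \<rho> (Y i)" using \<rho>(2) eq by eventually_elim simp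
  moreover have "dominated Fl Y (\<lambda>i. 1)"
    using assms by (intro dominated_cong[OF _ eq]) (simp add: tame_def)
  ultimately show ?thesis using \<rho>(1) unfolding tame_def by blast
qed

text \<open>Where \<open>eps i\<close> is small, X lies within half the margin of Y; elsewhere
  \<open>alt\<close> supplies the margin \<rho>. Confinement passes in this way from the limit run
  to the scheme, and from the scheme to the corrected run.\<close>

lemma tame_close:
  assumes Y: "tame D Fl Y" and close: "dominated Fl (\<lambda>i. X i - Y i) eps"
    and eps: "\<forall>\<^sub>F i in Fl. 0 < eps i \<and> eps i \<le> 1"
    and "0 < \<rho>" and alt: "\<And>\<delta>. 0 < \<delta> \<Longrightarrow> \<forall>\<^sub>F i in Fl. eps i \<le> \<delta> \<or> confined D \<rho> (X i)"
  shows "tame D Fl X"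
  unfolding tame_def
proof
  obtain \<rho>' where \<rho>': "\<rho>' > 0" "\<forall>\<^sub>F i in Fl. confined D \<rho>' (Y i)" using Y by (auto simp: tame_def)
  obtain C where C: "C \<ge> 0" "\<forall>\<^sub>F i in Fl. norm (X i - Y i) \<le> C * \<bar>eps i\<bar>" using dominatedE[OF close] .
  \<comment> \<open>Below this threshold the distance of X from Y is at most half the margin; C + 1
    keeps the denominator positive when C = 0.\<close>
  have "0 < \<rho>' / (2 * (C + 1))" using \<rho>' C by simp
  from alt[OF this] \<rho>'(2) C(2) eps
  have "\<forall>\<^sub>F i in Fl. confined D (min \<rho> (\<rho>' / 2)) (X i)"
  proof eventually_elim
    case (elim i)
    from elim(1) show ?case
    proof
      assume "confined D \<rho> (X i)" then show ?thesis by (rule confined_mono) simp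
    next
      assume e: "eps i \<le> \<rho>' / (2 * (C + 1))"
      have "norm (fst (X i) - fst (Y i)) \<le> norm (X i - Y i)"
        using norm_fst_le[of "fst (X i - Y i)" "snd (X i - Y i)"]
        unfolding prod.collapse by simp
      also have "\<dots> \<le> (C + 1) * eps i" using elim by (simp add: algebra_simps)
      also have "\<dots> \<le> (C + 1) * (\<rho>' / (2 * (C + 1)))" using e C by (intro mult_left_mono) auto
      also have "\<dots> = \<rho>' / 2" using C(1) by (simp add: field_simps)
      finally have "fst (Y i) - \<rho>' / 2 \<le> fst (X i)" "fst (X i) \<le> fst (Y i) + \<rho>' / 2"
        unfolding real_norm_def by linarith+
      then show ?thesis using elim(2) by (auto simp: confined_def min_def)
    qed
  qed
  then show "\<exists>\<rho>>0. \<forall>\<^sub>F i in Fl. confined D \<rho> (X i)"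
    using \<open>0 < \<rho>\<close> \<rho>'(1) by (intro exI[of _ "min \<rho> (\<rho>' / 2)"]) auto
  have "dominated Fl eps (\<lambda>i. 1)"
    using eps by (intro dominatedI[where C = 1]) (auto elim: eventually_mono)
  then have "dominated Fl (\<lambda>i. (X i - Y i) + Y i) (\<lambda>i. 1)"
    using dominated_trans[OF close] Y by (intro dominated_add) (auto simp: tame_def)
  then show "dominated Fl X (\<lambda>i. 1)" by simp
qed

lemma dominated_rotation_eq:
  fixes w y :: "'i \<Rightarrow> perp"
  assumes "dominated Fl y g" "dominated Fl (\<lambda>i. 1 / a i) (\<lambda>i. 1)" "\<forall>\<^sub>F i in Fl. 0 < a i"
    and "\<forall>\<^sub>F i in Fl. a i *\<^sub>R w i + c i *\<^sub>R J0 (w i) = y i"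
  shows "dominated Fl w g"
proof -
  have "dominated Fl (\<lambda>i. (1 / a i) *\<^sub>R y i) g" by (rule dominated_bscale[OF assms(2,1)])
  then obtain C where "\<forall>\<^sub>F i in Fl. norm ((1 / a i) *\<^sub>R y i) \<le> C * \<bar>g i\<bar>" by (auto simp: dominated_def)
  with assms(3,4) have "\<forall>\<^sub>F i in Fl. norm (w i) \<le> C * \<bar>g i\<bar>"
  proof eventually_elim
    case (elim i)
    then show ?case using norm_le_of_rotation_eq[OF elim(2,1)] by simp
  qed
  then show ?thesis by (rule dominatedI)
qed

section \<open>Bounds for the fields on tame families\<close>

context
  fixes D :: torus_data
  assumes sa: "standing_assumptions D"
begin

text \<open>Time is frozen: a run meets only finitely many stage times, and each may have its own
  constant.\<close>

lemma smooth_field_bounds: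
  fixes f :: "real \<Rightarrow> state \<Rightarrow> perp \<Rightarrow> 'b::real_normed_vector"
  assumes f: "smooth_on (fields_domain D) (\<lambda>p. f (fst p) (fst (snd p)) (snd (snd p)))" and "0 < \<rho>"
  obtains L where "0 \<le> L"
    "\<And>Z Y u w. Z \<in> confined_ball D \<rho> B \<Longrightarrow> Y \<in> confined_ball D \<rho> B \<Longrightarrow> u \<in> cball 0 M \<Longrightarrow> w \<in> cball 0 M \<Longrightarrow>
      norm (f t Z u) \<le> L \<and> norm (f t Z u - f t Y w) \<le> L * (norm (Z - Y) + norm (u - w))"
proof -
  let ?K = "{t} \<times> confined_ball D \<rho> B \<times> cball (0::perp) M"
  have K: "compact ?K" by (intro compact_Times compact_confined_ball) auto
  have KS: "?K \<subseteq> fields_domain D"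
    using \<open>0 < \<rho>\<close> by (auto simp: fields_domain_def confined_ball_def intro: confined_imp_state_space)
  obtain L where L: "0 \<le> L" "\<And>p q. p \<in> ?K \<Longrightarrow> q \<in> ?K \<Longrightarrow>
      norm (f (fst p) (fst (snd p)) (snd (snd p)) - f (fst q) (fst (snd q)) (snd (snd q))) \<le> L * norm (p - q)"
    by (rule smooth_on_lipschitz_compact[OF f open_fields_domain K KS]) (rule that)
  obtain M' where M': "0 \<le> M'" "\<And>p. p \<in> ?K \<Longrightarrow> norm (f (fst p) (fst (snd p)) (snd (snd p))) \<le> M'"
    by (rule smooth_on_bounded_compact[OF f K KS]) (rule that)
  show thesis
  proof (rule that[of "max L M'"])
    fix Z Y u w
    assume a: "Z \<in> confined_ball D \<rho> B" "Y \<in> confined_ball D \<rho> B" "u \<in> cball (0::perp) M" "w \<in> cball (0::perp) M"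
    have "norm (f t Z u - f t Y w) \<le> L * norm (Z - Y, u - w)"
      using L(2)[of "(t, Z, u)" "(t, Y, w)"] a by (simp add: norm_Pair)
    also have "\<dots> \<le> max L M' * (norm (Z - Y) + norm (u - w))"
      using L(1) by (intro mult_mono norm_Pair_le) auto
    finally show "norm (f t Z u) \<le> max L M' \<and> norm (f t Z u - f t Y w) \<le> max L M' * (norm (Z - Y) + norm (u - w))"
      using M'(2)[of "(t, Z, u)"] a by auto
  qed (use L(1) in auto)
qed

lemma dominated_smooth_field:
  fixes f :: "real \<Rightarrow> state \<Rightarrow> perp \<Rightarrow> 'b::real_normed_vector"
  assumes f: "smooth_on (fields_domain D) (\<lambda>p. f (fst p) (fst (snd p)) (snd (snd p)))"
    and Z: "tame D Fl Z" and u: "dominated Fl u (\<lambda>i. 1)"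
  shows "dominated Fl (\<lambda>i. f t (Z i) (u i)) (\<lambda>i. 1)"
proof -
  obtain \<rho> B where \<rho>: "\<rho> > 0" "\<forall>\<^sub>F i in Fl. Z i \<in> confined_ball D \<rho> B \<and> Z i \<in> confined_ball D \<rho> B"
    using tame_pairE[OF Z Z] .
  obtain M where M: "\<forall>\<^sub>F i in Fl. norm (u i) \<le> M * \<bar>1\<bar>" using u by (auto simp: dominated_def)
  obtain L where L: "0 \<le> L" "\<And>Z Y u w. Z \<in> confined_ball D \<rho> B \<Longrightarrow> Y \<in> confined_ball D \<rho> B \<Longrightarrow> u \<in> cball 0 M \<Longrightarrow> w \<in> cball 0 M \<Longrightarrow>
      norm (f t Z u) \<le> L \<and> norm (f t Z u - f t Y w) \<le> L * (norm (Z - Y) + norm (u - w))"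
    by (rule smooth_field_bounds[OF f \<rho>(1)]) (rule that)
  from \<rho>(2) M have "\<forall>\<^sub>F i in Fl. norm (f t (Z i) (u i)) \<le> L * \<bar>1\<bar>"
    by eventually_elim (use L(2) in auto)
  then show ?thesis by (rule dominatedI)
qed

lemma dominated_smooth_field_diff:
  fixes f :: "real \<Rightarrow> state \<Rightarrow> perp \<Rightarrow> 'b::real_normed_vector"
  assumes f: "smooth_on (fields_domain D) (\<lambda>p. f (fst p) (fst (snd p)) (snd (snd p)))"
    and Z: "tame D Fl Z" and Y: "tame D Fl Y"
    and u: "dominated Fl u (\<lambda>i. 1)" and w: "dominated Fl w (\<lambda>i. 1)"
    and ZY: "dominated Fl (\<lambda>i. Z i - Y i) g" and uw: "dominated Fl (\<lambda>i. u i - w i) g"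
  shows "dominated Fl (\<lambda>i. f t (Z i) (u i) - f t (Y i) (w i)) g"
proof -
  obtain \<rho> B where \<rho>: "\<rho> > 0" "\<forall>\<^sub>F i in Fl. Z i \<in> confined_ball D \<rho> B \<and> Y i \<in> confined_ball D \<rho> B"
    using tame_pairE[OF Z Y] .
  obtain M where M: "\<forall>\<^sub>F i in Fl. norm (u i) \<le> M * \<bar>1\<bar>" using u by (auto simp: dominated_def)
  obtain M' where M': "\<forall>\<^sub>F i in Fl. norm (w i) \<le> M' * \<bar>1\<bar>" using w by (auto simp: dominated_def)
  obtain L where L: "0 \<le> L" "\<And>Z Y u w. Z \<in> confined_ball D \<rho> B \<Longrightarrow> Y \<in> confined_ball D \<rho> B \<Longrightarrow>
      u \<in> cball 0 (max M M') \<Longrightarrow> w \<in> cball 0 (max M M') \<Longrightarrow>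
      norm (f t Z u) \<le> L \<and> norm (f t Z u - f t Y w) \<le> L * (norm (Z - Y) + norm (u - w))"
    by (rule smooth_field_bounds[OF f \<rho>(1)]) (rule that)
  from \<rho>(2) M M' have "\<forall>\<^sub>F i in Fl. norm (f t (Z i) (u i) - f t (Y i) (w i)) \<le>
      L * (norm (Z i - Y i) + norm (u i - w i))"
    by eventually_elim (use L(2) in auto)
  then show ?thesis by (rule dominated_lipschitz[OF _ L(1) ZY uw])
qed

lemmas dominated_F = dominated_smooth_field[OF smooth_on_F[OF sa]]
lemmas dominated_F_diff = dominated_smooth_field_diff[OF smooth_on_F[OF sa]]
lemmas dominated_U_perp = dominated_smooth_field[OF smooth_on_U_perp[OF sa]]
lemmas dominated_U_perp_diff = dominated_smooth_field_diff[OF smooth_on_U_perp[OF sa]]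

lemma smooth_on_inverse_b:
  "smooth_on (fields_domain D) (\<lambda>p. 1 / b_at D (fst (snd p)))"
proof (intro smooth_on_divide smooth_on_const)
  show "smooth_on (fields_domain D) (\<lambda>p. b_at D (fst (snd p)))"
    by (rule smooth_on_compose[OF smooth_on_b_at[OF sa] smooth_on_fst[OF smooth_on_snd[OF smooth_on_id]]])
       (auto simp: fields_domain_def)
  show "b_at D (fst (snd p)) \<noteq> 0" if "p \<in> fields_domain D" for p
    using b_at_pos[OF sa, of "fst (snd p)"] that by (auto simp: fields_domain_def)
qed

lemma dominated_inverse_b: "tame D Fl Z \<Longrightarrow> dominated Fl (\<lambda>i. 1 / b_at D (Z i)) (\<lambda>i. 1)"
  by (rule dominated_smooth_field[where f = "\<lambda>t Z u. 1 / b_at D Z" and t = 0, OF smooth_on_inverse_b _ dominated_const])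

lemma smooth_on_drift_fields_domain: "smooth_on (fields_domain D)
    (\<lambda>p. (1 / b_at D (fst (snd p))) *\<^sub>R U_bar D (fst p) (fst (snd p)))"
proof -
  have "smooth_on (fields_domain D) (\<lambda>p. (fst p, fst (snd p)))" by (intro smooth_intros)
  moreover have "(\<lambda>p. (fst p, fst (snd p))) ` fields_domain D \<subseteq> UNIV \<times> state_space D"
    by (auto simp: fields_domain_def)
  ultimately show ?thesis using smooth_on_compose[OF smooth_on_drift[OF sa]] by fastforce
qed

lemma dominated_slaved: "tame D Fl Z \<Longrightarrow> dominated Fl (\<lambda>i. slaved D (eps i) t (Z i)) eps"
  unfolding slaved_eq
  using dominated_scaleR[OF dominated_refl[of Fl eps] dominated_smooth_field[OF smooth_on_drift_fields_domain _ dominated_const]]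
  by fastforce

lemma dominated_slaved_diff:
  assumes "tame D Fl Z" "tame D Fl Y" "dominated Fl (\<lambda>i. Z i - Y i) g" "dominated Fl eps (\<lambda>i. 1)"
  shows "dominated Fl (\<lambda>i. slaved D (eps i) t (Z i) - slaved D (eps i) t (Y i)) g"
proof -
  have "dominated Fl (\<lambda>i. (0::perp) - 0) g" by (rule dominatedI[where C = 0]) simp
  from dominated_smooth_field_diff[OF smooth_on_drift_fields_domain assms(1,2) dominated_const dominated_const assms(3) this]
  show ?thesis unfolding slaved_eq scaleR_diff_right[symmetric] by (rule dominated_bscale[OF assms(4)])
qed

text \<open>The margin is preserved exactly since the radius is invariant, and boundedness comes
  from that of \<open>F\<close> on tame families.\<close>

lemma tame_rk:
  assumes Z: "tame D Fl Z"
  shows "tame D Fl (\<lambda>i. rk_stage (gyro_field D) h t (Z i))" "tame D Fl (\<lambda>i. rk_step (gyro_field D) h t (Z i))"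
proof -
  have F: "dominated Fl (\<lambda>i. F D t (Z i) 0) (\<lambda>i. 1)" if "tame D Fl Z" for t Z
    by (rule dominated_F[OF that dominated_const])
  show 1: "tame D Fl (\<lambda>i. rk_stage (gyro_field D) h t (Z i))"
    unfolding tame_def
  proof
    show "\<exists>\<rho>>0. \<forall>\<^sub>F i in Fl. confined D \<rho> (rk_stage (gyro_field D) h t (Z i))"
      using Z by (simp add: tame_def confined_def fst_rk_gyro)
    show "dominated Fl (\<lambda>i. rk_stage (gyro_field D) h t (Z i)) (\<lambda>i. 1)"
      unfolding rk_stage_def gyro_field_def
      by (intro dominated_add dominated_cmult F Z) (use Z in \<open>simp add: tame_def\<close>)
  qed
  show "tame D Fl (\<lambda>i. rk_step (gyro_field D) h t (Z i))"
    unfolding tame_def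
  proof
    show "\<exists>\<rho>>0. \<forall>\<^sub>F i in Fl. confined D \<rho> (rk_step (gyro_field D) h t (Z i))"
      using Z by (simp add: tame_def confined_def fst_rk_gyro)
    show "dominated Fl (\<lambda>i. rk_step (gyro_field D) h t (Z i)) (\<lambda>i. 1)"
      unfolding rk_step_def gyro_field_def
      by (intro dominated_add dominated_cmult F Z 1[unfolded gyro_field_def])
         (use Z in \<open>simp add: tame_def\<close>)
  qed
qed

end

section \<open>Orders in \<epsilon> of a single step\<close>

context
  fixes D :: torus_data and Fl :: "'i filter" and eps :: "'i \<Rightarrow> real" and h :: real
  assumes sa: "standing_assumptions D" and h: "0 < h"
    and eps: "\<forall>\<^sub>F i in Fl. 0 < eps i \<and> eps i \<le> 1"
begin

lemma dominated_eps: "dominated Fl eps (\<lambda>i. 1)"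
  using eps by (intro dominatedI[where C = 1]) (auto elim: eventually_mono)

lemma dominated_eps_square: "dominated Fl f (\<lambda>i. (eps i)\<^sup>2) \<Longrightarrow> dominated Fl f eps"
proof (erule dominated_trans)
  show "dominated Fl (\<lambda>i. (eps i)\<^sup>2) eps"
    using dominated_bscale[OF dominated_eps dominated_refl[of Fl eps]] by (simp add: power2_eq_square)
qed

lemma dominated_eps_scale: "dominated Fl f (\<lambda>i. 1) \<Longrightarrow> dominated Fl (\<lambda>i. eps i *\<^sub>R f i) eps"
  using dominated_scaleR[OF dominated_refl[of Fl eps], of f "\<lambda>i. 1"] by simp

lemma dominated_eps_scale2: "dominated Fl f eps \<Longrightarrow> dominated Fl (\<lambda>i. eps i *\<^sub>R f i) (\<lambda>i. (eps i)\<^sup>2)"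
  using dominated_scaleR[OF dominated_refl[of Fl eps], of f eps] by (simp add: power2_eq_square)

lemma eventually_b_at_pos: "tame D Fl Z \<Longrightarrow> \<forall>\<^sub>F i in Fl. 0 < b_at D (Z i)"
  by (drule tame_eventually_state_space) (auto elim: eventually_mono intro: b_at_pos[OF sa])

context
  fixes t :: real and Z Z1 Z' :: "'i \<Rightarrow> state" and u u1 u' :: "'i \<Rightarrow> perp"
  assumes step: "\<forall>\<^sub>F i in Fl. imex_step D (eps i) h t (Z i) (u i) (Z1 i) (u1 i) (Z' i) (u' i)"
    and Z: "tame D Fl Z" and u: "dominated Fl u (\<lambda>i. 1)"
begin

abbreviation (input) "res i \<equiv> eps i *\<^sub>R U_perp D t (Z i) (u i) - b_at D (Z i) *\<^sub>R u1 i"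

lemma dominated_stage1: "dominated Fl u1 eps"
proof (rule dominated_rotation_eq[OF _ dominated_inverse_b[OF sa Z] eventually_b_at_pos[OF Z]])
  show "dominated Fl (\<lambda>i. eps i *\<^sub>R (U_perp D t (Z i) (u i) + (1 / (h * gam)) *\<^sub>R J0 (u i))) eps"
    by (intro dominated_eps_scale dominated_add dominated_cmult dominated_J0 dominated_U_perp[OF sa] Z u)
  show "\<forall>\<^sub>F i in Fl. b_at D (Z i) *\<^sub>R u1 i + (eps i / (h * gam)) *\<^sub>R J0 (u1 i) =
      eps i *\<^sub>R (U_perp D t (Z i) (u i) + (1 / (h * gam)) *\<^sub>R J0 (u i))"
    using step eps
  proof eventually_elim
    case (elim i)
    then show ?case using imex_step_relax1[OF elim(1) h] by (simp add: scaleR_add_right)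
  qed
qed

text \<open>By the first relaxation equation the residual is \<open>eps i / (h * gam)\<close> times
  \<open>J0 (u1 i) - J0 (u i)\<close>, so it gains one order over the velocities. Bounding its two
  terms separately would miss the second claim.\<close>

lemma dominated_residual:
  shows "dominated Fl (\<lambda>i. res i) eps"
    and "dominated Fl u eps \<Longrightarrow> dominated Fl (\<lambda>i. res i) (\<lambda>i. (eps i)\<^sup>2)"
proof -
  have *: "\<forall>\<^sub>F i in Fl. eps i *\<^sub>R ((1 / (h * gam)) *\<^sub>R (J0 (u1 i) - J0 (u i))) = res i"
    using step eps
  proof eventually_elim
    case (elim i)
    then show ?case using imex_step_relax1[OF elim(1) h] by (simp add: algebra_simps)
  qed
  have "dominated Fl (\<lambda>i. eps i *\<^sub>R ((1 / (h * gam)) *\<^sub>R (J0 (u1 i) - J0 (u i)))) eps"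
    by (intro dominated_eps_scale dominated_cmult dominated_diff dominated_J0 u
        dominated_trans[OF dominated_stage1 dominated_eps])
  then show "dominated Fl (\<lambda>i. res i) eps" using * by (rule dominated_cong)
  assume "dominated Fl u eps"
  then have "dominated Fl (\<lambda>i. eps i *\<^sub>R ((1 / (h * gam)) *\<^sub>R (J0 (u1 i) - J0 (u i)))) (\<lambda>i. (eps i)\<^sup>2)"
    by (intro dominated_eps_scale2 dominated_cmult dominated_diff dominated_J0 dominated_stage1)
  then show "dominated Fl (\<lambda>i. res i) (\<lambda>i. (eps i)\<^sup>2)" using * by (rule dominated_cong)
qed

text \<open>Here b times u1 is \<epsilon> \<open>U_perp\<close> minus the residual, and replacing u
  by 0 inside \<open>U_perp\<close> costs \<epsilon> times O(\<epsilon>). The first stage is slaved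
  at the starting point of the step, in contrast to the final velocity.\<close>

lemma dominated_stage1_slaved:
  assumes ue: "dominated Fl u eps"
  shows "dominated Fl (\<lambda>i. u1 i - slaved D (eps i) t (Z i)) (\<lambda>i. (eps i)\<^sup>2)"
proof -
  have "dominated Fl (\<lambda>i. U_perp D t (Z i) (u i) - U_perp D t (Z i) 0) eps"
    using ue by (intro dominated_U_perp_diff[OF sa] Z u dominated_const dominated_diff_self) simp
  then have "dominated Fl (\<lambda>i. eps i *\<^sub>R (U_perp D t (Z i) (u i) - U_perp D t (Z i) 0) - res i) (\<lambda>i. (eps i)\<^sup>2)"
    by (rule dominated_diff[OF dominated_eps_scale2 dominated_residual(2)[OF ue]])
  from dominated_bscale[OF dominated_inverse_b[OF sa Z] this] show ?thesis
    by (rule dominated_cong) (use eventually_b_at_pos[OF Z] in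
      \<open>auto elim!: eventually_mono simp: slaved_eq U_bar_def algebra_simps\<close>)
qed

context
  assumes Zh: "tame D Fl (\<lambda>i. extrapolate (Z i) (Z1 i))"
begin

abbreviation (input) "Zh i \<equiv> extrapolate (Z i) (Z1 i)"
abbreviation (input) "uh i \<equiv> extrapolate (u i) (u1 i)"

lemma dominated_uh: "dominated Fl (\<lambda>i. uh i) (\<lambda>i. 1)"
  by (intro dominated_extrapolate u dominated_trans[OF dominated_stage1 dominated_eps])

lemma dominated_result: "dominated Fl u' eps"
proof (rule dominated_rotation_eq[OF _ dominated_inverse_b[OF sa Zh] eventually_b_at_pos[OF Zh]])
  show "dominated Fl (\<lambda>i. eps i *\<^sub>R (U_perp D (stage_time h t) (Zh i) (uh i) + (1 / (h * gam)) *\<^sub>R J0 (u i))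
      + ((1 - gam) / gam) *\<^sub>R res i) eps"
    by (intro dominated_eps_scale dominated_add dominated_cmult dominated_J0 dominated_U_perp[OF sa]
        Zh u dominated_uh dominated_residual)
  show "\<forall>\<^sub>F i in Fl. b_at D (Zh i) *\<^sub>R u' i + (eps i / (h * gam)) *\<^sub>R J0 (u' i) =
      eps i *\<^sub>R (U_perp D (stage_time h t) (Zh i) (uh i) + (1 / (h * gam)) *\<^sub>R J0 (u i))
      + ((1 - gam) / gam) *\<^sub>R res i"
    using step eps
  proof eventually_elim
    case (elim i)
    then show ?case using imex_step_relax2[OF elim(1) h] by (simp add: scaleR_add_right)
  qed
qed

text \<open>A bootstrap: \<open>dominated_result\<close> already gives O(\<epsilon>) for u', so the
  rotation term of u' can be moved to the right-hand side, where it is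
  O(\<open>\<epsilon>\<^sup>2\<close>) like the rotation of u and the residual.\<close>

lemma dominated_result_slaved:
  assumes ue: "dominated Fl u eps"
  shows "dominated Fl (\<lambda>i. u' i - slaved D (eps i) (stage_time h t) (Zh i)) (\<lambda>i. (eps i)\<^sup>2)"
proof -
  have "dominated Fl (\<lambda>i. uh i - 0) eps"
    using dominated_extrapolate[OF ue dominated_stage1] by simp
  then have "dominated Fl (\<lambda>i. U_perp D (stage_time h t) (Zh i) (uh i) - U_perp D (stage_time h t) (Zh i) 0) eps"
    by (intro dominated_U_perp_diff[OF sa] Zh dominated_uh dominated_const dominated_diff_self)
  then have "dominated Fl (\<lambda>i. eps i *\<^sub>R ((U_perp D (stage_time h t) (Zh i) (uh i)
      - U_perp D (stage_time h t) (Zh i) 0) + (1 / (h * gam)) *\<^sub>R (J0 (u i) - J0 (u' i)))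
      + ((1 - gam) / gam) *\<^sub>R res i) (\<lambda>i. (eps i)\<^sup>2)"
    by (intro dominated_add[OF dominated_eps_scale2[OF dominated_add] dominated_cmult]
        dominated_residual(2) dominated_cmult dominated_diff[OF dominated_J0 dominated_J0]
        ue dominated_result)
  from dominated_bscale[OF dominated_inverse_b[OF sa Zh] this] show ?thesis
  proof (rule dominated_cong)
    show "\<forall>\<^sub>F i in Fl. (1 / b_at D (Zh i)) *\<^sub>R (eps i *\<^sub>R ((U_perp D (stage_time h t) (Zh i) (uh i)
        - U_perp D (stage_time h t) (Zh i) 0) + (1 / (h * gam)) *\<^sub>R (J0 (u i) - J0 (u' i)))
        + ((1 - gam) / gam) *\<^sub>R res i) = u' i - slaved D (eps i) (stage_time h t) (Zh i)"
      using step eps eventually_b_at_pos[OF Zh]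
    proof eventually_elim
      case (elim i)
      have "eps i *\<^sub>R ((U_perp D (stage_time h t) (Zh i) (uh i)
        - U_perp D (stage_time h t) (Zh i) 0) + (1 / (h * gam)) *\<^sub>R (J0 (u i) - J0 (u' i)))
        + ((1 - gam) / gam) *\<^sub>R res i
        = b_at D (Zh i) *\<^sub>R u' i - eps i *\<^sub>R U_perp D (stage_time h t) (Zh i) 0"
      proof -
        have "b_at D (Zh i) *\<^sub>R u' i = eps i *\<^sub>R U_perp D (stage_time h t) (Zh i) (uh i)
          + (eps i / (h * gam)) *\<^sub>R J0 (u i) + ((1 - gam) / gam) *\<^sub>R res i - (eps i / (h * gam)) *\<^sub>R J0 (u' i)"
          using imex_step_relax2[OF elim(1) h conjunct1[OF elim(2)]] by (simp only: eq_diff_eq)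
        then show ?thesis by (simp only:) (simp add: scaleR_add_right scaleR_diff_right)
      qed
      then show ?case using elim(3) by (simp only:) (simp add: slaved_eq U_bar_def scaleR_diff_right)
    qed
  qed
qed

end

text \<open>The velocity w and the order g are left free for two uses: w = 0 with first order
  compares with the limit scheme, the slaved w with second order compares with the corrected
  scheme.\<close>

lemma dominated_extrapolate_diff:
  assumes Y: "tame D Fl Y" and w: "dominated Fl w (\<lambda>i. 1)"
    and "dominated Fl (\<lambda>i. Z i - Y i) g" "dominated Fl (\<lambda>i. u1 i - w i) g"
  shows "dominated Fl (\<lambda>i. extrapolate (Z i) (Z1 i) - (Y i + (h * (1 / (2 * gam))) *\<^sub>R F D t (Y i) (w i))) g"
proof -
  have "dominated Fl (\<lambda>i. (Z i - Y i) + (h * (1 / (2 * gam))) *\<^sub>R (F D t (Z i) (u1 i) - F D t (Y i) (w i))) g"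
    by (intro dominated_add dominated_cmult dominated_F_diff[OF sa] assms Z
        dominated_trans[OF dominated_stage1 dominated_eps])
  moreover have "\<forall>\<^sub>F i in Fl. (Z i - Y i) + (h * (1 / (2 * gam))) *\<^sub>R (F D t (Z i) (u1 i) - F D t (Y i) (w i))
      = extrapolate (Z i) (Z1 i) - (Y i + (h * (1 / (2 * gam))) *\<^sub>R F D t (Y i) (w i))"
    using step eps
  proof eventually_elim
    case (elim i)
    then show ?case using imex_step_extrapolate[OF elim(1) h] by (simp add: scaleR_diff_right)
  qed
  ultimately show ?thesis by (rule dominated_cong)
qed

lemma dominated_result_diff:
  assumes Zh: "tame D Fl (\<lambda>i. extrapolate (Z i) (Z1 i))"
    and Y: "tame D Fl Y" "tame D Fl Yh" and w: "dominated Fl w (\<lambda>i. 1)" "dominated Fl wh (\<lambda>i. 1)"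
    and "dominated Fl (\<lambda>i. Z i - Y i) g" "dominated Fl (\<lambda>i. u1 i - w i) g"
    and "dominated Fl (\<lambda>i. extrapolate (Z i) (Z1 i) - Yh i) g" "dominated Fl (\<lambda>i. u' i - wh i) g"
  shows "dominated Fl (\<lambda>i. Z' i - (Y i + h *\<^sub>R ((1 - gam) *\<^sub>R F D t (Y i) (w i)
      + gam *\<^sub>R F D (stage_time h t) (Yh i) (wh i)))) g"
proof -
  have "dominated Fl (\<lambda>i. (Z i - Y i) + h *\<^sub>R ((1 - gam) *\<^sub>R (F D t (Z i) (u1 i) - F D t (Y i) (w i))
      + gam *\<^sub>R (F D (stage_time h t) (extrapolate (Z i) (Z1 i)) (u' i) - F D (stage_time h t) (Yh i) (wh i)))) g"
    by (intro dominated_add dominated_cmult dominated_F_diff[OF sa] assms Z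
        dominated_trans[OF dominated_stage1 dominated_eps] dominated_trans[OF dominated_result[OF Zh] dominated_eps])
  moreover have "\<forall>\<^sub>F i in Fl. (Z i - Y i) + h *\<^sub>R ((1 - gam) *\<^sub>R (F D t (Z i) (u1 i) - F D t (Y i) (w i))
      + gam *\<^sub>R (F D (stage_time h t) (extrapolate (Z i) (Z1 i)) (u' i) - F D (stage_time h t) (Yh i) (wh i)))
      = Z' i - (Y i + h *\<^sub>R ((1 - gam) *\<^sub>R F D t (Y i) (w i) + gam *\<^sub>R F D (stage_time h t) (Yh i) (wh i)))"
    using step eps
  proof eventually_elim
    case (elim i)
    then show ?case
      using imex_step_result[OF elim(1) h] by (simp add: scaleR_diff_right scaleR_add_right)
  qed
  ultimately show ?thesis by (rule dominated_cong)
qed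

end

lemma tame_of_compact:
  assumes "compact K" "K \<subseteq> state_space D" "\<forall>\<^sub>F i in Fl. X i \<in> K"
  shows "tame D Fl X"
proof -
  obtain \<rho> where "0 < \<rho>" "\<forall>Z\<in>K. confined D \<rho> Z"
  proof (cases "K = {}")
    case False
    \<comment> \<open>The margin is the least distance of r from 0 and R0 over K; it is attained,
      hence positive.\<close>
    have c: "continuous_on K (\<lambda>Z. min (fst Z) (R0 D - fst Z))" by (intro continuous_intros)
    obtain Z where Z: "Z \<in> K" "\<And>Y. Y \<in> K \<Longrightarrow> min (fst Z) (R0 D - fst Z) \<le> min (fst Y) (R0 D - fst Y)"
      using continuous_attains_inf[OF assms(1) False c] by blast
    have "0 < min (fst Z) (R0 D - fst Z)" using assms(2) Z(1) by (auto simp: state_space_def)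
    moreover have "confined D (min (fst Z) (R0 D - fst Z)) Y" if "Y \<in> K" for Y
      using Z(2)[OF that] by (auto simp: confined_def)
    ultimately show ?thesis using that by blast
  qed (auto intro: that[of 1])
  moreover have "\<forall>\<^sub>F i in Fl. confined D \<rho> (X i)" if "\<forall>Z\<in>K. confined D \<rho> Z"
    using assms(3) by eventually_elim (use that in blast)
  moreover obtain B where "\<forall>Z\<in>K. norm Z \<le> B"
    using compact_imp_bounded[OF assms(1)] by (auto simp: bounded_iff)
  then have "\<forall>\<^sub>F i in Fl. norm (X i) \<le> B * \<bar>1\<bar>" using assms(3) by (auto elim: eventually_mono)
  then have "dominated Fl X (\<lambda>i. 1)" by (rule dominatedI)
  ultimately show ?thesis unfolding tame_def by blast
qed

section \<open>Induction over the steps\<close>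

context
  fixes N :: nat and \<rho> :: real and K :: "state set" and Z Z1 Zlim :: "'i \<Rightarrow> nat \<Rightarrow> state" and u u1 :: "'i \<Rightarrow> nat \<Rightarrow> perp"
  assumes K: "compact K" "K \<subseteq> state_space D" and \<rho>: "0 < \<rho>"
    and run: "\<forall>\<^sub>F i in Fl. imex_run D (eps i) h N (Z i) (u i) (Z1 i) (u1 i)"
    and Z_init: "dominated Fl (\<lambda>i. Z i 0 - Zlim i 0) eps" and u_init: "dominated Fl (\<lambda>i. u i 0) (\<lambda>i. 1)"
    and Zlim_init: "\<forall>\<^sub>F i in Fl. Zlim i 0 \<in> K"
    and Zlim_run: "\<forall>\<^sub>F i in Fl. rk_run (gyro_field D) h 0 N (Zlim i)"
    and conf: "\<And>\<delta>. 0 < \<delta> \<Longrightarrow> \<forall>\<^sub>F i in Fl. eps i \<le> \<delta> \<or> imex_confined D \<rho> N (Z i) (Z1 i)"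
begin

lemma run_step:
  assumes "n < N"
  shows "\<forall>\<^sub>F i in Fl. imex_step D (eps i) h (real n * h) (Z i n) (u i n) (Z1 i n) (u1 i n) (Z i (Suc n)) (u i (Suc n))"
  using run by eventually_elim (use assms in \<open>simp add: imex_run_def\<close>)

lemma conf_step:
  assumes "n < N" "0 < \<delta>"
  shows "\<forall>\<^sub>F i in Fl. eps i \<le> \<delta> \<or> confined D \<rho> (Z i n)"
    and "\<forall>\<^sub>F i in Fl. eps i \<le> \<delta> \<or> confined D \<rho> (extrapolate (Z i n) (Z1 i n))"
  using conf[OF assms(2)] by (auto elim!: eventually_mono simp: imex_confined_def assms(1))

text \<open>Tameness of Z is claimed only before N: confinement is assumed where the fields are
  evaluated, and the final state is not such a point. The velocity is O(1) initially and
  O(\<epsilon>) after one step.\<close>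

lemma first_order_induct:
  assumes "n \<le> N"
  shows "tame D Fl (\<lambda>i. Zlim i n) \<and> dominated Fl (\<lambda>i. Z i n - Zlim i n) eps \<and>
    dominated Fl (\<lambda>i. u i n) (\<lambda>i. 1) \<and> (1 \<le> n \<longrightarrow> dominated Fl (\<lambda>i. u i n) eps) \<and>
    (n < N \<longrightarrow> tame D Fl (\<lambda>i. Z i n) \<and> tame D Fl (\<lambda>i. extrapolate (Z i n) (Z1 i n)))"
proof -
  \<comment> \<open>The order matters: closeness to the limit run makes Z tame, hence the
    first-stage velocity O(\<epsilon>), hence the internal stage close to that of the limit scheme,
    and so tame in turn.\<close>
  have stages: "tame D Fl (\<lambda>i. Z i n) \<and> tame D Fl (\<lambda>i. extrapolate (Z i n) (Z1 i n)) \<and>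
      dominated Fl (\<lambda>i. extrapolate (Z i n) (Z1 i n) - rk_stage (gyro_field D) h (real n * h) (Zlim i n)) eps"
    if n: "n < N" and lim: "tame D Fl (\<lambda>i. Zlim i n)" and d: "dominated Fl (\<lambda>i. Z i n - Zlim i n) eps"
      and u: "dominated Fl (\<lambda>i. u i n) (\<lambda>i. 1)" for n
  proof -
    have Z: "tame D Fl (\<lambda>i. Z i n)" by (rule tame_close[OF lim d eps \<rho> conf_step(1)[OF n]])
    note u1 = dominated_stage1[OF run_step[OF n] Z u]
    have "dominated Fl (\<lambda>i. u1 i n - 0) eps" using u1 by simp
    from dominated_extrapolate_diff[OF run_step[OF n] Z u lim dominated_const d this]
    have Zh: "dominated Fl (\<lambda>i. extrapolate (Z i n) (Z1 i n) - rk_stage (gyro_field D) h (real n * h) (Zlim i n)) eps"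
      by (simp add: rk_stage_def gyro_field_def)
    have "tame D Fl (\<lambda>i. extrapolate (Z i n) (Z1 i n))"
      by (rule tame_close[OF tame_rk(1)[OF sa lim] Zh eps \<rho> conf_step(2)[OF n]])
    with Z Zh show ?thesis by blast
  qed
  have "tame D Fl (\<lambda>i. Zlim i n) \<and> dominated Fl (\<lambda>i. Z i n - Zlim i n) eps \<and>
    dominated Fl (\<lambda>i. u i n) (\<lambda>i. 1) \<and> (1 \<le> n \<longrightarrow> dominated Fl (\<lambda>i. u i n) eps)"
    using assms
  proof (induction n)
    case 0
    show ?case using tame_of_compact[OF K Zlim_init] Z_init u_init by simp
  next
    case (Suc n)
    then have n: "n < N" and lim: "tame D Fl (\<lambda>i. Zlim i n)" and d: "dominated Fl (\<lambda>i. Z i n - Zlim i n) eps"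
      and u: "dominated Fl (\<lambda>i. u i n) (\<lambda>i. 1)" by auto
    from stages[OF n lim d u] have Z: "tame D Fl (\<lambda>i. Z i n)"
      and Zh: "tame D Fl (\<lambda>i. extrapolate (Z i n) (Z1 i n))"
      and Zhd: "dominated Fl (\<lambda>i. extrapolate (Z i n) (Z1 i n) - rk_stage (gyro_field D) h (real n * h) (Zlim i n)) eps"
      by auto
    note s = run_step[OF n] Z u
    have u1: "dominated Fl (\<lambda>i. u1 i n - 0) eps" using dominated_stage1[OF s] by simp
    have u': "dominated Fl (\<lambda>i. u i (Suc n) - 0) eps" using dominated_result[OF s Zh] by simp
    have step: "\<forall>\<^sub>F i in Fl. rk_step (gyro_field D) h (real n * h) (Zlim i n) = Zlim i (Suc n)"
      using Zlim_run by eventually_elim (use n in \<open>simp add: rk_run_def\<close>)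
    have "tame D Fl (\<lambda>i. Zlim i (Suc n))" by (rule tame_cong[OF tame_rk(2)[OF sa lim] step])
    moreover from dominated_result_diff[OF s Zh lim tame_rk(1)[OF sa lim] dominated_const dominated_const d u1 Zhd u']
    have "dominated Fl (\<lambda>i. Z i (Suc n) - rk_step (gyro_field D) h (real n * h) (Zlim i n)) eps"
      by (simp add: rk_step_def gyro_field_def)
    then have "dominated Fl (\<lambda>i. Z i (Suc n) - Zlim i (Suc n)) eps"
      by (rule dominated_cong) (use step in \<open>auto elim: eventually_mono\<close>)
    ultimately show ?case using u' dominated_trans[OF _ dominated_eps] by auto
  qed
  then show ?thesis using stages by blast
qed

lemma first_order_estimate:
  "\<exists>C. \<forall>\<^sub>F i in Fl. \<forall>n\<in>{1..N}. norm (Z i n - Zlim i n) + norm (u i n) \<le> C * eps i"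
proof -
  have "dominated Fl (\<lambda>i. norm (Z i n - Zlim i n) + norm (u i n)) eps" if "n \<in> {1..N}" for n
    using first_order_induct[of n] that by (intro dominated_add dominated_norm) auto
  then have "\<exists>C. \<forall>\<^sub>F i in Fl. \<forall>n\<in>{1..N}. norm (norm (Z i n - Zlim i n) + norm (u i n)) \<le> C * \<bar>eps i\<bar>"
    by (intro dominated_uniform finite_atLeastAtMost)
  then obtain C where
    "\<forall>\<^sub>F i in Fl. \<forall>n\<in>{1..N}. norm (norm (Z i n - Zlim i n) + norm (u i n)) \<le> C * \<bar>eps i\<bar>" ..
  with eps have "\<forall>\<^sub>F i in Fl. \<forall>n\<in>{1..N}. norm (Z i n - Zlim i n) + norm (u i n) \<le> C * eps i"
    by eventually_elim simp
  then show ?thesis by blast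
qed

context
  fixes Y :: "'i \<Rightarrow> nat \<Rightarrow> state"
  assumes Y_init: "\<forall>\<^sub>F i in Fl. Y i 1 = Z i 1"
    and Y_run: "\<forall>\<^sub>F i in Fl. rk_run (corrected_field D (eps i)) h 1 N (Y i)"
    and Y_conf: "\<And>\<delta>. 0 < \<delta> \<Longrightarrow> \<forall>\<^sub>F i in Fl. eps i \<le> \<delta> \<or> rk_confined D \<rho> (corrected_field D (eps i)) h 1 N (Y i)"
begin

lemma Y_conf_step:
  assumes "n < N" "1 \<le> n" "0 < \<delta>"
  shows "\<forall>\<^sub>F i in Fl. eps i \<le> \<delta> \<or> confined D \<rho> (Y i n)"
    and "\<forall>\<^sub>F i in Fl. eps i \<le> \<delta> \<or> confined D \<rho> (rk_stage (corrected_field D (eps i)) h (real n * h) (Y i n))"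
  using Y_conf[OF assms(3)] assms(1,2) unfolding rk_confined_def
  by (auto elim!: eventually_mono simp: Suc_le_eq)

text \<open>The corrected field may change the radius, so tameness of Y cannot come from an
  invariant. It is deduced from closeness to Z, and again in the same way at the internal
  stage.\<close>

lemma second_order_step:
  assumes n: "n < N" "1 \<le> n" and d: "dominated Fl (\<lambda>i. Z i n - Y i n) (\<lambda>i. (eps i)\<^sup>2)"
  shows "dominated Fl (\<lambda>i. Z i (Suc n) - Y i (Suc n)) (\<lambda>i. (eps i)\<^sup>2) \<and>
    dominated Fl (\<lambda>i. u i (Suc n) - slaved D (eps i) (stage_time h (real n * h))
      (rk_stage (corrected_field D (eps i)) h (real n * h) (Y i n))) (\<lambda>i. (eps i)\<^sup>2)"
proof -
  let ?t = "real n * h"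
  let ?Zh = "\<lambda>i. extrapolate (Z i n) (Z1 i n)" and ?Yh = "\<lambda>i. rk_stage (corrected_field D (eps i)) h ?t (Y i n)"
  let ?w = "\<lambda>i. slaved D (eps i) ?t (Y i n)" and ?wh = "\<lambda>i. slaved D (eps i) (stage_time h ?t) (?Yh i)"
  from first_order_induct[of n] n have Z: "tame D Fl (\<lambda>i. Z i n)" and Zh: "tame D Fl ?Zh"
    and u: "dominated Fl (\<lambda>i. u i n) (\<lambda>i. 1)" and ue: "dominated Fl (\<lambda>i. u i n) eps" by auto
  note s = run_step[OF n(1)] Z u
  have Y: "tame D Fl (\<lambda>i. Y i n)"
    by (rule tame_close[OF Z dominated_eps_square[OF dominated_minus_commute[OF d]] eps \<rho> Y_conf_step(1)[OF n]])
  note w = dominated_trans[OF dominated_slaved[OF sa Y] dominated_eps]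
  \<comment> \<open>The first stage is slaved at Z; moving the slaved velocity from Z to Y costs no
    more than their distance, which is O(\<open>\<epsilon>\<^sup>2\<close>) by d.\<close>
  have "dominated Fl (\<lambda>i. (u1 i n - slaved D (eps i) ?t (Z i n)) + (slaved D (eps i) ?t (Z i n) - ?w i)) (\<lambda>i. (eps i)\<^sup>2)"
    by (intro dominated_add dominated_stage1_slaved[OF s ue] dominated_slaved_diff[OF sa Z Y d dominated_eps])
  then have u1: "dominated Fl (\<lambda>i. u1 i n - ?w i) (\<lambda>i. (eps i)\<^sup>2)" by simp
  have Zhd: "dominated Fl (\<lambda>i. ?Zh i - ?Yh i) (\<lambda>i. (eps i)\<^sup>2)"
    using dominated_extrapolate_diff[OF s Y w d u1] by (simp add: rk_stage_def corrected_field_def)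
  have Yh: "tame D Fl ?Yh"
    by (rule tame_close[OF Zh dominated_eps_square[OF dominated_minus_commute[OF Zhd]] eps \<rho> Y_conf_step(2)[OF n]])
  note wh = dominated_trans[OF dominated_slaved[OF sa Yh] dominated_eps]
  have "dominated Fl (\<lambda>i. (u i (Suc n) - slaved D (eps i) (stage_time h ?t) (?Zh i))
      + (slaved D (eps i) (stage_time h ?t) (?Zh i) - ?wh i)) (\<lambda>i. (eps i)\<^sup>2)"
    by (intro dominated_add dominated_result_slaved[OF s Zh ue] dominated_slaved_diff[OF sa Zh Yh Zhd dominated_eps])
  then have u': "dominated Fl (\<lambda>i. u i (Suc n) - ?wh i) (\<lambda>i. (eps i)\<^sup>2)" by simp
  have step: "\<forall>\<^sub>F i in Fl. rk_step (corrected_field D (eps i)) h ?t (Y i n) = Y i (Suc n)"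
    using Y_run by eventually_elim (use n in \<open>simp add: rk_run_def\<close>)
  from dominated_result_diff[OF s Zh Y Yh w wh d u1 Zhd u']
  have "dominated Fl (\<lambda>i. Z i (Suc n) - rk_step (corrected_field D (eps i)) h ?t (Y i n)) (\<lambda>i. (eps i)\<^sup>2)"
    by (simp add: rk_step_def corrected_field_def)
  then have "dominated Fl (\<lambda>i. Z i (Suc n) - Y i (Suc n)) (\<lambda>i. (eps i)\<^sup>2)"
    by (rule dominated_cong) (use step in \<open>auto elim: eventually_mono\<close>)
  with u' show ?thesis by blast
qed

text \<open>The start is at 1, where Y and Z coincide and the velocity is already O(\<epsilon>). At
  0 it is only O(1), too large for the slaved estimates.\<close>

lemma second_order_induct:
  "1 \<le> n \<Longrightarrow> n \<le> N \<Longrightarrow> dominated Fl (\<lambda>i. Z i n - Y i n) (\<lambda>i. (eps i)\<^sup>2)"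
proof (induction n rule: dec_induct)
  case base
  have "dominated Fl (\<lambda>i. 0 :: state) (\<lambda>i. (eps i)\<^sup>2)" by (rule dominatedI[where C = 0]) simp
  then show ?case by (rule dominated_cong) (use Y_init in \<open>auto elim: eventually_mono\<close>)
next
  case (step n)
  then show ?case using second_order_step by auto
qed

lemma second_order_estimate:
  "\<exists>C. \<forall>\<^sub>F i in Fl. \<forall>n\<in>{2..N}. norm (Z i n - Y i n) + norm (u i n
     - slaved D (eps i) (stage_time h (real (n - 1) * h))
         (rk_stage (corrected_field D (eps i)) h (real (n - 1) * h) (Y i (n - 1)))) \<le> C * (eps i)\<^sup>2"
    (is "\<exists>C. \<forall>\<^sub>F i in Fl. \<forall>n\<in>{2..N}. ?err i n \<le> C * (eps i)\<^sup>2")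
proof -
  have "dominated Fl (\<lambda>i. ?err i n) (\<lambda>i. (eps i)\<^sup>2)" if "n \<in> {2..N}" for n
  proof -
    \<comment> \<open>The velocity at n is slaved at the internal stage of the step from n - 1, and
      that step must itself start from an O(\<epsilon>) velocity, whence n - 1 \<ge> 1.\<close>
    define m where "m = n - 1"
    have m: "n = Suc m" "m < N" "1 \<le> m" using that by (auto simp: m_def)
    from second_order_step[OF m(2,3) second_order_induct[of m]] m show ?thesis
      by (intro dominated_add dominated_norm) auto
  qed
  then have "\<exists>C. \<forall>\<^sub>F i in Fl. \<forall>n\<in>{2..N}. norm (?err i n) \<le> C * \<bar>(eps i)\<^sup>2\<bar>"
    by (intro dominated_uniform finite_atLeastAtMost)
  then obtain C where "\<forall>\<^sub>F i in Fl. \<forall>n\<in>{2..N}. norm (?err i n) \<le> C * \<bar>(eps i)\<^sup>2\<bar>" ..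
  then have "\<forall>\<^sub>F i in Fl. \<forall>n\<in>{2..N}. ?err i n \<le> C * (eps i)\<^sup>2"
    by eventually_elim simp
  then show ?thesis by blast
qed

end

end

end

section \<open>Constants shared by all runs\<close>

datatype scheme_run = Run (run_eps: real) (run_Z: "nat \<Rightarrow> state") (run_u: "nat \<Rightarrow> perp")
  (run_Z1: "nat \<Rightarrow> state") (run_u1: "nat \<Rightarrow> perp") (run_lim: "nat \<Rightarrow> state") (run_Y: "nat \<Rightarrow> state")

text \<open>A run carries its own \<epsilon> together with its limit run and corrected run, so a
  single index ranges over everything on which the constants must not depend. The estimates concern
  one \<epsilon> at a time, so a family is treated run by run.\<close>

definition admissible_runs :: "torus_data \<Rightarrow> real \<Rightarrow> nat \<Rightarrow> real \<Rightarrow> state set \<Rightarrow> scheme_run set" where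
  "admissible_runs D h N M K = {R. 0 < run_eps R \<and> run_eps R \<le> 1
     \<and> imex_run D (run_eps R) h N (run_Z R) (run_u R) (run_Z1 R) (run_u1 R)
     \<and> norm (run_Z R 0 - run_lim R 0) \<le> M * run_eps R \<and> norm (run_u R 0) \<le> M
     \<and> run_lim R 0 \<in> K \<and> rk_run (gyro_field D) h 0 N (run_lim R)
     \<and> run_Y R 1 = run_Z R 1 \<and> rk_run (corrected_field D (run_eps R)) h 1 N (run_Y R)}"

text \<open>
  A bound that holds eventually along this filter holds uniformly over all \<open>i \<in> A\<close> for which \<open>e i\<close> is
  below some threshold or \<open>P i\<close> holds; this turns the uniform constants of the theorem into
  asymptotic statements in which thresholds need not be tracked.
\<close>

definition small_eps_filter :: "('i \<Rightarrow> real) \<Rightarrow> 'i set \<Rightarrow> ('i \<Rightarrow> bool) \<Rightarrow> 'i filter" where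
  "small_eps_filter e A P = (INF \<delta>\<in>{0<..}. principal {i \<in> A. e i \<le> \<delta> \<or> P i})"

text \<open>The generating sets shrink with \<delta>, so the minimum of two thresholds shows that
  they form a filter base.\<close>

lemma eventually_small_eps_filter:
  "eventually Q (small_eps_filter e A P) \<longleftrightarrow> (\<exists>\<delta>>0. \<forall>i\<in>A. e i \<le> \<delta> \<or> P i \<longrightarrow> Q i)"
  unfolding small_eps_filter_def
proof (subst eventually_INF_base)
  fix a b :: real assume "a \<in> {0<..}" "b \<in> {0<..}"
  then show "\<exists>x\<in>{0<..}. principal {i \<in> A. e i \<le> x \<or> P i} \<le>
      inf (principal {i \<in> A. e i \<le> a \<or> P i}) (principal {i \<in> A. e i \<le> b \<or> P i})"
    by (intro bexI[of _ "min a b"]) auto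
qed (auto simp: eventually_principal)

lemma eventually_small_eps_filterI:
  "(\<And>i. i \<in> A \<Longrightarrow> Q i) \<Longrightarrow> eventually Q (small_eps_filter e A P)"
  unfolding eventually_small_eps_filter by (auto intro: exI[of _ 1])

lemma eventually_small_eps_filter_alt:
  "0 < \<delta> \<Longrightarrow> \<forall>\<^sub>F i in small_eps_filter e A P. e i \<le> \<delta> \<or> P i"
  unfolding eventually_small_eps_filter by auto

context
  fixes D :: torus_data and h M \<rho> :: real and N :: nat and K :: "state set"
  assumes sa: "standing_assumptions D" and h: "0 < h" and \<rho>: "0 < \<rho>"
    and K: "compact K" "K \<subseteq> state_space D"
begin

lemma admissible_eventually:
  fixes P
  defines "Fl \<equiv> small_eps_filter run_eps (admissible_runs D h N M K) P"
  shows "\<forall>\<^sub>F R in Fl. 0 < run_eps R \<and> run_eps R \<le> 1"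
    "\<forall>\<^sub>F R in Fl. imex_run D (run_eps R) h N (run_Z R) (run_u R) (run_Z1 R) (run_u1 R)"
    "dominated Fl (\<lambda>R. run_Z R 0 - run_lim R 0) run_eps"
    "dominated Fl (\<lambda>R. run_u R 0) (\<lambda>R. 1)"
    "\<forall>\<^sub>F R in Fl. run_lim R 0 \<in> K"
    "\<forall>\<^sub>F R in Fl. rk_run (gyro_field D) h 0 N (run_lim R)"
    "\<forall>\<^sub>F R in Fl. run_Y R 1 = run_Z R 1"
    "\<forall>\<^sub>F R in Fl. rk_run (corrected_field D (run_eps R)) h 1 N (run_Y R)"
  unfolding Fl_def
  by (intro eventually_small_eps_filterI dominatedI[where C = M]; simp add: admissible_runs_def)+

lemma uniform_first_order:
  "\<exists>C \<delta>. 0 < \<delta> \<and> (\<forall>R\<in>admissible_runs D h N M K.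
     run_eps R \<le> \<delta> \<or> imex_confined D \<rho> N (run_Z R) (run_Z1 R) \<longrightarrow>
     (\<forall>n\<in>{1..N}. norm (run_Z R n - run_lim R n) + norm (run_u R n) \<le> C * run_eps R))"
proof -
  let ?Fl = "small_eps_filter run_eps (admissible_runs D h N M K)
      (\<lambda>R. imex_confined D \<rho> N (run_Z R) (run_Z1 R))"
  note a = admissible_eventually
  have "\<exists>C. \<forall>\<^sub>F R in ?Fl. \<forall>n\<in>{1..N}.
      norm (run_Z R n - run_lim R n) + norm (run_u R n) \<le> C * run_eps R"
    by (rule first_order_estimate[OF sa h a(1) K \<rho> a(2-6) eventually_small_eps_filter_alt])
  then show ?thesis unfolding eventually_small_eps_filter by blast
qed

lemma uniform_second_order:
  "\<exists>C \<delta>. 0 < \<delta> \<and> (\<forall>R\<in>admissible_runs D h N M K.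
     run_eps R \<le> \<delta> \<or> imex_confined D \<rho> N (run_Z R) (run_Z1 R) \<and>
       rk_confined D \<rho> (corrected_field D (run_eps R)) h 1 N (run_Y R) \<longrightarrow>
     (\<forall>n\<in>{2..N}. norm (run_Z R n - run_Y R n) + norm (run_u R n
       - slaved D (run_eps R) (stage_time h (real (n - 1) * h))
           (rk_stage (corrected_field D (run_eps R)) h (real (n - 1) * h) (run_Y R (n - 1))))
       \<le> C * (run_eps R)\<^sup>2))"
proof -
  let ?P = "\<lambda>R. imex_confined D \<rho> N (run_Z R) (run_Z1 R) \<and>
       rk_confined D \<rho> (corrected_field D (run_eps R)) h 1 N (run_Y R)"
  let ?Fl = "small_eps_filter run_eps (admissible_runs D h N M K) ?P"
  note a = admissible_eventually
  have "\<forall>\<^sub>F R in ?Fl. run_eps R \<le> \<delta> \<or> imex_confined D \<rho> N (run_Z R) (run_Z1 R)"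
    and "\<forall>\<^sub>F R in ?Fl. run_eps R \<le> \<delta> \<or> rk_confined D \<rho> (corrected_field D (run_eps R)) h 1 N (run_Y R)"
    if "0 < \<delta>" for \<delta>
    using eventually_small_eps_filter_alt[OF that, where e = run_eps and A = "admissible_runs D h N M K" and P = ?P]
    by (auto elim: eventually_mono)
  note conf = this
  have "\<exists>C. \<forall>\<^sub>F R in ?Fl. \<forall>n\<in>{2..N}. norm (run_Z R n - run_Y R n) + norm (run_u R n
       - slaved D (run_eps R) (stage_time h (real (n - 1) * h))
           (rk_stage (corrected_field D (run_eps R)) h (real (n - 1) * h) (run_Y R (n - 1))))
       \<le> C * (run_eps R)\<^sup>2"
    by (rule second_order_estimate[OF sa h a(1) K \<rho> a(2-6) conf(1) a(7,8) conf(2)])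
  then show ?thesis unfolding eventually_small_eps_filter by blast
qed

end

theorem proposition4p4:
  fixes D :: torus_data and h T :: real
  assumes "standing_assumptions D" and "0 < h" and "0 < T"
  shows
    "(\<forall>Z u Z1 u1 Z0 Zlim.
        Z0 \<in> state_space D \<and>
        (\<forall>\<epsilon>\<in>{0<..1}. imex_run D \<epsilon> h (num_steps T h) (Z \<epsilon>) (u \<epsilon>) (Z1 \<epsilon>) (u1 \<epsilon>)) \<and>
        ((\<lambda>\<epsilon>. Z \<epsilon> 0) \<longlongrightarrow> Z0) (at_right 0) \<and>
        ((\<lambda>\<epsilon>. sqrt \<epsilon> *\<^sub>R u \<epsilon> 0) \<longlongrightarrow> 0) (at_right 0) \<and>
        Zlim 0 = Z0 \<and> rk_run (gyro_field D) h 0 (num_steps T h) Zlim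
        \<longrightarrow> (\<forall>n\<in>{1..num_steps T h}.
              ((\<lambda>\<epsilon>. Z \<epsilon> n) \<longlongrightarrow> Zlim n) (at_right 0) \<and>
              ((\<lambda>\<epsilon>. u \<epsilon> n) \<longlongrightarrow> 0) (at_right 0)))
     \<and> consistent_second_order (rk_step (gyro_field D)) (gyro_field D) (state_space D)
     \<and> (\<forall>M>0. \<forall>\<rho>>0. \<forall>K. compact K \<and> K \<subseteq> state_space D \<longrightarrow>
         (\<exists>C \<epsilon>0. 0 < \<epsilon>0 \<and>
           (\<forall>Z u Z1 u1 Z0 Zlim Y.
              Z0 \<in> K \<and>
              (\<forall>\<epsilon>\<in>{0<..1}.
                 imex_run D \<epsilon> h (num_steps T h) (Z \<epsilon>) (u \<epsilon>) (Z1 \<epsilon>) (u1 \<epsilon>) \<and>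
                 norm ((1 / \<epsilon>) *\<^sub>R (Z \<epsilon> 0 - Z0), u \<epsilon> 0) \<le> M \<and>
                 Y \<epsilon> 1 = Z \<epsilon> 1 \<and>
                 rk_run (corrected_field D \<epsilon>) h 1 (num_steps T h) (Y \<epsilon>)) \<and>
              Zlim 0 = Z0 \<and> rk_run (gyro_field D) h 0 (num_steps T h) Zlim
              \<longrightarrow> (\<forall>\<epsilon>\<in>{0<..1}.
                    (\<epsilon> \<le> \<epsilon>0 \<or> imex_confined D \<rho> (num_steps T h) (Z \<epsilon>) (Z1 \<epsilon>) \<longrightarrow>
                      (\<forall>n\<in>{1..num_steps T h}.
                         norm (Z \<epsilon> n - Zlim n) + norm (u \<epsilon> n) \<le> C * \<epsilon>)) \<and>
                    (\<epsilon> \<le> \<epsilon>0 \<or>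
                      imex_confined D \<rho> (num_steps T h) (Z \<epsilon>) (Z1 \<epsilon>) \<and>
                      rk_confined D \<rho> (corrected_field D \<epsilon>) h 1 (num_steps T h) (Y \<epsilon>) \<longrightarrow>
                      (\<forall>n\<in>{2..num_steps T h}.
                         norm (Z \<epsilon> n - Y \<epsilon> n)
                         + norm (u \<epsilon> n
                             - slaved D \<epsilon> (stage_time h (real (n - 1) * h))
                                 (rk_stage (corrected_field D \<epsilon>) h (real (n - 1) * h) (Y \<epsilon> (n - 1))))
                         \<le> C * \<epsilon>\<^sup>2))))))
     \<and> (\<forall>\<epsilon>\<in>{0<..1}.
         consistent_second_order (rk_step (corrected_field D \<epsilon>)) (corrected_field D \<epsilon>) (state_space D))"
proof -
  let ?N = "num_steps T h"
  note sa = assms(1) and h = assms(2)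
  let ?hyp = "\<lambda>M K Z u Z1 u1 Z0 Zlim Y. Z0 \<in> K \<and>
    (\<forall>\<epsilon>\<in>{0<..1}. imex_run D \<epsilon> h ?N (Z \<epsilon>) (u \<epsilon>) (Z1 \<epsilon>) (u1 \<epsilon>) \<and>
       norm ((1 / \<epsilon>) *\<^sub>R (Z \<epsilon> 0 - Z0), u \<epsilon> 0) \<le> M \<and> Y \<epsilon> 1 = Z \<epsilon> 1 \<and>
       rk_run (corrected_field D \<epsilon>) h 1 ?N (Y \<epsilon>)) \<and>
    Zlim 0 = Z0 \<and> rk_run (gyro_field D) h 0 ?N Zlim"
  let ?first = "\<lambda>C \<epsilon> Z u Zlim. \<forall>n\<in>{1..?N}. norm (Z \<epsilon> n - Zlim n) + norm (u \<epsilon> n) \<le> C * \<epsilon>"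
  let ?second = "\<lambda>C \<epsilon> Z u Y. \<forall>n\<in>{2..?N}. norm (Z \<epsilon> n - Y \<epsilon> n) + norm (u \<epsilon> n
    - slaved D \<epsilon> (stage_time h (real (n - 1) * h))
        (rk_stage (corrected_field D \<epsilon>) h (real (n - 1) * h) (Y \<epsilon> (n - 1)))) \<le> C * \<epsilon>\<^sup>2"
  have iii: "\<exists>C \<epsilon>0. 0 < \<epsilon>0 \<and> (\<forall>Z u Z1 u1 Z0 Zlim Y. ?hyp M K Z u Z1 u1 Z0 Zlim Y \<longrightarrow>
      (\<forall>\<epsilon>\<in>{0<..1}. (\<epsilon> \<le> \<epsilon>0 \<or> imex_confined D \<rho> ?N (Z \<epsilon>) (Z1 \<epsilon>) \<longrightarrow> ?first C \<epsilon> Z u Zlim) \<and>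
        (\<epsilon> \<le> \<epsilon>0 \<or> imex_confined D \<rho> ?N (Z \<epsilon>) (Z1 \<epsilon>) \<and>
           rk_confined D \<rho> (corrected_field D \<epsilon>) h 1 ?N (Y \<epsilon>) \<longrightarrow> ?second C \<epsilon> Z u Y)))"
    if \<rho>: "0 < \<rho>" and K: "compact K" "K \<subseteq> state_space D" for M \<rho> :: real and K
  proof -
    obtain C1 \<delta>1 where 1: "0 < \<delta>1" "\<And>R. R \<in> admissible_runs D h ?N M K \<Longrightarrow>
        run_eps R \<le> \<delta>1 \<or> imex_confined D \<rho> ?N (run_Z R) (run_Z1 R) \<Longrightarrow>
        \<forall>n\<in>{1..?N}. norm (run_Z R n - run_lim R n) + norm (run_u R n) \<le> C1 * run_eps R"
      using uniform_first_order[OF sa h \<rho> K] by metis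
    obtain C2 \<delta>2 where 2: "0 < \<delta>2" "\<And>R. R \<in> admissible_runs D h ?N M K \<Longrightarrow>
        run_eps R \<le> \<delta>2 \<or> imex_confined D \<rho> ?N (run_Z R) (run_Z1 R) \<and>
          rk_confined D \<rho> (corrected_field D (run_eps R)) h 1 ?N (run_Y R) \<Longrightarrow>
        \<forall>n\<in>{2..?N}. norm (run_Z R n - run_Y R n) + norm (run_u R n
          - slaved D (run_eps R) (stage_time h (real (n - 1) * h))
              (rk_stage (corrected_field D (run_eps R)) h (real (n - 1) * h) (run_Y R (n - 1))))
          \<le> C2 * (run_eps R)\<^sup>2"
      using uniform_second_order[OF sa h \<rho> K] by metis
    \<comment> \<open>The larger constant and the smaller threshold serve both estimates at
      once.\<close>
    have bounds: "(\<epsilon> \<le> min \<delta>1 \<delta>2 \<or> imex_confined D \<rho> ?N (Z \<epsilon>) (Z1 \<epsilon>) \<longrightarrow> ?first (max C1 C2) \<epsilon> Z u Zlim) \<and>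
        (\<epsilon> \<le> min \<delta>1 \<delta>2 \<or> imex_confined D \<rho> ?N (Z \<epsilon>) (Z1 \<epsilon>) \<and>
           rk_confined D \<rho> (corrected_field D \<epsilon>) h 1 ?N (Y \<epsilon>) \<longrightarrow> ?second (max C1 C2) \<epsilon> Z u Y)"
      if hyp: "?hyp M K Z u Z1 u1 Z0 Zlim Y" and \<epsilon>: "\<epsilon> \<in> {0<..1}"
      for Z u Z1 u1 Z0 Zlim Y and \<epsilon> :: real
    proof (intro conjI impI)
      \<comment> \<open>Freezing \<epsilon> turns one member of the family into an admissible run,
        to which the uniform constants apply.\<close>
      let ?R = "Run \<epsilon> (Z \<epsilon>) (u \<epsilon>) (Z1 \<epsilon>) (u1 \<epsilon>) Zlim (Y \<epsilon>)"
      have b: "norm ((1 / \<epsilon>) *\<^sub>R (Z \<epsilon> 0 - Z0), u \<epsilon> 0) \<le> M" using hyp \<epsilon> by blast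
      have "norm ((1 / \<epsilon>) *\<^sub>R (Z \<epsilon> 0 - Z0)) \<le> M" "norm (u \<epsilon> 0) \<le> M"
        using order_trans[OF norm_fst_le b] order_trans[OF norm_snd_le b] by auto
      moreover from this(1) have "norm (Z \<epsilon> 0 - Z0) \<le> M * \<epsilon>"
        using \<epsilon> by (simp add: pos_divide_le_eq)
      ultimately have R: "?R \<in> admissible_runs D h ?N M K"
        using hyp \<epsilon> by (auto simp: admissible_runs_def)
      have C: "C1 * \<epsilon> \<le> max C1 C2 * \<epsilon>" "C2 * \<epsilon>\<^sup>2 \<le> max C1 C2 * \<epsilon>\<^sup>2"
        using \<epsilon> by (auto intro!: mult_right_mono)
      show "?first (max C1 C2) \<epsilon> Z u Zlim"
        if "\<epsilon> \<le> min \<delta>1 \<delta>2 \<or> imex_confined D \<rho> ?N (Z \<epsilon>) (Z1 \<epsilon>)"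
        using 1(2)[OF R] that C(1) by (fastforce intro: order_trans)
      show "?second (max C1 C2) \<epsilon> Z u Y"
        if "\<epsilon> \<le> min \<delta>1 \<delta>2 \<or> imex_confined D \<rho> ?N (Z \<epsilon>) (Z1 \<epsilon>) \<and>
          rk_confined D \<rho> (corrected_field D \<epsilon>) h 1 ?N (Y \<epsilon>)"
        using 2(2)[OF R] that C(2) by (fastforce intro: order_trans)
    qed
    have pos: "0 < min \<delta>1 \<delta>2" using 1(1) 2(1) by simp
    show ?thesis
      by (rule exI[of _ "max C1 C2"], rule exI[of _ "min \<delta>1 \<delta>2"], rule conjI[OF pos],
          intro allI impI, rule ballI, rule bounds)
  qed
  show ?thesis
  proof (intro conjI consistent_gyro[OF sa] ballI consistent_corrected[OF sa], goal_cases)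
    case 1
    show ?case
      by (intro allI impI ballI, elim conjE) (rule imex_run_tendsto[OF sa h])
  next
    case 2
    show ?case by (intro allI impI, elim conjE) (rule iii)
  qed
qed

end
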